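(* Let $x_0\in\mathbb R^3$, $t_0\in\mathbb R$, $r>0$, $0<\rho\le\frac14$, $0<\ell\le\rho r$, and let $(u,p)$ be a suitable weak solution of the Navier–Stokes equations $\partial_tu-\Delta u+(u\cdot\nabla)u+\nabla p=0$, $\operatorname{div}u=0$ on the whole space $\mathbb R^3$, on a time interval containing $I_r=(t_0-r^2,t_0)$. Let $s_0<s_1$ with $[s_0,s_1]\subset I_r$, and let $\chi\in C^\infty(\mathbb R^3\times[s_0,s_1])$ be nonnegative and compactly supported in the spatial variable. Then $$\mathcal E_\chi(s_1)-\mathcal E_\chi(s_0)+\mathcal P_\chi=\mathcal V_\chi^{\mathrm{near}}+\mathcal V_\chi^{\mathrm{rem}}+\mathcal R_\chi+\mathcal L_\chi,$$ where $$\mathcal E_\chi(t)=\frac r2\int_{\mathbb R^3}\chi(x,t)|\Omega_\ell(x,t)|^2\,dx,\qquad \mathcal P_\chi=r\int_{s_0}^{s_1}\!\!\int_{\mathbb R^3}\chi|\nabla\Omega_\ell|^2\,dx\,dt,$$ $$\mathcal V_\chi^{\mathrm{near}}=r\int_{s_0}^{s_1}\!\!\int_{\mathbb R^3}\chi\,\mathbb S_\ell^{\mathrm{near}}\Omega_\ell\cdot\Omega_\ell\,dx\,dt,\qquad \mathcal V_\chi^{\mathrm{rem}}=r\int_{s_0}^{s_1}\!\!\int_{\mathbb R^3}\chi\,\mathbb S_\ell^{\mathrm{rem}}\Omega_\ell\cdot\Omega_\ell\,dx\,dt,$$ $$\mathcal R_\chi=r\int_{s_0}^{s_1}\!\!\int_{\mathbb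 R^3}\chi F_\ell\cdot\Omega_\ell\,dx\,dt,\qquad \mathcal L_\chi=\frac r2\int_{s_0}^{s_1}\!\!\int_{\mathbb R^3}|\Omega_\ell|^2\bigl(\partial_t\chi+\Delta\chi+U_\ell\cdot\nabla\chi\bigr)\,dx\,dt.$$
   Context: Filter: $\varphi\in C_c^\infty(B_1(0))$, $\varphi\ge0$, $\int\varphi=1$, $\varphi_\ell(x)=\ell^{-3}\varphi(x/\ell)$; all convolutions are in space. $U_\ell=\varphi_\ell*u$, $\Omega_\ell=\operatorname{curl}U_\ell$, $\mathbb S_\ell=\frac12(\nabla U_\ell+\nabla U_\ell^T)$, commutator stress $R_\ell=\varphi_\ell*(u\otimes u)-U_\ell\otimes U_\ell$, commutator forcing $F_\ell=-\operatorname{curl}\operatorname{div}R_\ell$. Kernel cutoff: $\vartheta\in C_c^\infty(B_1(0))$ is radial, $0\le\vartheta\le1$, $\vartheta\equiv1$ on $B_{1/2}(0)$. Near-field strain (with $\widehat z=z/|z|$): $$\mathbb S_\ell^{\mathrm{near}}(x,t)=\frac{3}{8\pi}\,\mathrm{p.v.}\!\int_{\mathbb R^3}\vartheta\!\left(\frac z{\rho r}\right)\frac{(\widehat z\times\Omega_\ell(x-z,t))\otimes\widehat z+\widehat z\otimes(\widehat z\times\Omega_\ell(x-z,t))}{|z|^3}\,dz,$$ and $\mathbb S_\ell^{\mathrm{rem}}=\mathbb S_\ell-\mathbb S_\ell^{\mathrm{near}}$. *)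

theory Defs
  imports "HOL-Analysis.Analysis"
begin

unbundle no cross3_syntax
unbundle set_product_syntax

section \<open>Smooth functions and differential operators\<close>

text \<open>
  Derivatives are taken within the set S, so that on a slab such as
  \<open>UNIV \<times> {a..b}\<close> this is smoothness up to the boundary.
\<close>

primrec Ck_on :: "nat \<Rightarrow> 'a::real_normed_vector set \<Rightarrow> ('a \<Rightarrow> 'b::real_normed_vector) \<Rightarrow> bool" where
  "Ck_on 0 S f \<longleftrightarrow> continuous_on S f"
| "Ck_on (Suc k) S f \<longleftrightarrow>
     (\<exists>f'. (\<forall>x\<in>S. (f has_derivative f' x) (at x within S)) \<and> (\<forall>v. Ck_on k S (\<lambda>x. f' x v)))"

definition smooth_on :: "'a::real_normed_vector set \<Rightarrow> ('a \<Rightarrow> 'b::real_normed_vector) \<Rightarrow> bool" where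
  "smooth_on S f \<longleftrightarrow> (\<forall>k. Ck_on k S f)"

definition test_function :: "'a::real_normed_vector set \<Rightarrow> ('a \<Rightarrow> 'b::real_normed_vector) \<Rightarrow> bool" where
  "test_function D f \<longleftrightarrow>
     smooth_on UNIV f \<and> compact (closure {x. f x \<noteq> 0}) \<and> closure {x. f x \<noteq> 0} \<subseteq> D"

definition pd :: "3 \<Rightarrow> (real^3 \<Rightarrow> 'b::real_normed_vector) \<Rightarrow> real^3 \<Rightarrow> 'b" where
  "pd i f x = frechet_derivative f (at x) (axis i 1)"

definition grad :: "(real^3 \<Rightarrow> real) \<Rightarrow> real^3 \<Rightarrow> real^3" where
  "grad f x = (\<chi> i. pd i f x)"

definition laplacian :: "(real^3 \<Rightarrow> 'b::real_normed_vector) \<Rightarrow> real^3 \<Rightarrow> 'b" where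
  "laplacian f x = (\<Sum>i\<in>UNIV. pd i (pd i f) x)"

definition divergence :: "(real^3 \<Rightarrow> real^3) \<Rightarrow> real^3 \<Rightarrow> real" where
  "divergence f x = (\<Sum>i\<in>UNIV. pd i f x $ i)"

definition div_matrix :: "(real^3 \<Rightarrow> real^3^3) \<Rightarrow> real^3 \<Rightarrow> real^3" where
  "div_matrix A x = (\<chi> i. \<Sum>j\<in>UNIV. pd j A x $ i $ j)"

definition curl :: "(real^3 \<Rightarrow> real^3) \<Rightarrow> real^3 \<Rightarrow> real^3" where
  "curl f x = vector [pd 2 f x $ 3 - pd 3 f x $ 2,
                      pd 3 f x $ 1 - pd 1 f x $ 3,
                      pd 1 f x $ 2 - pd 2 f x $ 1]"

definition outer :: "real^3 \<Rightarrow> real^3 \<Rightarrow> real^3^3" where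
  "outer a b = (\<chi> i j. a $ i * b $ j)"


section \<open>Suitable weak solutions of the Navier--Stokes equations\<close>

text \<open>
  G is the distributional spatial gradient of u on \<open>\<real>\<^sup>3 \<times> J\<close>, with
  \<open>G\<^sub>i\<^sub>j = \<partial>\<^sub>j u\<^sub>i\<close>, the convention of \<^const>\<open>jacobian\<close>. The inner product on
  \<open>real^3^3\<close> is the Frobenius one.
\<close>

definition weak_gradient ::
  "real set \<Rightarrow> (real^3 \<Rightarrow> real \<Rightarrow> real^3) \<Rightarrow> (real^3 \<Rightarrow> real \<Rightarrow> real^3^3) \<Rightarrow> bool" where
  "weak_gradient J u G \<longleftrightarrow>
     (\<forall>\<psi> :: real^3 \<Rightarrow> real \<Rightarrow> real. \<forall>i j.
        test_function (UNIV \<times> J) (\<lambda>(x, t). \<psi> x t) \<longrightarrow>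
        (LINT (x, t)|lebesgue. u x t $ i * pd j (\<lambda>y. \<psi> y t) x)
          = - (LINT (x, t)|lebesgue. G x t $ i $ j * \<psi> x t))"

text \<open>
  Local energy class: \<open>u \<in> L\<^sup>\<infinity>\<^sub>t L\<^sup>2\<^sub>x\<close> and \<open>\<nabla>u \<in> L\<^sup>2\<close>, both locally in space-time,
  with gradient G.
\<close>

definition local_energy_class ::
  "real set \<Rightarrow> (real^3 \<Rightarrow> real \<Rightarrow> real^3) \<Rightarrow> (real^3 \<Rightarrow> real \<Rightarrow> real^3^3) \<Rightarrow> bool" where
  "local_energy_class J u G \<longleftrightarrow>
     (\<lambda>(x, t). u x t) \<in> borel_measurable (lebesgue_on (UNIV \<times> J)) \<and>
     (\<lambda>(x, t). G x t) \<in> borel_measurable (lebesgue_on (UNIV \<times> J)) \<and>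
     (\<forall>R a b. {a..b} \<subseteq> J \<longrightarrow>
        (\<exists>C. AE t\<in>{a..b} in lebesgue. (LINT x:cball 0 R|lebesgue. (norm (u x t))\<^sup>2) \<le> C)) \<and>
     (\<forall>K. compact K \<and> K \<subseteq> UNIV \<times> J \<longrightarrow>
        set_integrable lebesgue K (\<lambda>(x, t). (norm (G x t))\<^sup>2)) \<and>
     weak_gradient J u G"

text \<open>
  A solution of the energy class is defined only up to null sets in time. As usual, u denotes
  its representative that is weakly continuous in time, so that \<open>u(\<cdot>, t)\<close> is meaningful at
  every t.
\<close>

definition weakly_continuous_in_time :: "real set \<Rightarrow> (real^3 \<Rightarrow> real \<Rightarrow> real^3) \<Rightarrow> bool" where
  "weakly_continuous_in_time J u \<longleftrightarrow>
     (\<forall>t\<in>J. (\<lambda>x. u x t) \<in> borel_measurable lebesgue \<and>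
        (\<forall>R. set_integrable lebesgue (cball 0 R) (\<lambda>x. (norm (u x t))\<^sup>2))) \<and>
     (\<forall>w :: real^3 \<Rightarrow> real^3. test_function UNIV w \<longrightarrow>
        continuous_on J (\<lambda>t. LINT x|lebesgue. u x t \<bullet> w x))"

definition pressure_class :: "real set \<Rightarrow> (real^3 \<Rightarrow> real \<Rightarrow> real) \<Rightarrow> bool" where
  "pressure_class J p \<longleftrightarrow>
     (\<lambda>(x, t). p x t) \<in> borel_measurable (lebesgue_on (UNIV \<times> J)) \<and>
     (\<forall>K. compact K \<and> K \<subseteq> UNIV \<times> J \<longrightarrow>
        set_integrable lebesgue K (\<lambda>(x, t). \<bar>p x t\<bar> powr (3/2)))"

text \<open>
  The equations hold in the sense of distributions, with \<open>(u \<cdot> \<nabla>)u = div (u \<otimes> u)\<close>.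
\<close>

definition weak_navier_stokes ::
  "real set \<Rightarrow> (real^3 \<Rightarrow> real \<Rightarrow> real^3) \<Rightarrow> (real^3 \<Rightarrow> real \<Rightarrow> real) \<Rightarrow> bool" where
  "weak_navier_stokes J u p \<longleftrightarrow>
     (\<forall>\<psi> :: real^3 \<Rightarrow> real \<Rightarrow> real^3. test_function (UNIV \<times> J) (\<lambda>(x, t). \<psi> x t) \<longrightarrow>
        (LINT (x, t)|lebesgue.
           u x t \<bullet> vector_derivative (\<lambda>s. \<psi> x s) (at t)
           + u x t \<bullet> laplacian (\<lambda>y. \<psi> y t) x
           + outer (u x t) (u x t) \<bullet> jacobian (\<lambda>y. \<psi> y t) (at x)
           + p x t * divergence (\<lambda>y. \<psi> y t) x) = 0) \<and>
     (\<forall>\<psi> :: real^3 \<Rightarrow> real \<Rightarrow> real. test_function (UNIV \<times> J) (\<lambda>(x, t). \<psi> x t) \<longrightarrow>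
        (LINT (x, t)|lebesgue. u x t \<bullet> grad (\<lambda>y. \<psi> y t) x) = 0)"

definition local_energy_inequality ::
  "real set \<Rightarrow> (real^3 \<Rightarrow> real \<Rightarrow> real^3) \<Rightarrow> (real^3 \<Rightarrow> real \<Rightarrow> real^3^3)
    \<Rightarrow> (real^3 \<Rightarrow> real \<Rightarrow> real) \<Rightarrow> bool" where
  "local_energy_inequality J u G p \<longleftrightarrow>
     (\<forall>\<psi> :: real^3 \<Rightarrow> real \<Rightarrow> real.
        test_function (UNIV \<times> J) (\<lambda>(x, t). \<psi> x t) \<and> (\<forall>x t. 0 \<le> \<psi> x t) \<longrightarrow>
        2 * (LINT (x, t)|lebesgue. (norm (G x t))\<^sup>2 * \<psi> x t)
          \<le> (LINT (x, t)|lebesgue.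
               (norm (u x t))\<^sup>2
                 * (vector_derivative (\<lambda>s. \<psi> x s) (at t) + laplacian (\<lambda>y. \<psi> y t) x)
               + ((norm (u x t))\<^sup>2 + 2 * p x t) * (u x t \<bullet> grad (\<lambda>y. \<psi> y t) x)))"

text \<open>
  The time interval J need not be open; all conditions are imposed on the open set
  \<open>\<real>\<^sup>3 \<times> interior J\<close>.
\<close>

definition suitable_weak_solution ::
  "real set \<Rightarrow> (real^3 \<Rightarrow> real \<Rightarrow> real^3) \<Rightarrow> (real^3 \<Rightarrow> real \<Rightarrow> real) \<Rightarrow> bool" where
  "suitable_weak_solution J u p \<longleftrightarrow>
     weakly_continuous_in_time (interior J) u \<and>
     pressure_class (interior J) p \<and>
     weak_navier_stokes (interior J) u p \<and>
     (\<exists>G. local_energy_class (interior J) u G \<and> local_energy_inequality (interior J) u G p)"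


section \<open>Filtered fields\<close>

definition convolution ::
  "(real^3 \<Rightarrow> real) \<Rightarrow> (real^3 \<Rightarrow> 'b::euclidean_space) \<Rightarrow> real^3 \<Rightarrow> 'b" where
  "convolution k f x = (LINT y|lebesgue. k (x - y) *\<^sub>R f y)"

definition rescaled :: "(real^3 \<Rightarrow> real) \<Rightarrow> real \<Rightarrow> real^3 \<Rightarrow> real" where
  "rescaled \<phi> l x = \<phi> (x /\<^sub>R l) / l ^ 3"

definition filtered_velocity ::
  "(real^3 \<Rightarrow> real) \<Rightarrow> real \<Rightarrow> (real^3 \<Rightarrow> real \<Rightarrow> real^3) \<Rightarrow> real^3 \<Rightarrow> real \<Rightarrow> real^3" where
  "filtered_velocity \<phi> l u x t = convolution (rescaled \<phi> l) (\<lambda>y. u y t) x"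

definition filtered_vorticity ::
  "(real^3 \<Rightarrow> real) \<Rightarrow> real \<Rightarrow> (real^3 \<Rightarrow> real \<Rightarrow> real^3) \<Rightarrow> real^3 \<Rightarrow> real \<Rightarrow> real^3" where
  "filtered_vorticity \<phi> l u x t = curl (\<lambda>y. filtered_velocity \<phi> l u y t) x"

definition filtered_strain ::
  "(real^3 \<Rightarrow> real) \<Rightarrow> real \<Rightarrow> (real^3 \<Rightarrow> real \<Rightarrow> real^3) \<Rightarrow> real^3 \<Rightarrow> real \<Rightarrow> real^3^3" where
  "filtered_strain \<phi> l u x t =
     (let D = jacobian (\<lambda>y. filtered_velocity \<phi> l u y t) (at x) in (1/2) *\<^sub>R (D + transpose D))"

definition commutator_stress ::
  "(real^3 \<Rightarrow> real) \<Rightarrow> real \<Rightarrow> (real^3 \<Rightarrow> real \<Rightarrow> real^3) \<Rightarrow> real^3 \<Rightarrow> real \<Rightarrow> real^3^3" where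
  "commutator_stress \<phi> l u x t =
     convolution (rescaled \<phi> l) (\<lambda>y. outer (u y t) (u y t)) x
     - outer (filtered_velocity \<phi> l u x t) (filtered_velocity \<phi> l u x t)"

definition commutator_forcing ::
  "(real^3 \<Rightarrow> real) \<Rightarrow> real \<Rightarrow> (real^3 \<Rightarrow> real \<Rightarrow> real^3) \<Rightarrow> real^3 \<Rightarrow> real \<Rightarrow> real^3" where
  "commutator_forcing \<phi> l u x t = - curl (div_matrix (\<lambda>y. commutator_stress \<phi> l u y t)) x"

text \<open>
  Here \<open>d\<close> is the near-field radius \<open>\<rho> r\<close>, and \<open>sgn z\<close> is the unit vector \<open>z/|z|\<close>.
  The principal value is the limit of integrals over \<open>|z| > \<epsilon>\<close> as \<open>\<epsilon>\<close> decreases to 0.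
\<close>

definition near_strain ::
  "(real^3 \<Rightarrow> real) \<Rightarrow> real \<Rightarrow> (real^3 \<Rightarrow> real) \<Rightarrow> real \<Rightarrow> (real^3 \<Rightarrow> real \<Rightarrow> real^3)
    \<Rightarrow> real^3 \<Rightarrow> real \<Rightarrow> real^3^3" where
  "near_strain \<theta> d \<phi> l u x t =
     (3 / (8 * pi)) *\<^sub>R
       Lim (at_right 0) (\<lambda>\<epsilon>. LINT z:{z. \<epsilon> < norm z}|lebesgue.
         (\<theta> (z /\<^sub>R d) / norm z ^ 3) *\<^sub>R
           (outer (cross3 (sgn z) (filtered_vorticity \<phi> l u (x - z) t)) (sgn z)
            + outer (sgn z) (cross3 (sgn z) (filtered_vorticity \<phi> l u (x - z) t))))"

definition rem_strain ::
  "(real^3 \<Rightarrow> real) \<Rightarrow> real \<Rightarrow> (real^3 \<Rightarrow> real) \<Rightarrow> real \<Rightarrow> (real^3 \<Rightarrow> real \<Rightarrow> real^3)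
    \<Rightarrow> real^3 \<Rightarrow> real \<Rightarrow> real^3^3" where
  "rem_strain \<theta> d \<phi> l u x t = filtered_strain \<phi> l u x t - near_strain \<theta> d \<phi> l u x t"

end

theory Submission
  imports Defs
begin

text \<open>
  Testing the weak equation with \<open>g(t)\<close> times the divergence-free field
  \<open>(\<partial>\<^sub>a \<phi>\<^sub>l)(x - \<cdot>) e\<^sub>b - (\<partial>\<^sub>b \<phi>\<^sub>l)(x - \<cdot>) e\<^sub>a\<close> removes the pressure and shows that, for fixed x,
  the components of \<open>\<Omega>\<^sub>l(x, \<cdot>)\<close> are Lipschitz in time with a bounded measurable derivative, namely
  \<open>\<Delta>\<Omega>\<^sub>l - curl div (\<phi>\<^sub>l * (u \<otimes> u))\<close>. Splitting the quadratic term into transport, stretching and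
  \<open>F\<^sub>l\<close> (this uses \<open>div U\<^sub>l = 0\<close>) and multiplying by \<open>\<eta> \<Omega>\<^sub>l\<close>, the time derivative of \<open>\<eta> |\<Omega>\<^sub>l|\<^sup>2\<close> equals the
  integrands of the claimed identity up to the divergence of a compactly supported \<open>C\<^sup>1\<close> field.
  Only \<open>u \<otimes> u\<close> is irregular in time, and its filtered versions are bounded for almost every time, so
  Fubini applies. The near-field kernel has mean zero over spheres, so the principal value is the absolutely
  convergent integral of the kernel against \<open>\<Omega>\<^sub>l(x - z) - \<Omega>\<^sub>l(x)\<close>, hence continuous in \<open>(x, t)\<close>; this
  makes the near and remainder stretching terms separately integrable.
\<close>

section \<open>Smooth functions\<close>

text \<open>The difficulty is what is known at which times. Weak continuity gives \<open>u\<close> a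
  meaning at each single time and makes its pairings with test fields continuous, whereas joint
  measurability holds only up to a null set of space-time and the energy is bounded only for almost
  every time. Bounds for quantities linear in \<open>u\<close> are therefore promoted from almost
  every time to every time by continuity. Quadratic quantities allow no such step: under time
  integrals they are replaced by versions built from a Borel representative of \<open>u\<close>,
  which agree with the original ones for almost every time and then at all points at once. The
  balance is derived at fixed \<open>x\<close> by integrating in time, but the divergence is removed
  at fixed time by integrating in space; the exchange of the two orders is where the
  almost-everywhere bounds are spent. The forcing term is the one whose measurability in time is not
  known beforehand; it is read off from the balance, in which all other terms are
  integrable.\<close>

lemma Ck_on_SucD: "Ck_on (Suc k) S f \<Longrightarrow> Ck_on k S f"
proof (induction k arbitrary: f)
  case 0
  then show ?case
    by (auto intro: has_derivative_continuous_on)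
next
  case (Suc k)
  then obtain f' where "\<forall>x\<in>S. (f has_derivative f' x) (at x within S)"
    and "\<forall>v. Ck_on (Suc k) S (\<lambda>x. f' x v)"
    by auto
  with Suc.IH show ?case
    by auto
qed

lemma Ck_on_continuous: "Ck_on k S f \<Longrightarrow> continuous_on S f"
  by (induction k) (use Ck_on_SucD in auto)

lemma Ck_on_const: "Ck_on k S (\<lambda>_. c)"
proof (induction k arbitrary: c)
  case (Suc k)
  show ?case
    unfolding Ck_on.simps by (rule exI[of _ "\<lambda>_ _. 0"]) (auto simp: Suc)
qed auto

lemma Ck_on_add: "Ck_on k S f \<Longrightarrow> Ck_on k S g \<Longrightarrow> Ck_on k S (\<lambda>x. f x + g x)"
proof (induction k arbitrary: f g)
  case (Suc k)
  obtain f' g' where "\<forall>x\<in>S. (f has_derivative f' x) (at x within S)" "\<forall>v. Ck_on k S (\<lambda>x. f' x v)"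
    "\<forall>x\<in>S. (g has_derivative g' x) (at x within S)" "\<forall>v. Ck_on k S (\<lambda>x. g' x v)"
    using Suc.prems by auto
  then show ?case
    unfolding Ck_on.simps
    by (intro exI[of _ "\<lambda>x v. f' x v + g' x v"]) (auto intro: derivative_intros Suc.IH)
qed (auto intro: continuous_intros)

text \<open>The derivative of the product contains \<open>f\<close> and \<open>g\<close>
  undifferentiated, so the induction uses them one order lower, by
  \<open>Ck_on_SucD\<close>.\<close>

lemma Ck_on_scaleR:
  "Ck_on k S f \<Longrightarrow> Ck_on k S g \<Longrightarrow> Ck_on k S (\<lambda>x. f x *\<^sub>R g x)"
proof (induction k arbitrary: f g)
  case (Suc k)
  obtain f' g' where fg: "\<forall>x\<in>S. (f has_derivative f' x) (at x within S)" "\<forall>v. Ck_on k S (\<lambda>x. f' x v)"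
    "\<forall>x\<in>S. (g has_derivative g' x) (at x within S)" "\<forall>v. Ck_on k S (\<lambda>x. g' x v)"
    using Suc.prems by auto
  have "Ck_on k S f" "Ck_on k S g"
    using Suc.prems Ck_on_SucD by auto
  with fg show ?case
    unfolding Ck_on.simps
    by (intro exI[of _ "\<lambda>x v. f x *\<^sub>R g' x v + f' x v *\<^sub>R g x"])
       (auto intro!: derivative_intros Ck_on_add Suc.IH)
qed (auto intro: continuous_intros)

text \<open>An affine substitution turns the derivative in direction \<open>v\<close> into the
  derivative in the fixed direction \<open>T v\<close>, taken at the affine image, so the claim
  reproduces itself at each order. Scaling, translation, reflection, restriction to a line and
  projection to a factor are all of this kind.\<close>

lemma Ck_on_affine:
  assumes "bounded_linear T" "Ck_on k S f" "\<And>x. x \<in> S' \<Longrightarrow> T x + c \<in> S"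
  shows "Ck_on k S' (\<lambda>x. f (T x + c))"
  using assms(2)
proof (induction k arbitrary: f)
  case 0
  have "continuous_on S' (\<lambda>x. T x + c)"
    by (intro continuous_intros bounded_linear.continuous_on[OF assms(1)])
  then show ?case
    using 0 assms(3) by (auto intro: continuous_on_compose2)
next
  case (Suc k)
  obtain f' where f': "\<forall>x\<in>S. (f has_derivative f' x) (at x within S)" "\<forall>v. Ck_on k S (\<lambda>x. f' x v)"
    using Suc.prems by auto
  have "((\<lambda>x. f (T x + c)) has_derivative (\<lambda>v. f' (T x + c) (T v))) (at x within S')"
    if "x \<in> S'" for x
  proof (rule has_derivative_in_compose2[where t=S and g=f and f="\<lambda>x. T x + c" and g'=f' and f'=T])
    show "((\<lambda>x. T x + c) has_derivative T) (at x within S')"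
      by (auto intro!: derivative_eq_intros bounded_linear_imp_has_derivative assms(1))
  qed (use that f' assms(3) in auto)
  then show ?case
    unfolding Ck_on.simps using f'(2) Suc.IH
    by (intro exI[of _ "\<lambda>x v. f' (T x + c) (T v)"]) auto
qed

lemma smooth_on_const: "smooth_on S (\<lambda>_. c)"
  by (simp add: smooth_on_def Ck_on_const)

lemma smooth_on_add: "smooth_on S f \<Longrightarrow> smooth_on S g \<Longrightarrow> smooth_on S (\<lambda>x. f x + g x)"
  by (simp add: smooth_on_def Ck_on_add)

lemma smooth_on_scaleR: "smooth_on S f \<Longrightarrow> smooth_on S g \<Longrightarrow> smooth_on S (\<lambda>x. f x *\<^sub>R g x)"
  by (simp add: smooth_on_def Ck_on_scaleR)

lemma smooth_on_cmult: "smooth_on S f \<Longrightarrow> smooth_on S (\<lambda>x. c * f x :: real)"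
  using smooth_on_scaleR[OF smooth_on_const[of S c], of f] by simp

lemma smooth_on_affine:
  "bounded_linear T \<Longrightarrow> smooth_on S f \<Longrightarrow> (\<And>x. x \<in> S' \<Longrightarrow> T x + c \<in> S)
    \<Longrightarrow> smooth_on S' (\<lambda>x. f (T x + c))"
  unfolding smooth_on_def by (blast intro: Ck_on_affine)

lemma smooth_on_imp_continuous: "smooth_on S f \<Longrightarrow> continuous_on S f"
  using Ck_on_continuous smooth_on_def by blast

text \<open>\<open>Ck_on\<close> supplies a derivative for each order \<open>k\<close> separately.
  On the whole space derivatives are unique, so all of them are \<open>frechet_derivative\<close>,
  which is then of every class.\<close>

lemma smooth_on_UNIV_frechet:
  assumes "smooth_on UNIV f"
  shows "(f has_derivative frechet_derivative f (at x)) (at x)"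
    and "smooth_on UNIV (\<lambda>x. frechet_derivative f (at x) v)"
proof -
  have *: "\<exists>f'. (\<forall>x. (f has_derivative f' x) (at x)) \<and> (\<forall>v. Ck_on k UNIV (\<lambda>x. f' x v))" for k
    using assms[unfolded smooth_on_def, rule_format, of "Suc k"] by auto
  from *[of 0] show "(f has_derivative frechet_derivative f (at x)) (at x)"
    using frechet_derivative_at by metis
  show "smooth_on UNIV (\<lambda>x. frechet_derivative f (at x) v)"
    unfolding smooth_on_def
  proof
    fix k
    obtain f' where f': "\<forall>x. (f has_derivative f' x) (at x)" "\<forall>v. Ck_on k UNIV (\<lambda>x. f' x v)"
      using *[of k] by auto
    then have "frechet_derivative f (at x) = f' x" for x
      using frechet_derivative_at by metis
    with f' show "Ck_on k UNIV (\<lambda>x. frechet_derivative f (at x) v)"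
      by simp
  qed
qed

section \<open>Partial derivatives of smooth functions on space\<close>

lemma pd_eqI: "(f has_derivative f') (at x) \<Longrightarrow> pd i f x = f' (axis i 1)"
  unfolding pd_def using frechet_derivative_at by metis

lemma smooth_on_pd: "smooth_on UNIV f \<Longrightarrow> smooth_on UNIV (pd i f)"
  using smooth_on_UNIV_frechet(2)[of f "axis i 1"] by (simp add: pd_def[abs_def])

lemma has_derivative_vec_expand:
  fixes f :: "real^3 \<Rightarrow> 'b::real_normed_vector"
  assumes "(f has_derivative f') (at x)"
  shows "f' = (\<lambda>h. \<Sum>i\<in>UNIV. h $ i *\<^sub>R f' (axis i 1))"
proof
  fix h :: "real^3"
  have "f' h = f' (\<Sum>i\<in>UNIV. h $ i *\<^sub>R axis i 1)"
    using basis_expansion[of h] by (simp add: scalar_mult_eq_scaleR)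
  also have "\<dots> = (\<Sum>i\<in>UNIV. h $ i *\<^sub>R f' (axis i 1))"
    using has_derivative_linear[OF assms] by (simp add: linear_sum linear_cmul)
  finally show "f' h = (\<Sum>i\<in>UNIV. h $ i *\<^sub>R f' (axis i 1))" .
qed

lemma smooth_has_derivative_pd:
  fixes f :: "real^3 \<Rightarrow> 'b::real_normed_vector"
  assumes "smooth_on UNIV f"
  shows "(f has_derivative (\<lambda>h. \<Sum>i\<in>UNIV. h $ i *\<^sub>R pd i f x)) (at x)"
  unfolding pd_def has_derivative_vec_expand[OF smooth_on_UNIV_frechet(1)[OF assms], symmetric]
  by (rule smooth_on_UNIV_frechet(1)[OF assms])

lemma pd_line:
  fixes f :: "real^3 \<Rightarrow> real"
  assumes "smooth_on UNIV f"
  shows "((\<lambda>s. f (x + s *\<^sub>R axis i 1)) has_real_derivative pd i f (x + s *\<^sub>R axis i 1)) (at s)"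
proof -
  have "((\<lambda>s. f (x + s *\<^sub>R axis i 1)) has_derivative
      (\<lambda>h. frechet_derivative f (at (x + s *\<^sub>R axis i 1)) (h *\<^sub>R axis i 1))) (at s)"
    by (rule has_derivative_compose[where g=f and f="\<lambda>s. x + s *\<^sub>R axis i 1" and f'="\<lambda>h. h *\<^sub>R axis i 1"])
       (auto intro!: derivative_eq_intros smooth_on_UNIV_frechet[OF assms])
  moreover have "frechet_derivative f (at y) (h *\<^sub>R axis i 1) = h * pd i f y" for y h
    unfolding pd_def
    using has_derivative_linear[OF smooth_on_UNIV_frechet(1)[OF assms]] by (simp add: linear_cmul)
  ultimately show ?thesis
    by (simp add: has_field_derivative_def mult_commute_abs)
qed

text \<open>Two applications of the mean value theorem: in direction \<open>i\<close> to the
  increment of \<open>f\<close> in direction \<open>j\<close>, then in direction \<open>j\<close> to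
  \<open>pd i f\<close>. The point found is displaced by less than \<open>h\<close> along each axis,
  hence the bound \<open>2 * h\<close>.\<close>

lemma pd_double_difference:
  fixes f :: "real^3 \<Rightarrow> real"
  assumes f: "smooth_on UNIV f" and h: "0 < h"
  shows "\<exists>\<xi>. dist \<xi> x \<le> 2 * h \<and>
    f (x + h *\<^sub>R axis i 1 + h *\<^sub>R axis j 1) - f (x + h *\<^sub>R axis i 1) - f (x + h *\<^sub>R axis j 1) + f x
      = h\<^sup>2 * pd j (pd i f) \<xi>"
proof -
  have der: "((\<lambda>s. f (x + h *\<^sub>R axis j 1 + s *\<^sub>R axis i 1) - f (x + s *\<^sub>R axis i 1)) has_real_derivative
      pd i f (x + h *\<^sub>R axis j 1 + s *\<^sub>R axis i 1) - pd i f (x + s *\<^sub>R axis i 1)) (at s)" for s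
    by (intro derivative_intros pd_line f)
  obtain s where s: "0 < s" "s < h"
    "(f (x + h *\<^sub>R axis j 1 + h *\<^sub>R axis i 1) - f (x + h *\<^sub>R axis i 1))
      - (f (x + h *\<^sub>R axis j 1 + 0 *\<^sub>R axis i 1) - f (x + 0 *\<^sub>R axis i 1))
     = (h - 0) * (pd i f (x + h *\<^sub>R axis j 1 + s *\<^sub>R axis i 1) - pd i f (x + s *\<^sub>R axis i 1))"
    using MVT2[OF h der] by blast
  have der2: "((\<lambda>t. pd i f (x + s *\<^sub>R axis i 1 + t *\<^sub>R axis j 1)) has_real_derivative
      pd j (pd i f) (x + s *\<^sub>R axis i 1 + t *\<^sub>R axis j 1)) (at t)" for t
    by (intro pd_line smooth_on_pd f)
  obtain t where t: "0 < t" "t < h"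
    "pd i f (x + s *\<^sub>R axis i 1 + h *\<^sub>R axis j 1) - pd i f (x + s *\<^sub>R axis i 1 + 0 *\<^sub>R axis j 1)
     = (h - 0) * pd j (pd i f) (x + s *\<^sub>R axis i 1 + t *\<^sub>R axis j 1)"
    using MVT2[OF h der2] by blast
  have "dist (x + s *\<^sub>R axis i 1 + t *\<^sub>R axis j 1) x = norm (s *\<^sub>R axis i 1 + t *\<^sub>R (axis j 1 :: real^3))"
    by (simp add: dist_norm)
  also have "\<dots> \<le> s + t"
    using norm_triangle_ineq[of "s *\<^sub>R axis i (1::real)" "t *\<^sub>R (axis j 1 :: real^3)"] s t by simp
  finally have "dist (x + s *\<^sub>R axis i 1 + t *\<^sub>R axis j 1) x \<le> 2 * h"
    using s t by simp
  moreover have "f (x + h *\<^sub>R axis i 1 + h *\<^sub>R axis j 1) - f (x + h *\<^sub>R axis i 1) - f (x + h *\<^sub>R axis j 1) + f x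
      = h\<^sup>2 * pd j (pd i f) (x + s *\<^sub>R axis i 1 + t *\<^sub>R axis j 1)"
    using s(3) t(3) by (simp add: add_ac power2_eq_square)
  ultimately show ?thesis
    by blast
qed

text \<open>The second difference is symmetric in \<open>i\<close> and \<open>j\<close>. Expressing
  it in both orders, cancelling the square of the step and letting the step tend to 0 gives equality
  by continuity of the second derivatives.\<close>

lemma pd_commute:
  fixes f :: "real^3 \<Rightarrow> real"
  assumes f: "smooth_on UNIV f"
  shows "pd i (pd j f) x = pd j (pd i f) x"
proof -
  define h where "h n = 1 / real (Suc n)" for n
  have h: "h n > 0" "h \<longlonglongrightarrow> 0" for n
    unfolding h_def by (simp, rule LIMSEQ_inverse_real_of_nat[unfolded inverse_eq_divide])
  obtain \<xi> where \<xi>: "\<And>n. dist (\<xi> n) x \<le> 2 * h n"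
    "\<And>n. f (x + h n *\<^sub>R axis i 1 + h n *\<^sub>R axis j 1) - f (x + h n *\<^sub>R axis i 1) - f (x + h n *\<^sub>R axis j 1) + f x
      = (h n)\<^sup>2 * pd j (pd i f) (\<xi> n)"
    using pd_double_difference[OF f h(1), of x _ i j] by metis
  obtain \<zeta> where \<zeta>: "\<And>n. dist (\<zeta> n) x \<le> 2 * h n"
    "\<And>n. f (x + h n *\<^sub>R axis j 1 + h n *\<^sub>R axis i 1) - f (x + h n *\<^sub>R axis j 1) - f (x + h n *\<^sub>R axis i 1) + f x
      = (h n)\<^sup>2 * pd i (pd j f) (\<zeta> n)"
    using pd_double_difference[OF f h(1), of x _ j i] by metis
  have eq: "pd j (pd i f) (\<xi> n) = pd i (pd j f) (\<zeta> n)" for n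
  proof -
    have "(h n)\<^sup>2 * pd j (pd i f) (\<xi> n) = (h n)\<^sup>2 * pd i (pd j f) (\<zeta> n)"
      unfolding \<xi>(2)[symmetric] \<zeta>(2)[symmetric] by (simp add: add_ac)
    with h(1)[of n] show ?thesis by simp
  qed
  have lim: "\<xi> \<longlonglongrightarrow> x" "\<zeta> \<longlonglongrightarrow> x"
    by (rule metric_tendsto_imp_tendsto[OF tendsto_mult_right_zero[OF h(2), of 2]];
        use \<xi>(1) \<zeta>(1) h(1) in \<open>simp add: abs_of_pos\<close>)+
  have c: "continuous_on UNIV (pd j (pd i f))" "continuous_on UNIV (pd i (pd j f))"
    by (intro smooth_on_imp_continuous smooth_on_pd f)+
  have "(\<lambda>n. pd j (pd i f) (\<xi> n)) \<longlonglongrightarrow> pd j (pd i f) x"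
    using continuous_on_tendsto_compose[OF c(1) lim(1)] by auto
  moreover have "(\<lambda>n. pd i (pd j f) (\<zeta> n)) \<longlonglongrightarrow> pd i (pd j f) x"
    using continuous_on_tendsto_compose[OF c(2) lim(2)] by auto
  ultimately show ?thesis
    unfolding eq using LIMSEQ_unique by blast
qed

section \<open>Test functions\<close>

text \<open>Compactness of a closure amounts to boundedness of the set, so support in the whole
  space only means vanishing outside some ball, the form in which test functions are used
  below.\<close>

lemma test_function_UNIV_iff:
  "test_function (UNIV :: 'a::euclidean_space set) f \<longleftrightarrow> smooth_on UNIV f \<and> (\<exists>R. \<forall>x. R < norm x \<longrightarrow> f x = 0)"
proof -
  have "bounded {x. f x \<noteq> 0} \<longleftrightarrow> (\<exists>R. \<forall>x. R < norm x \<longrightarrow> f x = 0)"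
    unfolding bounded_iff mem_Collect_eq Ball_def using linorder_not_less by metis
  then show ?thesis
    unfolding test_function_def compact_closure by simp
qed

lemma test_function_pd:
  fixes f :: "real^3 \<Rightarrow> 'b::real_normed_vector"
  assumes "test_function UNIV f"
  shows "test_function UNIV (pd i f)"
proof -
  obtain R where R: "\<And>x. R < norm x \<Longrightarrow> f x = 0" and sm: "smooth_on UNIV f"
    using assms test_function_UNIV_iff by blast
  have "pd i f x = 0" if "R < norm x" for x
  proof -
    have "open {x::real^3. R < norm x}"
      by (intro open_Collect_less continuous_intros)
    then have "(f has_derivative (\<lambda>_. 0)) (at x)"
      by (rule has_derivative_transform_within_open[OF has_derivative_const]) (use that R in auto)
    from pd_eqI[OF this] show ?thesis .
  qed
  then show ?thesis
    using smooth_on_pd[OF sm] test_function_UNIV_iff by blast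
qed

lemma test_function_rescaled:
  assumes "test_function D \<phi>" "0 < l"
  shows "test_function UNIV (rescaled \<phi> l)"
proof -
  have "test_function UNIV \<phi>"
    using assms(1) by (auto simp: test_function_def)
  then obtain R where R: "\<And>x. R < norm x \<Longrightarrow> \<phi> x = 0" and sm: "smooth_on UNIV \<phi>"
    unfolding test_function_UNIV_iff by blast
  have "smooth_on UNIV (\<lambda>x. \<phi> (x /\<^sub>R l + 0))"
    by (intro smooth_on_affine[OF _ sm]) (auto intro: bounded_linear_scaleR_right)
  from smooth_on_cmult[OF this, of "1 / l ^ 3"] have "smooth_on UNIV (rescaled \<phi> l)"
    by (simp add: rescaled_def[abs_def])
  moreover have "rescaled \<phi> l x = 0" if "R * l < norm x" for x
    using R[of "x /\<^sub>R l"] that assms(2) by (simp add: rescaled_def field_simps)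
  ultimately show ?thesis
    unfolding test_function_UNIV_iff by blast
qed

text \<open>A smooth bump on the line is obtained by restricting the filter to a line through a point of its support.\<close>

lemma smooth_step_exists:
  fixes \<phi> :: "real^3 \<Rightarrow> real"
  assumes "test_function (ball 0 1) \<phi>" "\<And>x. 0 \<le> \<phi> x" "(LINT x|lebesgue. \<phi> x) = 1"
  shows "\<exists>\<beta> B :: real \<Rightarrow> real. smooth_on UNIV \<beta> \<and> smooth_on UNIV B \<and> (\<forall>t. 0 \<le> \<beta> t)
    \<and> (\<forall>t. (B has_real_derivative \<beta> t) (at t))
    \<and> (\<forall>t. 2 < \<bar>t\<bar> \<longrightarrow> \<beta> t = 0) \<and> (\<forall>t\<le>-2. B t = 0) \<and> (\<forall>t\<ge>2. B t = 1)"
proof -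
  have sm: "smooth_on UNIV \<phi>" and supp: "closure {x. \<phi> x \<noteq> 0} \<subseteq> ball 0 1"
    using assms(1) by (auto simp: test_function_def)
  obtain z where z: "\<phi> z \<noteq> 0"
  proof -
    have "\<exists>z. \<phi> z \<noteq> 0"
    proof (rule ccontr)
      assume "\<nexists>z. \<phi> z \<noteq> 0"
      then have "\<phi> = (\<lambda>_. 0)" by auto
      with assms(3) show False by simp
    qed
    with that show thesis by blast
  qed
  have zero: "\<phi> x = 0" if "1 \<le> norm x" for x
    using supp closure_subset[of "{x. \<phi> x \<noteq> 0}"] that by force
  define b where "b t = \<phi> (t *\<^sub>R axis 1 1 + z)" for t
  have sb: "smooth_on UNIV b"
    unfolding b_def
    by (intro smooth_on_affine[OF _ sm]) (auto intro: bounded_linear_scaleR_left)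
  have b0: "b t = 0" if "2 \<le> \<bar>t\<bar>" for t
  proof -
    have "norm z < 1"
      using z zero not_le by blast
    moreover have "norm (t *\<^sub>R axis 1 1 :: real^3) \<le> norm (t *\<^sub>R axis 1 1 + z) + norm z"
      by (metis add_diff_cancel_right' norm_triangle_ineq4)
    ultimately show ?thesis
      using that by (auto simp: b_def intro!: zero)
  qed
  have bc: "continuous_on S b" for S
    using smooth_on_imp_continuous[OF sb] continuous_on_subset by blast
  define I where "I = integral {-2..2} b"
  have nn: "0 \<le> b t" for t
    using assms(2) by (simp add: b_def)
  \<comment> \<open>A nonnegative continuous function with integral 0 vanishes, whereas
    \<open>b 0 = \<phi> z\<close> does not.\<close>
  have "I \<noteq> 0"
  proof
    assume "I = 0"
    then have "(b has_integral 0) {-2..2}"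
      unfolding I_def using integrable_continuous_real[OF bc] integrable_integral by metis
    then have "(b has_integral 0) (cbox (-2) 2)"
      by simp
    then have "b 0 = 0"
      using has_integral_0_cbox_imp_0[of "-2::real" 2 b 0] bc nn
      by (auto simp: box_real)
    with z show False
      by (simp add: b_def)
  qed
  have "0 \<le> I"
    unfolding I_def by (intro integral_nonneg integrable_continuous_real bc) (auto simp: nn)
  define \<beta> where "\<beta> t = (1 / I) * b t" for t
  \<comment> \<open>The lower limit lies to the left of the support, so that every
    \<open>t \<ge> -2\<close> is interior to \<open>{-3..t+1}\<close> and the derivative within that
    interval is a full derivative.\<close>
  define B where "B t = integral {-3..t} \<beta>" for t
  have s\<beta>: "smooth_on UNIV \<beta>"
    unfolding \<beta>_def by (intro smooth_on_cmult sb)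
  have \<beta>c: "continuous_on S \<beta>" for S
    using smooth_on_imp_continuous[OF s\<beta>] continuous_on_subset by blast
  have \<beta>0: "\<beta> t = 0" if "2 \<le> \<bar>t\<bar>" for t
    using b0 that by (simp add: \<beta>_def)
  have Bneg: "B t = 0" if "t \<le> -2" for t
    unfolding B_def using that \<beta>0 by (intro integral_unique has_integral_is_0) auto
  have Bder: "(B has_real_derivative \<beta> t) (at t)" for t
  proof (cases "t < -2")
    case True
    have "(B has_real_derivative 0) (at t)"
      by (rule has_field_derivative_transform_within_open[where f="\<lambda>_. 0" and S="{..<-2}"])
         (use True Bneg in auto)
    with True \<beta>0 show ?thesis by simp
  next
    case False
    have "(B has_real_derivative \<beta> t) (at t within {-3..t+1})"
      unfolding B_def by (rule integral_has_real_derivative[OF \<beta>c]) (use False in auto)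
    moreover have "at t within {-3..t+1} = at t"
      by (rule at_within_interior) (use False in auto)
    ultimately show ?thesis by simp
  qed
  have sB: "smooth_on UNIV B"
    unfolding smooth_on_def
  proof
    fix k
    have "Ck_on (Suc k) UNIV B"
      unfolding Ck_on.simps
    proof (intro exI[of _ "\<lambda>t v. v *\<^sub>R \<beta> t"] conjI ballI allI)
      show "(B has_derivative (\<lambda>v. v *\<^sub>R \<beta> t)) (at t)" for t
        using Bder[of t] by (simp add: has_field_derivative_def mult_commute_abs)
      show "Ck_on k UNIV (\<lambda>t. v *\<^sub>R \<beta> t)" for v
        using Ck_on_scaleR[OF Ck_on_const[of k UNIV v], of \<beta>] s\<beta> by (simp add: smooth_on_def)
    qed
    then show "Ck_on k UNIV B" by (rule Ck_on_SucD)
  qed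
  have B1: "B t = 1" if "t \<ge> 2" for t
  proof -
    have int: "\<beta> integrable_on S" if "S = {a..b}" for S a b
      using that by (auto intro!: integrable_continuous_real \<beta>c)
    have "B t = integral {-3..-2} \<beta> + integral {-2..2} \<beta> + integral {2..t} \<beta>"
      unfolding B_def
      using that Henstock_Kurzweil_Integration.integral_combine[of "-3" 2 t \<beta>]
        Henstock_Kurzweil_Integration.integral_combine[of "-3" "-2" 2 \<beta>] by (simp add: int)
    also have "integral {-3..-2} \<beta> = 0"
      by (intro integral_unique has_integral_is_0) (auto intro: \<beta>0)
    also have "integral {2..t} \<beta> = 0"
      by (intro integral_unique has_integral_is_0) (auto intro: \<beta>0)
    also have "integral {-2..2} \<beta> = 1"
      unfolding \<beta>_def using \<open>I \<noteq> 0\<close> by (simp add: I_def)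
    finally show ?thesis by simp
  qed
  show ?thesis
    using s\<beta> sB Bder Bneg B1 \<beta>0 nn \<open>0 \<le> I\<close>
    by (intro exI[of _ \<beta>] exI[of _ B]) (auto simp: \<beta>_def)
qed

section \<open>Convolution with compactly supported kernels\<close>

lemma compact_support_bounded:
  fixes k :: "'a::euclidean_space \<Rightarrow> 'b::real_normed_vector"
  assumes "continuous_on UNIV k" "\<And>x. R < norm x \<Longrightarrow> k x = 0"
  shows "\<exists>M\<ge>0. \<forall>x. norm (k x) \<le> M"
proof -
  have "compact (k ` cball 0 R)"
    using assms(1) by (intro compact_continuous_image) (auto intro: continuous_on_subset)
  then obtain M where M: "\<And>x. x \<in> cball 0 R \<Longrightarrow> norm (k x) \<le> M"
    using compact_imp_bounded bounded_iff by (metis imageI)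
  have "norm (k x) \<le> max M 0" for x
    using M[of x] assms(2)[of x] by (cases "norm x \<le> R") auto
  then show ?thesis
    by (intro exI[of _ "max M 0"]) auto
qed

lemma compact_support_uniformly_continuous:
  fixes k :: "'a::euclidean_space \<Rightarrow> 'b::real_normed_vector"
  assumes k: "continuous_on UNIV k" "\<And>x. R < norm x \<Longrightarrow> k x = 0" and "0 < e"
  shows "\<exists>d>0. \<forall>x y. dist x y < d \<longrightarrow> dist (k x) (k y) < e"
proof -
  \<comment> \<open>The margin 1 handles the boundary: of two points closer than 1, if one leaves
    this ball then both have norm above \<open>R\<close>, where \<open>k\<close> is zero.\<close>
  have "uniformly_continuous_on (cball 0 (R + 1)) k"
    by (intro compact_uniformly_continuous continuous_on_subset[OF k(1)]) auto
  with \<open>0 < e\<close> obtain d where d: "d > 0"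
    "\<And>x y. x \<in> cball 0 (R+1) \<Longrightarrow> y \<in> cball 0 (R+1) \<Longrightarrow> dist x y < d \<Longrightarrow> dist (k x) (k y) < e"
    unfolding uniformly_continuous_on_def by (metis dist_commute)
  have "dist (k x) (k y) < e" if "dist x y < min d 1" for x y
  proof (cases "x \<in> cball 0 (R+1) \<and> y \<in> cball 0 (R+1)")
    case True
    with d(2) that show ?thesis by simp
  next
    case False
    have "norm x \<le> norm y + dist x y" "norm y \<le> norm x + dist x y"
      using norm_triangle_sub[of x y] norm_triangle_sub[of y x] by (simp_all add: dist_norm norm_minus_commute)
    with False that have "R < norm x" "R < norm y"
      by auto
    with k(2) \<open>0 < e\<close> show ?thesis by simp
  qed
  with d(1) show ?thesis
    by (intro exI[of _ "min d 1"]) auto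
qed

text \<open>\<open>f\<close> is only locally integrable, but \<open>g\<close> vanishes off the ball,
  so the indicator of the ball can be inserted next to \<open>f\<close>; the product is then
  dominated by \<open>M\<close> times an integrable function.\<close>

lemma integrable_compact_support_mult:
  fixes g f :: "'a::euclidean_space \<Rightarrow> real"
  assumes g: "continuous_on UNIV g" "\<And>y. R < norm y \<Longrightarrow> g y = 0" "\<And>y. \<bar>g y\<bar> \<le> M"
    and f: "set_integrable lebesgue (cball 0 R) f"
  shows "integrable lebesgue (\<lambda>y. g y * f y)"
    and "\<bar>LINT y|lebesgue. g y * f y\<bar> \<le> M * (LINT y:cball 0 R|lebesgue. \<bar>f y\<bar>)"
proof -
  have eq: "g y * f y = g y * (indicator (cball 0 R) y * f y)" for y
    using g(2)[of y] by (auto simp: indicator_def)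
  have int: "integrable lebesgue (\<lambda>y. M * \<bar>indicator (cball 0 R) y * f y\<bar>)"
    using f unfolding set_integrable_def by (auto simp del: abs_mult)
  have gm: "g \<in> borel_measurable lebesgue"
    using g(1) by (simp add: borel_measurable_continuous_onI measurable_completion)
  have le: "norm (g y * f y) \<le> M * \<bar>indicator (cball 0 R) y * f y\<bar>" for y
    unfolding eq[of y] abs_mult[of "g y"] real_norm_def by (intro mult_right_mono g(3)) auto
  show 1: "integrable lebesgue (\<lambda>y. g y * f y)"
  proof (rule Bochner_Integration.integrable_bound[OF int])
    show "(\<lambda>y. g y * f y) \<in> borel_measurable lebesgue"
      unfolding eq using gm f by (auto simp: set_integrable_def)
    show "AE y in lebesgue. norm (g y * f y) \<le> norm (M * \<bar>indicator (cball 0 R) y * f y\<bar>)"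
      by (rule AE_I2, rule order_trans[OF le]) simp
  qed
  have "\<bar>LINT y|lebesgue. g y * f y\<bar> \<le> (LINT y|lebesgue. M * \<bar>indicator (cball 0 R) y * f y\<bar>)"
    using Bochner_Integration.integral_norm_bound_integral[OF 1 int le] by simp
  also have "\<dots> = M * (LINT y:cball 0 R|lebesgue. \<bar>f y\<bar>)"
    by (simp add: set_lebesgue_integral_def abs_mult)
  finally show "\<bar>LINT y|lebesgue. g y * f y\<bar> \<le> M * (LINT y:cball 0 R|lebesgue. \<bar>f y\<bar>)" .
qed

section \<open>Convolution of a locally integrable function with a continuous kernel\<close>

lemma translated_kernel:
  fixes k :: "'a::euclidean_space \<Rightarrow> real"
  assumes "continuous_on UNIV k" "\<And>x. R < norm x \<Longrightarrow> k x = 0" "norm x \<le> r"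
  shows "continuous_on UNIV (\<lambda>y. k (x - y))" "\<And>y. R + r < norm y \<Longrightarrow> k (x - y) = 0"
proof -
  show "continuous_on UNIV (\<lambda>y. k (x - y))"
    by (rule continuous_on_compose2[OF assms(1)]) (auto intro: continuous_intros)
  show "k (x - y) = 0" if "R + r < norm y" for y
    using norm_triangle_sub[of y x] that assms(3) by (intro assms(2)) (simp add: norm_minus_commute)
qed

lemma convolution_integrable:
  fixes k f :: "real^3 \<Rightarrow> real"
  assumes k: "continuous_on UNIV k" "\<And>x. R < norm x \<Longrightarrow> k x = 0"
    and f: "\<And>R. set_integrable lebesgue (cball 0 R) f"
  shows "integrable lebesgue (\<lambda>y. k (x - y) * f y)"
proof -
  obtain M where "\<And>x. \<bar>k x\<bar> \<le> M"
    using compact_support_bounded[OF k] by auto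
  then show ?thesis
    by (intro integrable_compact_support_mult(1)[OF translated_kernel[OF k order_refl] _ f])
qed

lemma convolution_bound:
  fixes k f :: "real^3 \<Rightarrow> real"
  assumes k: "continuous_on UNIV k" "\<And>x. R < norm x \<Longrightarrow> k x = 0" "\<And>x. \<bar>k x\<bar> \<le> M"
    and f: "set_integrable lebesgue (cball 0 (R + r)) f" and "norm x \<le> r"
  shows "\<bar>convolution k f x\<bar> \<le> M * (LINT y:cball 0 (R + r)|lebesgue. \<bar>f y\<bar>)"
  using integrable_compact_support_mult(2)[OF translated_kernel[OF k(1,2) \<open>norm x \<le> r\<close>] k(3) f]
  by (simp add: convolution_def)

text \<open>The mean value theorem on the segment from \<open>x\<close> to \<open>x + h\<close>
  compares \<open>D\<close> at two points closer than \<open>d\<close>. Since \<open>d\<close> is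
  independent of the base point, the estimate can be used under the convolution integral.\<close>

lemma increment_linear_approximation:
  fixes k :: "real^3 \<Rightarrow> real"
  assumes der: "\<And>x. (k has_derivative (\<lambda>h. h \<bullet> D x)) (at x)"
    and d: "\<And>x y. dist x y < d \<Longrightarrow> dist (D x) (D y) < e" and h: "norm h < d"
  shows "\<bar>k (x + h) - k x - h \<bullet> D x\<bar> \<le> e * norm h"
proof -
  have "((\<lambda>s. k (x + s *\<^sub>R h)) has_real_derivative h \<bullet> D (x + s *\<^sub>R h)) (at s)" for s
  proof -
    have "((\<lambda>s. k (x + s *\<^sub>R h)) has_derivative (\<lambda>a. (a *\<^sub>R h) \<bullet> D (x + s *\<^sub>R h))) (at s)"
      by (rule has_derivative_compose[where g=k and f="\<lambda>s. x + s *\<^sub>R h" and f'="\<lambda>a. a *\<^sub>R h"])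
         (auto intro!: derivative_eq_intros der)
    then show ?thesis
      by (simp add: has_field_derivative_def mult_commute_abs)
  qed
  from MVT2[OF zero_less_one this] obtain s where s: "0 < s" "s < 1"
    "k (x + h) - k x = h \<bullet> D (x + s *\<^sub>R h)"
    by auto
  have "dist (x + s *\<^sub>R h) x < d"
    using s(1,2) h mult_left_le_one_le[of "norm h" s] by (simp add: dist_norm)
  then have "norm (D (x + s *\<^sub>R h) - D x) \<le> e"
    using d[of "x + s *\<^sub>R h" x] by (simp add: dist_norm)
  then have "\<bar>h \<bullet> (D (x + s *\<^sub>R h) - D x)\<bar> \<le> norm h * e"
    using Cauchy_Schwarz_ineq2[of h "D (x + s *\<^sub>R h) - D x"] by (meson mult_left_mono norm_ge_zero order_trans)
  then show ?thesis
    using s(3) by (simp add: inner_diff_right mult.commute)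
qed

lemma sum_axis_scaleR:
  fixes F :: "3 \<Rightarrow> 'b::real_normed_vector"
  shows "(\<Sum>i\<in>UNIV. axis j (1::real) $ i *\<^sub>R F i) = F j"
proof -
  have "axis j (1::real) $ i *\<^sub>R F i = (if i = j then F i else 0)" for i
    by (simp add: axis_def)
  then show ?thesis
    by simp
qed

text \<open>The difference quotient falls on the kernel. Its remainder is at most a small multiple
  of \<open>norm h\<close> uniformly in the integration variable, by uniform continuity of
  \<open>D\<close>, and is supported in one ball for all small \<open>h\<close>, on which
  \<open>f\<close> is integrable.\<close>

lemma convolution_has_derivative_C1:
  fixes k f :: "real^3 \<Rightarrow> real"
  assumes der: "\<And>x. (k has_derivative (\<lambda>h. h \<bullet> D x)) (at x)"
    and D: "continuous_on UNIV D" and supp: "\<And>x. R < norm x \<Longrightarrow> k x = 0" "\<And>x. R < norm x \<Longrightarrow> D x = 0"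
    and f: "\<And>R. set_integrable lebesgue (cball 0 R) f"
  shows "(convolution k f has_derivative (\<lambda>h. \<Sum>i\<in>UNIV. h $ i *\<^sub>R convolution (\<lambda>z. D z $ i) f x)) (at x)"
proof -
  let ?L = "\<lambda>h::real^3. \<Sum>i\<in>UNIV. h $ i *\<^sub>R convolution (\<lambda>z. D z $ i) f x"
  \<comment> \<open>The radius contains the supports of all kernels centred at \<open>x + h\<close>
    with \<open>norm h < 1\<close>. Below, \<open>e\<close> is divided by \<open>I + 1\<close>
    rather than \<open>I\<close> because \<open>I\<close> may be 0.\<close>
  define I where "I = (LINT y:cball 0 (R + (norm x + 1))|lebesgue. \<bar>f y\<bar>)"
  have I: "0 \<le> I"
    unfolding I_def set_lebesgue_integral_def by (intro Bochner_Integration.integral_nonneg) auto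
  have kc: "continuous_on UNIV k"
    by (rule has_derivative_continuous_on[OF der])
  have Di: "continuous_on UNIV (\<lambda>z. D z $ i)" for i
    by (intro continuous_intros D)
  have bl: "bounded_linear ?L"
    by (intro bounded_linear_sum bounded_linear_scaleR_const bounded_linear_vec_nth)
  have rem: "\<exists>d>0. \<forall>h. norm h < d \<longrightarrow> norm (convolution k f (x + h) - convolution k f x - ?L h) \<le> e * norm h"
    if e: "e > 0" for e
  proof -
    have "e / (I + 1) > 0" using e I by simp
    from compact_support_uniformly_continuous[OF D supp(2) this]
    obtain d where d: "d > 0" "\<And>x y. dist x y < d \<Longrightarrow> dist (D x) (D y) < e / (I + 1)"
      by blast
    have "norm (convolution k f (x + h) - convolution k f x - ?L h) \<le> e * norm h"
      if h: "norm h < min d 1" for h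
    proof -
      let ?g = "\<lambda>y. k (x + h - y) - k (x - y) - h \<bullet> D (x - y)"
      have ints: "integrable lebesgue (\<lambda>y. k (x + h - y) * f y)" "integrable lebesgue (\<lambda>y. k (x - y) * f y)"
        "\<And>i. integrable lebesgue (\<lambda>y. D (x - y) $ i * f y)"
        using convolution_integrable[OF kc supp(1) f] convolution_integrable[OF Di _ f, of R] supp(2)
        by auto
      have L: "?L h = (LINT y|lebesgue. h \<bullet> D (x - y) * f y)"
      proof -
        have "(LINT y|lebesgue. h \<bullet> D (x - y) * f y) = (LINT y|lebesgue. (\<Sum>i\<in>UNIV. h $ i * (D (x - y) $ i * f y)))"
          by (simp add: inner_vec_def sum_distrib_right mult.assoc)
        also have "\<dots> = ?L h"
          by (subst Bochner_Integration.integral_sum) (auto simp: convolution_def ints)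
        finally show ?thesis by (rule sym)
      qed
      have int3: "integrable lebesgue (\<lambda>y. h \<bullet> D (x - y) * f y)"
        unfolding inner_vec_def sum_distrib_right
        by (intro Bochner_Integration.integrable_sum) (auto simp: mult.assoc ints)
      have "convolution k f (x + h) - convolution k f x - ?L h = (LINT y|lebesgue. ?g y * f y)"
        unfolding L unfolding convolution_def real_scaleR_def left_diff_distrib using ints int3 by simp
      moreover have "\<bar>LINT y|lebesgue. ?g y * f y\<bar> \<le> (e / (I + 1) * norm h) * (LINT y:cball 0 (R + (norm x + 1))|lebesgue. \<bar>f y\<bar>)"
      proof (rule integrable_compact_support_mult(2))
        show "continuous_on UNIV ?g"
          by (intro continuous_intros continuous_on_compose2[OF kc] continuous_on_compose2[OF D]) auto
        show "?g y = 0" if "R + (norm x + 1) < norm y" for y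
        proof -
          have "norm (x + h) \<le> norm x + 1"
            using norm_triangle_ineq[of x h] h by simp
          then show ?thesis
            using translated_kernel(2)[OF kc supp(1), where x="x + h" and r="norm x + 1" and y=y]
              translated_kernel(2)[OF kc supp(1), where x=x and r="norm x + 1" and y=y]
              translated_kernel(2)[OF Di, where R=R and x=x and r="norm x + 1" and y=y] supp(2) that
            by (simp add: inner_vec_def)
        qed
        show "\<bar>?g y\<bar> \<le> e / (I + 1) * norm h" for y
          using increment_linear_approximation[OF der d(2), where h=h and x="x - y"] h by (simp add: algebra_simps)
        show "set_integrable lebesgue (cball 0 (R + (norm x + 1))) f" by (rule f)
      qed
      moreover have "(e / (I + 1) * norm h) * I \<le> e * norm h"
        using I e by (simp add: field_simps mult_left_mono)
      
      ultimately show ?thesis unfolding I_def[symmetric] by simp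
    qed
    with d(1) show ?thesis
      by (intro exI[of _ "min d 1"]) auto
  qed
  show ?thesis
    unfolding has_derivative_at_alt
  proof (intro conjI bl allI impI)
    fix e :: real
    assume "0 < e"
    from rem[OF this] obtain d where d: "d > 0"
      "\<And>h. norm h < d \<Longrightarrow> norm (convolution k f (x + h) - convolution k f x - ?L h) \<le> e * norm h"
      by blast
    have "norm (convolution k f y - convolution k f x - ?L (y - x)) \<le> e * norm (y - x)"
      if "norm (y - x) < d" for y
      using d(2)[OF that] by simp
    with d(1) show "\<exists>d>0. \<forall>y. norm (y - x) < d
        \<longrightarrow> norm (convolution k f y - convolution k f x - ?L (y - x)) \<le> e * norm (y - x)"
      by blast
  qed
qed


lemma convolution_has_derivative:
  fixes k f :: "real^3 \<Rightarrow> real"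
  assumes k: "test_function UNIV k" and f: "\<And>R. set_integrable lebesgue (cball 0 R) f"
  shows "(convolution k f has_derivative (\<lambda>h. \<Sum>i\<in>UNIV. h $ i *\<^sub>R convolution (pd i k) f x)) (at x)"
proof -
  have sm: "smooth_on UNIV k"
    using k by (simp add: test_function_def)
  obtain R where R: "\<And>x. R < norm x \<Longrightarrow> k x = 0"
    using k test_function_UNIV_iff by blast
  have "\<exists>R. \<forall>i x. R < norm x \<longrightarrow> pd i k x = 0"
  proof -
    have "\<exists>R. \<forall>x. R < norm x \<longrightarrow> pd i k x = 0" for i
      using test_function_pd[OF k] test_function_UNIV_iff by blast
    then obtain r where r: "\<And>i x. r i < norm x \<Longrightarrow> pd i k x = 0" by metis
    have "r i \<le> Max (range r)" for i by simp
    then show ?thesis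
      using r by (intro exI[of _ "Max (range r)"]) (meson le_less_trans)
  qed
  then obtain R' where R': "\<And>i x. R' < norm x \<Longrightarrow> pd i k x = 0" by blast
  have "(convolution k f has_derivative
      (\<lambda>h. \<Sum>i\<in>UNIV. h $ i *\<^sub>R convolution (\<lambda>z. (\<chi> i. pd i k z) $ i) f x)) (at x)"
  proof (rule convolution_has_derivative_C1[where R="max R R'" and D="\<lambda>z. \<chi> i. pd i k z"])
    show "(k has_derivative (\<lambda>h. h \<bullet> (\<chi> i. pd i k x))) (at x)" for x
      using smooth_has_derivative_pd[OF sm, of x] by (simp add: inner_vec_def)
    show "continuous_on UNIV (\<lambda>x. \<chi> i. pd i k x)"
      by (intro continuous_on_vec_lambda smooth_on_imp_continuous smooth_on_pd sm)
  qed (use R R' f in \<open>auto simp: vec_eq_iff\<close>)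
  then show ?thesis by simp
qed

lemma pd_convolution:
  fixes k f :: "real^3 \<Rightarrow> real"
  assumes "test_function UNIV k" "\<And>R. set_integrable lebesgue (cball 0 R) f"
  shows "pd i (convolution k f) = convolution (pd i k) f"
  by (rule ext, subst pd_eqI[OF convolution_has_derivative[OF assms]]) (rule sum_axis_scaleR)

section \<open>Derivatives of compactly supported functions have integral zero\<close>

lemma integral_reflect_translate:
  fixes k :: "'a::euclidean_space \<Rightarrow> real"
  assumes "k \<in> borel_measurable borel"
  shows "(LINT y|lborel. k (x - y)) = (LINT y|lborel. k y)"
proof -
  have "distr lborel borel (\<lambda>y::'a. x - y) = lborel"
    by (subst lborel_affine[of "-1" x]) (auto simp: density_1 one_ennreal_def[symmetric])
  then show ?thesis
    using integral_distr[of "\<lambda>y. x - y" lborel borel k] assms by simp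
qed

text \<open>By translation invariance the convolution of \<open>h\<close> with the constant 1 is the
  constant integral of \<open>h\<close>, so its derivative is 0; differentiating the kernel instead
  identifies the same derivative with the integrals of the components of \<open>D\<close>.\<close>

lemma integral_pd_compact_support:
  fixes h :: "real^3 \<Rightarrow> real"
  assumes der: "\<And>x. (h has_derivative (\<lambda>v. v \<bullet> D x)) (at x)"
    and D: "continuous_on UNIV D" and supp: "\<And>x. R < norm x \<Longrightarrow> h x = 0"
  shows "integrable lebesgue (\<lambda>x. D x $ i)" "(LINT x|lebesgue. D x $ i) = 0"
proof -
  have D0: "D x = 0" if "R < norm x" for x
  proof -
    have "open {x::real^3. R < norm x}"
      by (intro open_Collect_less continuous_intros)
    then have "(h has_derivative (\<lambda>_. 0)) (at x)"
      by (rule has_derivative_transform_within_open[OF has_derivative_const]) (use that supp in auto)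
    from has_derivative_unique[OF der this] have "(\<lambda>v. v \<bullet> D x) = (\<lambda>_. 0)" .
    then have "D x \<bullet> D x = 0" by meson
    then show ?thesis by simp
  qed
  have one: "set_integrable lebesgue (cball 0 R) (\<lambda>_::real^3. 1::real)" for R
    using emeasure_lborel_cball_finite[of "0::real^3" R]
    unfolding set_integrable_def by (simp add: integrable_indicator_iff)
  have Di: "continuous_on UNIV (\<lambda>z. D z $ i)" for i
    by (intro continuous_intros D)
  show int: "integrable lebesgue (\<lambda>x. D x $ i)" for i
  proof -
    obtain M where "\<And>x. \<bar>D x $ i\<bar> \<le> M"
      using compact_support_bounded[OF Di, of R i] D0 by auto
    then show ?thesis
      using integrable_compact_support_mult(1)[OF Di _ _ one, of R i M] D0 by simp
  qed
  have conv: "convolution k (\<lambda>_. 1) x = (LINT y|lebesgue. k y)" if "continuous_on UNIV k"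
    for k :: "real^3 \<Rightarrow> real" and x
    using borel_measurable_continuous_onI[OF that]
    by (simp add: convolution_def integral_completion integral_reflect_translate)
  have "(convolution h (\<lambda>_. 1) has_derivative
      (\<lambda>v. \<Sum>i\<in>UNIV. v $ i *\<^sub>R convolution (\<lambda>z. D z $ i) (\<lambda>_. 1::real) 0)) (at 0)"
    by (rule convolution_has_derivative_C1[OF der D supp D0 one])
  moreover have "continuous_on UNIV h"
    by (rule has_derivative_continuous_on[OF der])
  then have "convolution h (\<lambda>_. 1::real) = (\<lambda>_. LINT y|lebesgue. h y)"
    using conv by blast
  ultimately have "((\<lambda>_. LINT y|lebesgue. h y) has_derivative
      (\<lambda>v. \<Sum>i\<in>UNIV. v $ i *\<^sub>R (LINT x|lebesgue. D x $ i))) (at (0::real^3))"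
    using conv[OF Di] by simp
  from has_derivative_unique[OF this has_derivative_const]
  have "(\<Sum>j\<in>UNIV. axis i 1 $ j *\<^sub>R (LINT x|lebesgue. D x $ j)) = 0" for i
    by meson
  then show "(LINT x|lebesgue. D x $ i) = 0"
    by (simp only: sum_axis_scaleR)
qed

section \<open>Measurability and iterated integrals on space-time\<close>

text \<open>Fubini for null sets. As \<open>P\<close> is arbitrary, the exceptional set is first
  covered by a Borel null set \<open>N\<close>, for which the two almost-everywhere quantifiers can
  be exchanged.\<close>

lemma AE_lborel_prod_swap:
  fixes P :: "'a::euclidean_space \<times> 'b::euclidean_space \<Rightarrow> bool"
  assumes "AE z in lborel. P z"
  shows "AE t in lborel. AE x in lborel. P (x, t)"
proof -
  obtain N where N0: "\<And>z. z \<in> space lborel - N \<Longrightarrow> P z" and N1: "N \<in> null_sets lborel"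
    by (rule AE_E3[OF assms]) (rule that)
  have N: "N \<in> null_sets lborel" "\<And>z. z \<notin> N \<Longrightarrow> P z"
    using N0 N1 by auto
  have "AE z in lborel. z \<notin> N"
    using N(1) by (rule AE_not_in)
  then have "AE z in (lborel \<Otimes>\<^sub>M lborel :: ('a \<times> 'b) measure). z \<notin> N"
    unfolding lborel_prod .
  from lborel_pair.AE_pair[OF this] have "AE x in lborel. AE t in lborel. (x, t) \<notin> N"
    by simp
  moreover have "{z \<in> space (lborel \<Otimes>\<^sub>M lborel). (fst z, snd z) \<notin> N} \<in> sets (lborel \<Otimes>\<^sub>M lborel)"
  proof -
    have "{z \<in> space (lborel \<Otimes>\<^sub>M lborel). (fst z, snd z) \<notin> N} = space lborel - N"
      by (auto simp: lborel_prod)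
    then show ?thesis
      unfolding lborel_prod using N(1) by auto
  qed
  ultimately have "AE t in lborel. AE x in lborel. (x, t) \<notin> N"
    using lborel_pair.AE_commute[of "\<lambda>x t. (x, t) \<notin> N"] by simp
  then show ?thesis
  proof eventually_elim
    case (elim t)
    then show ?case
      by eventually_elim (rule N(2))
  qed
qed

text \<open>Extension by zero off \<open>S\<close> and a change on a null set in each coordinate
  produce a Borel function. Fubini is formulated for products of Borel measures, so it is applied to
  this representative.\<close>

lemma lebesgue_on_borel_version:
  fixes f :: "'a::euclidean_space \<Rightarrow> real^'n"
  assumes "f \<in> borel_measurable (lebesgue_on S)" "S \<in> sets lebesgue"
  shows "\<exists>g\<in>borel_measurable borel. AE x in lborel. x \<in> S \<longrightarrow> f x = g x"
proof -
  have m: "(\<lambda>x. if x \<in> S then f x else 0) \<in> borel_measurable lebesgue"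
    using assms borel_measurable_if by blast
  have "\<exists>g\<in>borel_measurable lborel. AE x in lborel. (if x \<in> S then f x else 0) $ i = g x" for i
    by (rule completion_ex_borel_measurable_real)
       (rule borel_measurable_continuous_on[OF _ m, of "\<lambda>x. x $ i"], intro continuous_intros)
  then have "\<forall>i. \<exists>g. g \<in> borel_measurable borel \<and> (AE x in lborel. (if x \<in> S then f x else 0) $ i = g x)"
    unfolding measurable_lborel2 Bex_def by blast
  from choice[OF this] obtain g where g: "\<And>i. g i \<in> borel_measurable borel"
    "\<And>i. AE x in lborel. (if x \<in> S then f x else 0) $ i = g i x"
    by blast
  have "(\<lambda>x. \<chi> i. g i x) \<in> borel_measurable borel"
    using g(1) by (subst borel_measurable_euclidean_space) (auto simp: Basis_vec_def inner_axis)
  moreover have "AE x in lborel. \<forall>i. (if x \<in> S then f x else 0) $ i = g i x"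
    using g(2) by (simp add: AE_all_countable)
  then have "AE x in lborel. x \<in> S \<longrightarrow> f x = (\<chi> i. g i x)"
  proof eventually_elim
    case (elim x)
    then show ?case
      by (cases "x \<in> S") (simp_all add: vec_eq_iff)
  qed
  ultimately show ?thesis
    by (rule bexI[where P="\<lambda>g. AE x in lborel. x \<in> S \<longrightarrow> f x = g x", rotated])
qed

text \<open>The estimates available are bounds on spatial integrals for almost every time. With time
  confined to a bounded interval they give integrability on space-time, with time as the outer
  variable although it is the second coordinate.\<close>

lemma iterated_integral_time_outer:
  fixes H :: "'a::euclidean_space \<times> real \<Rightarrow> real"
  assumes [measurable]: "H \<in> borel_measurable borel"
    and zero: "\<And>x t. t \<notin> {a..b} \<Longrightarrow> H (x, t) = 0"
    and bound: "AE t in lborel. integrable lborel (\<lambda>x. H (x, t)) \<and> (LINT x|lborel. \<bar>H (x, t)\<bar>) \<le> C"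
  shows "integrable lborel H"
    and "(LINT z|lborel. H z) = (LINT t|lborel. LINT x|lborel. H (x, t))"
    and "integrable lborel (\<lambda>t. LINT x|lborel. H (x, t))"
proof -
  have Hm: "(\<lambda>(t, x). H (x, t)) \<in> borel_measurable (lborel \<Otimes>\<^sub>M lborel)"
  proof -
    have "(\<lambda>z::real \<times> 'a. (snd z, fst z)) \<in> borel_measurable borel"
      by (intro borel_measurable_continuous_onI continuous_intros)
    from measurable_compose[OF this assms(1)] show ?thesis
      by (simp add: lborel_prod case_prod_unfold)
  qed
  have int: "integrable (lborel \<Otimes>\<^sub>M lborel) (\<lambda>(t, x). H (x, t))"
  proof (rule lborel_pair.Fubini_integrable[OF Hm])
    have "integrable lborel (\<lambda>t. indicator {a..b} t * C)"
      by (intro integrable_mult_left) (simp add: integrable_indicator_iff emeasure_lborel_Icc_eq)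
    then show "integrable lborel (\<lambda>t. LINT x|lborel. norm (case (t, x) of (t, x) \<Rightarrow> H (x, t)))"
    proof (rule Bochner_Integration.integrable_bound)
      show "(\<lambda>t. LINT x|lborel. norm (case (t, x) of (t, x) \<Rightarrow> H (x, t))) \<in> borel_measurable lborel"
        using Hm by measurable
      show "AE t in lborel. norm (LINT x|lborel. norm (case (t, x) of (t, x) \<Rightarrow> H (x, t)))
          \<le> norm (indicator {a..b} t * C)"
        using bound
      proof eventually_elim
        case (elim t)
        then show ?case
          using zero[of t] by (cases "t \<in> {a..b}") auto
      qed
    qed
    show "AE t in lborel. integrable lborel (\<lambda>x. case (t, x) of (t, x) \<Rightarrow> H (x, t))"
      using bound by eventually_elim auto
  qed
  from lborel_pair.integrable_product_swap[OF this] show 1: "integrable lborel H"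
    by (simp add: lborel_prod)
  have H: "integrable (lborel \<Otimes>\<^sub>M lborel) (\<lambda>(x, t). H (x, t))"
    using 1 by (simp add: lborel_prod)
  show "(LINT z|lborel. H z) = (LINT t|lborel. LINT x|lborel. H (x, t))"
    using lborel_pair.integral_snd[of "\<lambda>x t. H (x, t)"] H by (simp add: lborel_prod)
  show "integrable lborel (\<lambda>t. LINT x|lborel. H (x, t))"
    using lborel_pair.integrable_snd[of "\<lambda>x t. H (x, t)"] H by simp
qed

text \<open>The set where the bound holds is closed and has full measure in the open interval, hence
  contains it and its closure. This is how energy bounds valid for almost every time reach every
  time.\<close>

lemma continuous_AE_le:
  fixes f :: "real \<Rightarrow> real"
  assumes "continuous_on {a..b} f" "AE t in lborel. t \<in> {a..b} \<longrightarrow> f t \<le> K" "a < b" "t \<in> {a..b}"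
  shows "f t \<le> K"
proof -
  let ?C = "{t \<in> {a..b}. f t \<le> K}"
  have cl: "closed ?C"
  proof -
    have "?C = {a..b} \<inter> f -` {..K}" by auto
    then show ?thesis
      using continuous_closed_preimage[OF assms(1), of "{..K}"] by simp
  qed
  have ae: "AE t in lebesgue. t \<in> {a<..<b} \<longrightarrow> t \<in> ?C"
    unfolding AE_completion_iff using assms(2) by eventually_elim auto
  have "{a<..<b} \<subseteq> ?C"
    using mem_closed_if_AE_lebesgue_open[OF open_greaterThanLessThan cl ae] by auto
  then have "closure {a<..<b} \<subseteq> ?C"
    using cl closure_minimal by blast
  with assms(3,4) show ?thesis
    by auto
qed

lemma convolution_borel_version:
  fixes k f f' :: "real^3 \<Rightarrow> real"
  assumes k: "continuous_on UNIV k" and f: "f \<in> borel_measurable lebesgue" and f': "f' \<in> borel_measurable borel"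
    and eq: "AE y in lebesgue. f y = f' y"
  shows "convolution k f x = (LINT y|lborel. k (x - y) * f' y)"
proof -
  have km: "(\<lambda>y. k (x - y)) \<in> borel_measurable borel"
    by (intro borel_measurable_continuous_onI continuous_on_compose2[OF k] continuous_intros) auto
  have mb: "(\<lambda>y. k (x - y) * f' y) \<in> borel_measurable lborel"
    unfolding measurable_lborel2 by (intro borel_measurable_times km f')
  have "convolution k f x = (LINT y|lebesgue. k (x - y) * f' y)"
    unfolding convolution_def real_scaleR_def
  proof (rule integral_cong_AE)
    show "(\<lambda>y. k (x - y) * f y) \<in> borel_measurable lebesgue"
      using km by (intro borel_measurable_times f) (simp add: measurable_completion)
    show "(\<lambda>y. k (x - y) * f' y) \<in> borel_measurable lebesgue"
      by (rule measurable_completion[OF mb])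
    show "AE y in lebesgue. k (x - y) * f y = k (x - y) * f' y"
      using eq by eventually_elim simp
  qed
  then show ?thesis
    by (simp add: integral_completion[OF mb])
qed

section \<open>Filtered quantities of a weakly continuous field\<close>

text \<open>Two descriptions of one field are carried along: \<open>u\<close>, meaningful at every
  single time by weak continuity, and the jointly Borel \<open>v\<close>, equal to it almost
  everywhere on \<open>T\<close>, on which Fubini can act.\<close>

locale filtered_field =
  fixes T :: "real set" and u :: "real^3 \<Rightarrow> real \<Rightarrow> real^3" and v :: "(real^3) \<times> real \<Rightarrow> real^3"
  assumes open_T: "open T"
    and v_borel [measurable]: "v \<in> borel_measurable borel"
    and v_AE: "AE z in lborel. snd z \<in> T \<longrightarrow> u (fst z) (snd z) = v z"
    and weak_continuity: "weakly_continuous_in_time T u"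
    and energy_bound: "\<And>R a b. {a..b} \<subseteq> T \<Longrightarrow>
      \<exists>C. AE t in lborel. t \<in> {a..b} \<longrightarrow> (LINT x:cball 0 R|lebesgue. (norm (u x t))\<^sup>2) \<le> C"
begin

lemma v_AE_slices: "AE t in lborel. t \<in> T \<longrightarrow> (AE x in lebesgue. u x t = v (x, t))"
  unfolding AE_completion_iff using AE_lborel_prod_swap[OF v_AE] by eventually_elim auto

lemma v_component_borel [measurable]: "(\<lambda>z. v z $ i) \<in> borel_measurable borel"
  by (rule borel_measurable_continuous_on[OF _ v_borel, of "\<lambda>x. x $ i"]) (intro continuous_intros)

context
  fixes t assumes t: "t \<in> T"
begin

lemma u_component_measurable: "(\<lambda>x. u x t $ i) \<in> borel_measurable lebesgue"
proof -
  have "(\<lambda>x. u x t) \<in> borel_measurable lebesgue"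
    using weak_continuity t unfolding weakly_continuous_in_time_def by blast
  then show ?thesis
    by (rule borel_measurable_continuous_on[of "\<lambda>x. x $ i", rotated]) (intro continuous_intros)
qed

lemma u_square_integrable: "set_integrable lebesgue (cball 0 R) (\<lambda>x. (norm (u x t))\<^sup>2)"
  using weak_continuity t unfolding weakly_continuous_in_time_def by blast

lemma u_product_integrable: "set_integrable lebesgue (cball 0 R) (\<lambda>x. u x t $ i * u x t $ j)"
  and u_product_L1: "(LINT x:cball 0 R|lebesgue. \<bar>u x t $ i * u x t $ j\<bar>)
    \<le> (LINT x:cball 0 R|lebesgue. (norm (u x t))\<^sup>2)"
proof -
  have le: "\<bar>u x t $ i * u x t $ j\<bar> \<le> (norm (u x t))\<^sup>2" for x
    unfolding abs_mult power2_eq_square by (intro mult_mono component_le_norm_cart) auto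
  show 1: "set_integrable lebesgue (cball 0 R) (\<lambda>x. u x t $ i * u x t $ j)"
    unfolding set_integrable_def
  proof (rule Bochner_Integration.integrable_bound[OF u_square_integrable[of R, unfolded set_integrable_def]])
    show "(\<lambda>x. indicat_real (cball 0 R) x *\<^sub>R (u x t $ i * u x t $ j)) \<in> borel_measurable lebesgue"
      by (intro borel_measurable_scaleR borel_measurable_indicator borel_measurable_times
          u_component_measurable) auto
  qed (use le in \<open>auto simp: indicator_def\<close>)
  show "(LINT x:cball 0 R|lebesgue. \<bar>u x t $ i * u x t $ j\<bar>)
    \<le> (LINT x:cball 0 R|lebesgue. (norm (u x t))\<^sup>2)"
    using set_integrable_abs[OF 1] le by (intro set_integral_mono u_square_integrable) auto
qed

lemma u_component_integrable: "set_integrable lebesgue (cball 0 R) (\<lambda>x. u x t $ i)"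
  and u_component_L1: "(LINT x:cball 0 R|lebesgue. \<bar>u x t $ i\<bar>)
    \<le> measure lebesgue (cball (0::real^3) R) + (LINT x:cball 0 R|lebesgue. (norm (u x t))\<^sup>2)"
proof -
  have le: "\<bar>u x t $ i\<bar> \<le> 1 + (norm (u x t))\<^sup>2" for x
  proof -
    have "\<bar>u x t $ i\<bar> \<le> norm (u x t)" by (rule component_le_norm_cart)
    also have "\<dots> \<le> 1 + (norm (u x t))\<^sup>2"
      using zero_le_power2[of "norm (u x t) - 1"] norm_ge_zero[of "u x t"]
      unfolding power2_diff one_power2 mult_1_right by linarith
    finally show ?thesis .
  qed
  have one: "set_integrable lebesgue (cball 0 R) (\<lambda>_::real^3. 1::real)"
    using emeasure_lborel_cball_finite[of "0::real^3" R]
    unfolding set_integrable_def by (simp add: integrable_indicator_iff)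
  have int: "set_integrable lebesgue (cball 0 R) (\<lambda>x. 1 + (norm (u x t))\<^sup>2)"
    by (intro set_integral_add(1) one u_square_integrable)
  show 1: "set_integrable lebesgue (cball 0 R) (\<lambda>x. u x t $ i)"
    unfolding set_integrable_def
  proof (rule Bochner_Integration.integrable_bound[OF int[unfolded set_integrable_def]])
    show "(\<lambda>x. indicat_real (cball 0 R) x *\<^sub>R (u x t $ i)) \<in> borel_measurable lebesgue"
      by (intro borel_measurable_scaleR borel_measurable_indicator u_component_measurable) auto
  qed (use le in \<open>auto simp: indicator_def intro: order_trans\<close>)
  have "(LINT x:cball 0 R|lebesgue. \<bar>u x t $ i\<bar>) \<le> (LINT x:cball 0 R|lebesgue. 1 + (norm (u x t))\<^sup>2)"
    using set_integrable_abs[OF 1] le by (intro set_integral_mono int) auto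
  also have "\<dots> = (LINT x:cball (0::real^3) R|lebesgue. 1) + (LINT x:cball 0 R|lebesgue. (norm (u x t))\<^sup>2)"
    using set_integral_add(2)[OF one u_square_integrable[of R]] by simp
  also have "(LINT x:cball (0::real^3) R|lebesgue. 1) = measure lebesgue (cball (0::real^3) R)"
    by (simp add: set_lebesgue_integral_def)
  finally show "(LINT x:cball 0 R|lebesgue. \<bar>u x t $ i\<bar>)
    \<le> measure lebesgue (cball (0::real^3) R) + (LINT x:cball 0 R|lebesgue. (norm (u x t))\<^sup>2)" .
qed

end

text \<open>
  V and Q are the filtered velocity and the filtered products with an arbitrary kernel; every
  derivative of a filtered quantity is again of this form. Qv is a jointly Borel version of Q.
\<close>

definition V :: "(real^3 \<Rightarrow> real) \<Rightarrow> 3 \<Rightarrow> real^3 \<Rightarrow> real \<Rightarrow> real" where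
  "V k i x t = convolution k (\<lambda>y. u y t $ i) x"

definition Q :: "(real^3 \<Rightarrow> real) \<Rightarrow> 3 \<Rightarrow> 3 \<Rightarrow> real^3 \<Rightarrow> real \<Rightarrow> real" where
  "Q k i j x t = convolution k (\<lambda>y. u y t $ i * u y t $ j) x"

definition Qv :: "(real^3 \<Rightarrow> real) \<Rightarrow> 3 \<Rightarrow> 3 \<Rightarrow> (real^3) \<times> real \<Rightarrow> real" where
  "Qv k i j z = (LINT y|lborel. k (fst z - y) * (v (y, snd z) $ i * v (y, snd z) $ j))"

lemma V_has_derivative:
  assumes "test_function UNIV k" "t \<in> T"
  shows "((\<lambda>x. V k i x t) has_derivative (\<lambda>h. \<Sum>j\<in>UNIV. h $ j *\<^sub>R V (pd j k) i x t)) (at x)"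
  using convolution_has_derivative[OF assms(1) u_component_integrable[OF assms(2)]]
  unfolding V_def by simp

text \<open>\<open>V k i x t\<close> is the pairing of \<open>u\<close> at time \<open>t\<close>
  with the test field \<open>k (x - y)\<close> times the \<open>i\<close>-th unit vector, so this is
  exactly weak continuity. Products of components are not pairings of this type.\<close>

lemma V_time_continuous:
  assumes "test_function UNIV k"
  shows "continuous_on T (V k i x)"
proof -
  let ?w = "\<lambda>y. k (x - y) *\<^sub>R (axis i 1 :: real^3)"
  have k: "smooth_on UNIV k" "\<exists>R. \<forall>x. R < norm x \<longrightarrow> k x = 0"
    using assms test_function_UNIV_iff by blast+
  obtain R where R: "\<And>x. R < norm x \<Longrightarrow> k x = 0"
    using k by blast
  have "smooth_on UNIV (\<lambda>y. k (- y + x))"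
    by (intro smooth_on_affine[OF _ k(1)]) (auto intro: bounded_linear_minus bounded_linear_ident)
  then have "smooth_on UNIV ?w"
    by (intro smooth_on_scaleR smooth_on_const) simp
  moreover have "?w y = 0" if "R + norm x < norm y" for y
    using translated_kernel(2)[OF smooth_on_imp_continuous[OF k(1)] R order_refl] that by simp
  ultimately have "test_function UNIV ?w"
    unfolding test_function_UNIV_iff by blast
  then have "continuous_on T (\<lambda>t. LINT y|lebesgue. u y t \<bullet> ?w y)"
    using weak_continuity unfolding weakly_continuous_in_time_def by blast
  then show ?thesis
    by (simp add: V_def convolution_def inner_axis cong: continuous_on_cong)
qed

text \<open>The energy bounds the local L1 norm of a component for almost every time; continuity in
  time extends the resulting bound to all times of the interval.\<close>

lemma V_bounded:
  assumes k: "test_function UNIV k" and ab: "a < b" "{a..b} \<subseteq> T"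
  shows "\<exists>M\<ge>0. \<forall>t\<in>{a..b}. \<forall>x\<in>cball 0 r. \<bar>V k i x t\<bar> \<le> M"
proof -
  have kc: "continuous_on UNIV k"
    using k by (auto simp: test_function_def intro: smooth_on_imp_continuous)
  obtain R where R: "\<And>x. R < norm x \<Longrightarrow> k x = 0"
    using k test_function_UNIV_iff by blast
  obtain M where M: "M \<ge> 0" "\<And>x. \<bar>k x\<bar> \<le> M"
    using compact_support_bounded[OF kc R] by auto
  obtain C where C: "AE t in lborel. t \<in> {a..b} \<longrightarrow> (LINT x:cball 0 (R + r)|lebesgue. (norm (u x t))\<^sup>2) \<le> C"
    using energy_bound[OF ab(2)] by blast
  define K where "K = M * (measure lebesgue (cball (0::real^3) (R + r)) + C)"
  have "\<bar>V k i x t\<bar> \<le> K" if t: "t \<in> {a..b}" and x: "x \<in> cball 0 r" for t x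
  proof (rule continuous_AE_le[where f="\<lambda>t. \<bar>V k i x t\<bar>", OF _ _ ab(1) t])
    show "continuous_on {a..b} (\<lambda>t. \<bar>V k i x t\<bar>)"
      by (intro continuous_intros continuous_on_subset[OF V_time_continuous[OF k] ab(2)])
    show "AE t in lborel. t \<in> {a..b} \<longrightarrow> \<bar>V k i x t\<bar> \<le> K"
      using C
    proof eventually_elim
      case (elim t)
      show ?case
      proof
        assume t: "t \<in> {a..b}"
        then have tT: "t \<in> T" using ab by auto
        have "\<bar>V k i x t\<bar> \<le> M * (LINT x:cball 0 (R + r)|lebesgue. \<bar>u x t $ i\<bar>)"
          unfolding V_def using x by (intro convolution_bound[OF kc R M(2)] u_component_integrable tT) auto
        also have "\<dots> \<le> K"
          unfolding K_def using u_component_L1[OF tT, of "R + r" i] elim t M(1)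
          by (intro mult_left_mono) auto
        finally show "\<bar>V k i x t\<bar> \<le> K" .
      qed
    qed
  qed
  then show ?thesis
    by (intro exI[of _ "max K 0"]) (auto simp: le_max_iff_disj)
qed

text \<open>The spatial derivatives of \<open>V\<close> are again of the form \<open>V\<close>, with
  kernel \<open>pd j k\<close>, hence bounded uniformly in time; the mean value inequality on the
  convex ball concludes.\<close>

lemma V_lipschitz:
  assumes k: "test_function UNIV k" and ab: "a < b" "{a..b} \<subseteq> T"
  shows "\<exists>L\<ge>0. \<forall>t\<in>{a..b}. \<forall>x\<in>cball 0 r. \<forall>y\<in>cball 0 r. \<bar>V k i x t - V k i y t\<bar> \<le> L * norm (x - y)"
proof -
  have "\<exists>M\<ge>0. \<forall>t\<in>{a..b}. \<forall>x\<in>cball 0 r. \<bar>V (pd j k) i x t\<bar> \<le> M" for j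
    by (rule V_bounded[OF test_function_pd[OF k] ab])
  then obtain M where M: "\<And>j. M j \<ge> 0" "\<And>j t x. t \<in> {a..b} \<Longrightarrow> x \<in> cball 0 r \<Longrightarrow> \<bar>V (pd j k) i x t\<bar> \<le> M j"
    by metis
  define L where "L = (\<Sum>j\<in>UNIV. M j)"
  have "\<bar>V k i x t - V k i y t\<bar> \<le> L * norm (x - y)"
    if t: "t \<in> {a..b}" and xy: "x \<in> cball 0 r" "y \<in> cball 0 r" for t x y
  proof -
    have tT: "t \<in> T" using t ab by auto
    have "norm (V k i x t - V k i y t) \<le> L * norm (x - y)"
    proof (rule differentiable_bound[OF convex_cball _ _ xy(1,2)])
      fix z :: "real^3" assume z: "z \<in> cball 0 r"
      show "((\<lambda>x. V k i x t) has_derivative (\<lambda>h. \<Sum>j\<in>UNIV. h $ j *\<^sub>R V (pd j k) i z t)) (at z within cball 0 r)"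
        by (rule has_derivative_at_withinI[OF V_has_derivative[OF k tT]])
      show "onorm (\<lambda>h. \<Sum>j\<in>UNIV. h $ j *\<^sub>R V (pd j k) i z t) \<le> L"
      proof (rule onorm_le)
        fix h :: "real^3"
        have "norm (\<Sum>j\<in>UNIV. h $ j *\<^sub>R V (pd j k) i z t) \<le> (\<Sum>j\<in>UNIV. norm h * M j)"
          by (rule sum_norm_le) (use M(2)[OF t z] component_le_norm_cart[of h] in \<open>auto simp: abs_mult intro!: mult_mono\<close>)
        then show "norm (\<Sum>j\<in>UNIV. h $ j *\<^sub>R V (pd j k) i z t) \<le> L * norm h"
          by (simp add: L_def sum_distrib_left mult.commute)
      qed
    qed
    then show ?thesis by simp
  qed
  moreover have "L \<ge> 0"
    unfolding L_def by (intro sum_nonneg M(1))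
  ultimately show ?thesis by blast
qed

text \<open>Continuity in time at fixed \<open>x\<close> together with a Lipschitz bound in space
  that is uniform in time yields joint continuity.\<close>

lemma V_continuous:
  assumes k: "test_function UNIV k" and ab: "a < b" "{a..b} \<subseteq> T"
  shows "continuous_on (UNIV \<times> {a..b}) (\<lambda>(x, t). V k i x t)"
proof -
  have "((\<lambda>(x, t). V k i x t) \<longlongrightarrow> V k i x t) (at (x, t) within UNIV \<times> {a..b})"
    if t: "t \<in> {a..b}" for x t
  proof -
    obtain L where L: "\<And>t y z. t \<in> {a..b} \<Longrightarrow> y \<in> cball 0 (norm x + 1) \<Longrightarrow> z \<in> cball 0 (norm x + 1)
        \<Longrightarrow> \<bar>V k i y t - V k i z t\<bar> \<le> L * norm (y - z)"
      using V_lipschitz[OF k ab, of "norm x + 1" i] by blast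
    let ?F = "at (x, t) within UNIV \<times> {a..b}"
    have fst_lim: "(fst \<longlongrightarrow> x) ?F" and snd_lim: "(snd \<longlongrightarrow> t) ?F"
      using tendsto_fst[OF tendsto_ident_at[of "(x,t)" "UNIV \<times> {a..b}"]]
        tendsto_snd[OF tendsto_ident_at[of "(x,t)" "UNIV \<times> {a..b}"]] by simp_all
    have mem: "eventually (\<lambda>z. snd z \<in> {a..b}) ?F"
      unfolding eventually_at_filter by (auto intro: always_eventually)
    have "continuous_on {a..b} (V k i x)"
      by (rule continuous_on_subset[OF V_time_continuous[OF k] ab(2)])
    then have l1: "((\<lambda>z. V k i x (snd z)) \<longlongrightarrow> V k i x t) ?F"
      using continuous_on_tendsto_compose[OF _ snd_lim t mem] by blast
    have near: "eventually (\<lambda>z. dist (fst z) x < 1) ?F"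
      using tendstoD[OF fst_lim, of 1] by simp
    have "((\<lambda>z. V k i (fst z) (snd z) - V k i x (snd z)) \<longlongrightarrow> 0) ?F"
    proof (rule Lim_null_comparison)
      show "eventually (\<lambda>z. norm (V k i (fst z) (snd z) - V k i x (snd z)) \<le> L * norm (fst z - x)) ?F"
        using mem near
      proof eventually_elim
        case (elim z)
        have "norm (fst z) \<le> norm x + 1"
          using elim(2) norm_triangle_sub[of "fst z" x] by (simp add: dist_norm)
        then show ?case
          using L[of "snd z" "fst z" x] elim by simp
      qed
      have "((\<lambda>z. L * norm (fst z - x)) \<longlongrightarrow> L * norm (x - x)) ?F"
        by (intro tendsto_intros fst_lim)
      then show "((\<lambda>z. L * norm (fst z - x)) \<longlongrightarrow> 0) ?F" by simp
    qed
    from tendsto_add[OF this l1] show ?thesis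
      by (simp add: case_prod_unfold)
  qed
  then show ?thesis
    by (auto simp: continuous_on_def)
qed

text \<open>The energy on one larger ball controls the convolution at every \<open>x\<close> of the
  smaller ball, so the exceptional set of times does not depend on \<open>x\<close>. With no
  continuity in time, the bound stays an almost-everywhere statement.\<close>

lemma Q_bounded:
  assumes k: "test_function UNIV k" and ab: "{a..b} \<subseteq> T"
  shows "\<exists>M. AE t in lborel. t \<in> {a..b} \<longrightarrow> (\<forall>x\<in>cball 0 r. \<bar>Q k i j x t\<bar> \<le> M)"
proof -
  have kc: "continuous_on UNIV k"
    using k by (auto simp: test_function_def intro: smooth_on_imp_continuous)
  obtain R where R: "\<And>x. R < norm x \<Longrightarrow> k x = 0"
    using k test_function_UNIV_iff by blast
  obtain M where M: "M \<ge> 0" "\<And>x. \<bar>k x\<bar> \<le> M"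
    using compact_support_bounded[OF kc R] by auto
  obtain C where C: "AE t in lborel. t \<in> {a..b} \<longrightarrow> (LINT x:cball 0 (R + r)|lebesgue. (norm (u x t))\<^sup>2) \<le> C"
    using energy_bound[OF ab] by blast
  have "AE t in lborel. t \<in> {a..b} \<longrightarrow> (\<forall>x\<in>cball 0 r. \<bar>Q k i j x t\<bar> \<le> M * C)"
    using C
  proof eventually_elim
    case (elim t)
    show ?case
    proof (intro impI ballI)
      fix x :: "real^3" assume t: "t \<in> {a..b}" and x: "x \<in> cball 0 r"
      then have tT: "t \<in> T" using ab by auto
      have "\<bar>Q k i j x t\<bar> \<le> M * (LINT x:cball 0 (R + r)|lebesgue. \<bar>u x t $ i * u x t $ j\<bar>)"
        unfolding Q_def using x by (intro convolution_bound[OF kc R M(2)] u_product_integrable tT) auto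
      also have "\<dots> \<le> M * C"
        using u_product_L1[OF tT, of "R + r" i j] elim t M(1) by (intro mult_left_mono) auto
      finally show "\<bar>Q k i j x t\<bar> \<le> M * C" .
    qed
  qed
  then show ?thesis by blast
qed

lemma Qv_borel: 
  assumes "continuous_on UNIV k"
  shows "Qv k i j \<in> borel_measurable borel"
proof -
  have [measurable]: "k \<in> borel_measurable borel"
    using assms by (rule borel_measurable_continuous_onI)
  have "(\<lambda>(z, y). k (fst z - y) * (v (y, snd z) $ i * v (y, snd z) $ j))
      \<in> borel_measurable borel"
  proof -
    have "(\<lambda>z::((real^3) \<times> real) \<times> (real^3). fst (fst z) - snd z) \<in> borel_measurable borel"
      "(\<lambda>z::((real^3) \<times> real) \<times> (real^3). (snd z, snd (fst z))) \<in> borel_measurable borel"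
      by (intro borel_measurable_continuous_onI continuous_intros)+
    note m = this
    show ?thesis
      using measurable_compose[OF m(1) borel_measurable_continuous_onI[OF assms]]
        measurable_compose[OF m(2) v_component_borel]
      unfolding case_prod_unfold by (intro borel_measurable_times)
  qed
  note m = this
  \<comment> \<open>Measurability of parameter integrals is stated for the product with
    \<open>lborel\<close>; that product has the same sets as the Borel algebra of the product
    space.\<close>
  have eq: "sets ((borel :: ((real^3) \<times> real) measure) \<Otimes>\<^sub>M (lborel :: (real^3) measure)) = sets borel"
    by (subst sets_pair_measure_cong[OF refl sets_lborel]) (simp only: borel_prod)
  have "(\<lambda>(z, y). k (fst z - y) * (v (y, snd z) $ i * v (y, snd z) $ j))
      \<in> borel_measurable ((borel :: ((real^3) \<times> real) measure) \<Otimes>\<^sub>M lborel)"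
    unfolding measurable_cong_sets[OF eq refl] by (rule m)
  then show ?thesis
    unfolding Qv_def[abs_def] by (rule lborel.borel_measurable_lebesgue_integral)
qed

lemma v_slice_borel: "(\<lambda>y. v (y, t) $ i) \<in> borel_measurable borel"
proof -
  have "(\<lambda>y::real^3. (y, t)) \<in> borel_measurable borel"
    by (intro borel_measurable_continuous_onI continuous_intros)
  from measurable_compose[OF this v_component_borel] show ?thesis .
qed

text \<open>The exceptional times are those at which the slices of \<open>u\<close> and
  \<open>v\<close> differ on a set of positive measure. They do not involve \<open>x\<close>, so at
  any other time the identity holds at all points.\<close>

lemma Q_eq_Qv:
  assumes "continuous_on UNIV k"
  shows "AE t in lborel. t \<in> T \<longrightarrow> (\<forall>x. Q k i j x t = Qv k i j (x, t))"
  using v_AE_slices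
proof eventually_elim
  case (elim t)
  show ?case
  proof (intro impI allI)
    fix x assume t: "t \<in> T"
    have "AE y in lebesgue. u y t $ i * u y t $ j = v (y, t) $ i * v (y, t) $ j"
      using elim[rule_format, OF t] by eventually_elim simp
    from convolution_borel_version[OF assms
        borel_measurable_times[OF u_component_measurable[OF t] u_component_measurable[OF t]]
        borel_measurable_times[OF v_slice_borel v_slice_borel] this]
    show "Q k i j x t = Qv k i j (x, t)"
      by (simp add: Q_def Qv_def)
  qed
qed

end

section \<open>Functions of time with bounded weak derivative\<close>

lemma AE_bounded_set_integral:
  fixes f :: "real \<Rightarrow> real"
  assumes f: "set_borel_measurable lborel {a..b} f" and M: "AE \<tau> in lborel. \<tau> \<in> {a..b} \<longrightarrow> \<bar>f \<tau>\<bar> \<le> M"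
  shows "set_integrable lborel {a..b} f"
    and "a \<le> b \<Longrightarrow> \<bar>LINT \<tau>:{a..b}|lborel. f \<tau>\<bar> \<le> M * (b - a)"
proof -
  have ind: "integrable lborel (\<lambda>t. indicator {a..b} t * M)"
    by (intro integrable_mult_left) (simp add: integrable_indicator_iff emeasure_lborel_Icc_eq)
  have le: "AE t in lborel. norm (indicator {a..b} t *\<^sub>R f t) \<le> indicator {a..b} t * M"
    using M by eventually_elim (simp add: indicator_def)
  show 1: "set_integrable lborel {a..b} f"
    unfolding set_integrable_def
  proof (rule Bochner_Integration.integrable_bound[OF ind f[unfolded set_borel_measurable_def]])
    show "AE t in lborel. norm (indicator {a..b} t *\<^sub>R f t) \<le> norm (indicator {a..b} t * M)"
      using le by eventually_elim (simp add: indicator_def split: if_splits)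
  qed
  show "\<bar>LINT \<tau>:{a..b}|lborel. f \<tau>\<bar> \<le> M * (b - a)" if "a \<le> b"
  proof -
    have "\<bar>LINT \<tau>:{a..b}|lborel. f \<tau>\<bar> \<le> (LINT t|lborel. norm (indicator {a..b} t *\<^sub>R f t))"
      unfolding set_lebesgue_integral_def
      using integral_norm_bound[of lborel "\<lambda>t. indicator {a..b} t *\<^sub>R f t"] by simp
    also have "\<dots> \<le> (LINT t|lborel. indicator {a..b} t * M)"
      using 1 unfolding set_integrable_def by (intro integral_mono_AE ind le) (rule integrable_norm)
    also have "\<dots> = M * (b - a)"
      using that by simp
    finally show ?thesis .
  qed
qed

text \<open>
  The product rule below is proved without absolute continuity: the defect of the product rule
  on an interval is quadratic in its length, and additive functions of intervals with that
  property vanish.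
\<close>

lemma quadratic_increment_constant:
  fixes D :: "real \<Rightarrow> real"
  assumes D: "\<And>x y. a \<le> x \<Longrightarrow> x \<le> y \<Longrightarrow> y \<le> b \<Longrightarrow> \<bar>D y - D x\<bar> \<le> C * (y - x)\<^sup>2" and "a \<le> b"
  shows "D b = D a"
proof -
  have q: "\<bar>D y - D x\<bar> \<le> C * \<bar>y - x\<bar>\<^sup>2" if "x \<in> {a..b}" "y \<in> {a..b}" for x y
    using D[of x y] D[of y x] that by (cases "x \<le> y") (auto simp: abs_minus_commute power2_commute)
  have "(D has_field_derivative 0) (at x within {a..b})" if x: "x \<in> {a..b}" for x
    unfolding has_field_derivative_iff
  proof (rule Lim_null_comparison)
    show "\<forall>\<^sub>F y in at x within {a..b}. norm ((D y - D x) / (y - x)) \<le> C * \<bar>y - x\<bar>"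
      unfolding eventually_at_filter
    proof (intro always_eventually allI impI)
      fix y assume y: "y \<noteq> x" "y \<in> {a..b}"
      then show "norm ((D y - D x) / (y - x)) \<le> C * \<bar>y - x\<bar>"
        using q[OF x y(2)] by (simp add: abs_divide pos_divide_le_eq power2_eq_square mult.assoc)
    qed
    have "((\<lambda>y. C * \<bar>y - x\<bar>) \<longlongrightarrow> C * \<bar>x - x\<bar>) (at x within {a..b})"
      by (intro tendsto_intros)
    then show "((\<lambda>y. C * \<bar>y - x\<bar>) \<longlongrightarrow> 0) (at x within {a..b})" by simp
  qed
  from has_field_derivative_zero_constant[OF convex_real_interval(5) this]
  obtain c where "\<And>x. x \<in> {a..b} \<Longrightarrow> D x = c" by blast
  then show ?thesis using \<open>a \<le> b\<close> by simp
qed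

text \<open>Encodes that \<open>F\<close> is Lipschitz with almost-everywhere derivative
  \<open>f\<close>, in integrated form: \<open>F\<close> is never differentiated and
  \<open>f\<close> matters only up to null sets.\<close>

definition bounded_primitive :: "real \<Rightarrow> real \<Rightarrow> (real \<Rightarrow> real) \<Rightarrow> (real \<Rightarrow> real) \<Rightarrow> bool" where
  "bounded_primitive a b F f \<longleftrightarrow>
     set_borel_measurable lborel {a..b} f \<and> (\<exists>M. AE \<tau> in lborel. \<tau> \<in> {a..b} \<longrightarrow> \<bar>f \<tau>\<bar> \<le> M) \<and>
     (\<forall>s t. a \<le> s \<longrightarrow> s \<le> t \<longrightarrow> t \<le> b \<longrightarrow> F t - F s = (LINT \<tau>:{s..t}|lborel. f \<tau>))"

lemma bounded_primitiveD:
  assumes "bounded_primitive a b F f" "a \<le> s" "s \<le> t" "t \<le> b"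
  shows "F t - F s = (LINT \<tau>:{s..t}|lborel. f \<tau>)" "set_integrable lborel {s..t} f"
proof -
  show "F t - F s = (LINT \<tau>:{s..t}|lborel. f \<tau>)"
    using assms by (simp add: bounded_primitive_def)
  obtain M where "set_borel_measurable lborel {a..b} f" "AE \<tau> in lborel. \<tau> \<in> {a..b} \<longrightarrow> \<bar>f \<tau>\<bar> \<le> M"
    using assms(1) unfolding bounded_primitive_def by blast
  from AE_bounded_set_integral(1)[OF this] show "set_integrable lborel {s..t} f"
    by (rule set_integrable_subset) (use assms in auto)
qed

lemma bounded_primitive_lipschitz:
  assumes "bounded_primitive a b F f"
  shows "\<exists>M\<ge>0. (AE \<tau> in lborel. \<tau> \<in> {a..b} \<longrightarrow> \<bar>f \<tau>\<bar> \<le> M)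
    \<and> (\<forall>s\<in>{a..b}. \<forall>t\<in>{a..b}. \<bar>F t - F s\<bar> \<le> M * \<bar>t - s\<bar>)"
proof -
  have f: "set_borel_measurable lborel {a..b} f"
    using assms by (simp add: bounded_primitive_def)
  obtain M0 where M0: "AE \<tau> in lborel. \<tau> \<in> {a..b} \<longrightarrow> \<bar>f \<tau>\<bar> \<le> M0"
    using assms unfolding bounded_primitive_def by blast
  \<comment> \<open>If the interval is a null set, an essential bound may be negative; the maximum
    makes it a legitimate Lipschitz constant.\<close>
  define M where "M = max M0 0"
  have M: "AE \<tau> in lborel. \<tau> \<in> {a..b} \<longrightarrow> \<bar>f \<tau>\<bar> \<le> M"
    using M0 by eventually_elim (auto simp: M_def)
  have le: "\<bar>F t - F s\<bar> \<le> M * (t - s)" if "a \<le> s" "s \<le> t" "t \<le> b" for s t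
  proof -
    have "set_borel_measurable lborel {s..t} f"
      by (rule set_borel_measurable_subset[OF f]) (use that in auto)
    moreover have "AE \<tau> in lborel. \<tau> \<in> {s..t} \<longrightarrow> \<bar>f \<tau>\<bar> \<le> M"
      using M by eventually_elim (use that in auto)
    ultimately have "\<bar>LINT \<tau>:{s..t}|lborel. f \<tau>\<bar> \<le> M * (t - s)"
      using that(2) by (rule AE_bounded_set_integral(2))
    then show ?thesis
      unfolding bounded_primitiveD(1)[OF assms that] .
  qed
  have "\<bar>F t - F s\<bar> \<le> M * \<bar>t - s\<bar>" if "s \<in> {a..b}" "t \<in> {a..b}" for s t
    using le[of s t] le[of t s] that by (cases "s \<le> t") (auto simp: abs_minus_commute)
  with M show ?thesis
    by (intro exI[of _ M]) (auto simp: M_def)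
qed

lemma bounded_primitive_continuous:
  assumes "bounded_primitive a b F f"
  shows "continuous_on {a..b} F"
proof -
  obtain M where "M \<ge> 0" "\<forall>s\<in>{a..b}. \<forall>t\<in>{a..b}. \<bar>F t - F s\<bar> \<le> M * \<bar>t - s\<bar>"
    using bounded_primitive_lipschitz[OF assms] by blast
  then have "M-lipschitz_on {a..b} F"
    by (intro lipschitz_onI) (auto simp: dist_real_def abs_minus_commute)
  then show ?thesis
    by (rule lipschitz_on_continuous_on)
qed

section \<open>Algebra of bounded primitives\<close>

lemma set_borel_measurable_mult:
  fixes f g :: "real \<Rightarrow> real"
  assumes "set_borel_measurable M S f" "set_borel_measurable M S g"
  shows "set_borel_measurable M S (\<lambda>x. f x * g x)"
proof -
  have "(\<lambda>x. (indicator S x *\<^sub>R f x) * (indicator S x *\<^sub>R g x)) \<in> borel_measurable M"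
    using assms unfolding set_borel_measurable_def by (rule borel_measurable_times)
  moreover have "(\<lambda>x. (indicator S x *\<^sub>R f x) * (indicator S x *\<^sub>R g x)) = (\<lambda>x. indicator S x *\<^sub>R (f x * g x))"
    by (auto simp: indicator_def)
  ultimately show ?thesis
    unfolding set_borel_measurable_def by simp
qed

lemma set_borel_measurable_add:
  fixes f g :: "real \<Rightarrow> real"
  assumes "set_borel_measurable M S f" "set_borel_measurable M S g"
  shows "set_borel_measurable M S (\<lambda>x. f x + g x)"
  using borel_measurable_add[OF assms[unfolded set_borel_measurable_def]]
  unfolding set_borel_measurable_def by (simp add: distrib_left)

lemma set_borel_measurable_continuous:
  fixes f :: "real \<Rightarrow> real"
  assumes "continuous_on {a..b} f"
  shows "set_borel_measurable lborel {a..b} f"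
  using borel_measurable_continuous_on_indicator[OF _ assms]
  unfolding set_borel_measurable_def by simp

lemma bounded_primitive_add:
  assumes F: "bounded_primitive a b F f" and G: "bounded_primitive a b G g"
  shows "bounded_primitive a b (\<lambda>t. F t + G t) (\<lambda>t. f t + g t)"
  unfolding bounded_primitive_def
proof (intro conjI allI impI)
  show "set_borel_measurable lborel {a..b} (\<lambda>t. f t + g t)"
    using F G by (intro set_borel_measurable_add) (auto simp: bounded_primitive_def)
  obtain M N where "AE \<tau> in lborel. \<tau> \<in> {a..b} \<longrightarrow> \<bar>f \<tau>\<bar> \<le> M" "AE \<tau> in lborel. \<tau> \<in> {a..b} \<longrightarrow> \<bar>g \<tau>\<bar> \<le> N"
    using F G unfolding bounded_primitive_def by blast
  then have "AE \<tau> in lborel. \<tau> \<in> {a..b} \<longrightarrow> \<bar>f \<tau> + g \<tau>\<bar> \<le> M + N"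
    by eventually_elim auto
  then show "\<exists>M. AE \<tau> in lborel. \<tau> \<in> {a..b} \<longrightarrow> \<bar>f \<tau> + g \<tau>\<bar> \<le> M" by blast
  fix s t assume st: "a \<le> s" "s \<le> t" "t \<le> b"
  show "F t + G t - (F s + G s) = (LINT \<tau>:{s..t}|lborel. f \<tau> + g \<tau>)"
    using bounded_primitiveD[OF F st] bounded_primitiveD[OF G st] set_integral_add(2)[of lborel "{s..t}" f g]
    by simp
qed

text \<open>On an interval of length \<open>t - s\<close> each factor varies by at most its
  Lipschitz constant times the length, while the derivative of the other is bounded by
  \<open>M\<close> or \<open>N\<close>. The product rule therefore fails by at most
  \<open>2 * (M * N) * (t - s)\<^sup>2\<close>, and \<open>quadratic_increment_constant\<close>
  applies to the product minus the integral of the expected derivative.\<close>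

lemma bounded_primitive_mult:
  assumes F: "bounded_primitive a b F f" and G: "bounded_primitive a b G g"
  shows "bounded_primitive a b (\<lambda>t. F t * G t) (\<lambda>t. f t * G t + F t * g t)" (is "bounded_primitive a b _ ?h")
proof -
  obtain M where M: "M \<ge> 0" "AE \<tau> in lborel. \<tau> \<in> {a..b} \<longrightarrow> \<bar>f \<tau>\<bar> \<le> M"
      "\<And>s t. s \<in> {a..b} \<Longrightarrow> t \<in> {a..b} \<Longrightarrow> \<bar>F t - F s\<bar> \<le> M * \<bar>t - s\<bar>"
    using bounded_primitive_lipschitz[OF F] by blast
  obtain N where N: "N \<ge> 0" "AE \<tau> in lborel. \<tau> \<in> {a..b} \<longrightarrow> \<bar>g \<tau>\<bar> \<le> N"
      "\<And>s t. s \<in> {a..b} \<Longrightarrow> t \<in> {a..b} \<Longrightarrow> \<bar>G t - G s\<bar> \<le> N * \<bar>t - s\<bar>"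
    using bounded_primitive_lipschitz[OF G] by blast
  have Fc: "continuous_on {a..b} F" and Gc: "continuous_on {a..b} G"
    using bounded_primitive_continuous F G by auto
  have fm: "set_borel_measurable lborel {a..b} f" and gm: "set_borel_measurable lborel {a..b} g"
    using F G by (auto simp: bounded_primitive_def)
  have hm: "set_borel_measurable lborel {a..b} ?h"
    by (intro set_borel_measurable_add set_borel_measurable_mult fm gm set_borel_measurable_continuous Fc Gc)
  obtain B where B: "\<And>t. t \<in> {a..b} \<Longrightarrow> \<bar>F t\<bar> \<le> B \<and> \<bar>G t\<bar> \<le> B"
  proof -
    have "bounded (F ` {a..b})" "bounded (G ` {a..b})"
      using Fc Gc by (auto intro!: compact_imp_bounded compact_continuous_image)
    then obtain B1 B2 where "\<forall>x\<in>{a..b}. \<bar>F x\<bar> \<le> B1" "\<forall>x\<in>{a..b}. \<bar>G x\<bar> \<le> B2"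
      unfolding bounded_iff by auto
    then show thesis
      by (intro that[of "max B1 B2"]) (auto simp: le_max_iff_disj)
  qed
  have hb: "AE \<tau> in lborel. \<tau> \<in> {a..b} \<longrightarrow> \<bar>?h \<tau>\<bar> \<le> M * B + B * N"
    using M(2) N(2)
  proof eventually_elim
    case (elim \<tau>)
    show ?case
    proof
      assume \<tau>: "\<tau> \<in> {a..b}"
      have "\<bar>?h \<tau>\<bar> \<le> \<bar>f \<tau>\<bar> * \<bar>G \<tau>\<bar> + \<bar>F \<tau>\<bar> * \<bar>g \<tau>\<bar>"
        using abs_triangle_ineq[of "f \<tau> * G \<tau>" "F \<tau> * g \<tau>"] by (simp add: abs_mult)
      also have "\<dots> \<le> M * B + B * N"
        using elim \<tau> B[OF \<tau>] M(1) by (intro add_mono mult_mono) auto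
      finally show "\<bar>?h \<tau>\<bar> \<le> M * B + B * N" .
    qed
  qed
  have hint: "set_integrable lborel {s..t} ?h" if "a \<le> s" "t \<le> b" for s t
    by (rule set_integrable_subset[OF AE_bounded_set_integral(1)[OF hm hb]]) (use that in auto)
  have est: "\<bar>F t * G t - F s * G s - (LINT \<tau>:{s..t}|lborel. ?h \<tau>)\<bar> \<le> 2 * (M * N) * (t - s)\<^sup>2"
    if st: "a \<le> s" "s \<le> t" "t \<le> b" for s t
  proof -
    let ?e = "\<lambda>\<tau>. f \<tau> * (G t - G \<tau>) + (F s - F \<tau>) * g \<tau>"
    have "continuous_on {a..b} (\<lambda>\<tau>. G t - G \<tau>)" "continuous_on {a..b} (\<lambda>\<tau>. F s - F \<tau>)"
      by (intro continuous_intros Fc Gc)+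
    then have "set_borel_measurable lborel {a..b} ?e"
      by (intro set_borel_measurable_add set_borel_measurable_mult fm gm set_borel_measurable_continuous)
    then have em: "set_borel_measurable lborel {s..t} ?e"
      by (rule set_borel_measurable_subset) (use st in auto)
    have eb: "AE \<tau> in lborel. \<tau> \<in> {s..t} \<longrightarrow> \<bar>?e \<tau>\<bar> \<le> 2 * (M * N) * (t - s)"
      using M(2) N(2)
    proof eventually_elim
      case (elim \<tau>)
      show ?case
      proof
        assume \<tau>: "\<tau> \<in> {s..t}"
        then have ab: "\<tau> \<in> {a..b}" "s \<in> {a..b}" "t \<in> {a..b}" using st by auto
        have "\<bar>?e \<tau>\<bar> \<le> \<bar>f \<tau>\<bar> * \<bar>G t - G \<tau>\<bar> + \<bar>F s - F \<tau>\<bar> * \<bar>g \<tau>\<bar>"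
          using abs_triangle_ineq[of "f \<tau> * (G t - G \<tau>)" "(F s - F \<tau>) * g \<tau>"] by (simp add: abs_mult)
        also have "\<dots> \<le> M * (N * (t - s)) + (M * (t - s)) * N"
        proof (intro add_mono mult_mono)
          show "\<bar>G t - G \<tau>\<bar> \<le> N * (t - s)"
            using N(3)[OF ab(1,3)] \<tau> N(1) by (auto intro!: order_trans[OF N(3)[OF ab(1,3)]] mult_left_mono)
          show "\<bar>F s - F \<tau>\<bar> \<le> M * (t - s)"
            using M(3)[OF ab(1,2)] \<tau> M(1) by (auto intro!: order_trans[OF M(3)[OF ab(1,2)]] mult_left_mono)
        qed (use elim ab M(1) N(1) st in auto)
        also have "\<dots> = 2 * (M * N) * (t - s)" by (simp add: algebra_simps)
        finally show "\<bar>?e \<tau>\<bar> \<le> 2 * (M * N) * (t - s)" .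
      qed
    qed
    have ei: "set_integrable lborel {s..t} ?e"
      by (rule AE_bounded_set_integral(1)[OF em eb])
    have "(LINT \<tau>:{s..t}|lborel. ?h \<tau>) + (LINT \<tau>:{s..t}|lborel. ?e \<tau>) = (LINT \<tau>:{s..t}|lborel. ?h \<tau> + ?e \<tau>)"
      using set_integral_add(2)[OF hint[OF st(1,3)] ei] by simp
    also have "\<dots> = (LINT \<tau>:{s..t}|lborel. G t * f \<tau> + F s * g \<tau>)"
      by (rule arg_cong[where f="set_lebesgue_integral lborel {s..t}"]) (auto simp: algebra_simps)
    also have "\<dots> = (LINT \<tau>:{s..t}|lborel. G t * f \<tau>) + (LINT \<tau>:{s..t}|lborel. F s * g \<tau>)"
      using bounded_primitiveD(2)[OF F st] bounded_primitiveD(2)[OF G st] by (intro set_integral_add(2)) auto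
    also have "\<dots> = F t * G t - F s * G s"
      using bounded_primitiveD(1)[OF F st] bounded_primitiveD(1)[OF G st]
      by (simp add: algebra_simps flip: bounded_primitiveD(1)[OF F st] bounded_primitiveD(1)[OF G st])
    finally have "F t * G t - F s * G s - (LINT \<tau>:{s..t}|lborel. ?h \<tau>) = (LINT \<tau>:{s..t}|lborel. ?e \<tau>)"
      by simp
    then show ?thesis
      using AE_bounded_set_integral(2)[OF em eb st(2)] by (simp add: power2_eq_square mult.assoc)
  qed
  have main: "F t * G t - F s * G s = (LINT \<tau>:{s..t}|lborel. ?h \<tau>)"
    if st: "a \<le> s" "s \<le> t" "t \<le> b" for s t
  proof -
    define I where "I x = (LINT \<tau>:{s..x}|lborel. ?h \<tau>)" for x
    have Iadd: "I y - I x = (LINT \<tau>:{x..y}|lborel. ?h \<tau>)" if "s \<le> x" "x \<le> y" "y \<le> t" for x y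
    proof -
      have "integral {s..x} ?h + integral {x..y} ?h = integral {s..y} ?h"
        by (rule Henstock_Kurzweil_Integration.integral_combine)
           (use that st in \<open>auto intro!: set_borel_integral_eq_integral(1) hint\<close>)
      then show ?thesis
        unfolding I_def using that st by (simp add: set_borel_integral_eq_integral(2) hint)
    qed
    have "F t * G t - I t = F s * G s - I s"
    proof (rule quadratic_increment_constant[OF _ st(2)])
      fix x y assume xy: "s \<le> x" "x \<le> y" "y \<le> t"
      have "F y * G y - I y - (F x * G x - I x) = F y * G y - F x * G x - (LINT \<tau>:{x..y}|lborel. ?h \<tau>)"
        using Iadd[OF xy] by simp
      then show "\<bar>F y * G y - I y - (F x * G x - I x)\<bar> \<le> 2 * (M * N) * (y - x)\<^sup>2"
        using est[of x y] xy st by simp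
    qed
    moreover have "I s = 0"
      using Iadd[of s s] st I_def[of s] by simp
    ultimately show ?thesis
      by (simp add: I_def)
  qed
  show ?thesis
    unfolding bounded_primitive_def using hm hb main by blast
qed

lemma bounded_primitive_C1:
  fixes F f :: "real \<Rightarrow> real"
  assumes der: "\<And>t. t \<in> {a..b} \<Longrightarrow> (F has_vector_derivative f t) (at t within {a..b})"
    and f: "continuous_on {a..b} f"
  shows "bounded_primitive a b F f"
  unfolding bounded_primitive_def
proof (intro conjI allI impI)
  show "set_borel_measurable lborel {a..b} f"
    by (rule set_borel_measurable_continuous[OF f])
  have "bounded (f ` {a..b})"
    using f by (auto intro!: compact_imp_bounded compact_continuous_image)
  then obtain M where "\<forall>x\<in>{a..b}. \<bar>f x\<bar> \<le> M"
    unfolding bounded_iff by auto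
  then show "\<exists>M. AE \<tau> in lborel. \<tau> \<in> {a..b} \<longrightarrow> \<bar>f \<tau>\<bar> \<le> M"
    by (intro exI[of _ M]) auto
  fix s t assume st: "a \<le> s" "s \<le> t" "t \<le> b"
  have "(LINT \<tau>|lborel. indicator {s..t} \<tau> *\<^sub>R f \<tau>) = F t - F s"
  proof (rule integral_FTC_Icc[OF st(2)])
    show "(F has_vector_derivative f x) (at x within {s..t})" if "s \<le> x" "x \<le> t" for x
      by (rule has_vector_derivative_within_subset[OF der]) (use that st in auto)
    show "continuous_on {s..t} f"
      by (rule continuous_on_subset[OF f]) (use st in auto)
  qed
  then show "F t - F s = (LINT \<tau>:{s..t}|lborel. f \<tau>)"
    by (simp add: set_lebesgue_integral_def)
qed

section \<open>The lemma of du Bois-Reymond\<close>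

text \<open>\<open>B\<close> is a smooth transition from 0 to 1 and \<open>\<beta>\<close> is its
  derivative. Rescaled by a large factor, \<open>B\<close> approximates the indicator of a half line
  and \<open>\<beta>\<close> becomes an approximate identity.\<close>

locale smooth_step =
  fixes \<beta> B :: "real \<Rightarrow> real"
  assumes \<beta>_smooth: "smooth_on UNIV \<beta>" and B_smooth: "smooth_on UNIV B"
    and \<beta>_nonneg: "0 \<le> \<beta> t" and B_deriv: "(B has_real_derivative \<beta> t) (at t)"
    and \<beta>_zero: "2 < \<bar>t\<bar> \<Longrightarrow> \<beta> t = 0" and B_zero: "t \<le> -2 \<Longrightarrow> B t = 0" and B_one: "2 \<le> t \<Longrightarrow> B t = 1"
begin

lemma B_bounds: "0 \<le> B t" "B t \<le> 1"
proof -
  have mono: "B x \<le> B y" if "x \<le> y" for x y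
    by (rule DERIV_nonneg_imp_nondecreasing[OF that]) (use B_deriv \<beta>_nonneg in blast)
  show "0 \<le> B t"
    using mono[of "min t (-2)" t] B_zero[of "min t (-2)"] by simp
  show "B t \<le> 1"
    using mono[of t "max t 2"] B_one[of "max t 2"] by simp
qed

lemma step_smooth: "smooth_on UNIV (\<lambda>\<tau>. B (N * (\<tau> - s)))"
  and step_deriv: "((\<lambda>\<tau>. B (N * (\<tau> - s))) has_real_derivative N * \<beta> (N * (t - s))) (at t)"
  and bump_smooth: "smooth_on UNIV (\<lambda>\<tau>. N * \<beta> (N * (\<tau> - s)))"
proof -
  have "smooth_on UNIV (\<lambda>\<tau>. B (N * \<tau> + - N * s))"
    by (intro smooth_on_affine[OF bounded_linear_mult_right B_smooth]) simp
  then show "smooth_on UNIV (\<lambda>\<tau>. B (N * (\<tau> - s)))"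
    by (simp add: right_diff_distrib)
  have "smooth_on UNIV (\<lambda>\<tau>. \<beta> (N * \<tau> + - N * s))"
    by (intro smooth_on_affine[OF bounded_linear_mult_right \<beta>_smooth]) simp
  then show "smooth_on UNIV (\<lambda>\<tau>. N * \<beta> (N * (\<tau> - s)))"
    by (intro smooth_on_cmult) (simp add: right_diff_distrib)
  have "((\<lambda>\<tau>. B (N * (\<tau> - s))) has_real_derivative \<beta> (N * (t - s)) * N) (at t)"
    by (rule DERIV_chain2[OF B_deriv]) (auto intro!: derivative_eq_intros)
  then show "((\<lambda>\<tau>. B (N * (\<tau> - s))) has_real_derivative N * \<beta> (N * (t - s))) (at t)"
    by (simp add: mult.commute)
qed

lemma bump_zero:
  assumes "0 < N" "2 / N < \<bar>\<tau> - s\<bar>"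
  shows "N * \<beta> (N * (\<tau> - s)) = 0"
proof -
  have "2 < \<bar>N * (\<tau> - s)\<bar>"
    using assms by (simp add: abs_mult pos_divide_less_eq mult.commute)
  then show ?thesis by (simp add: \<beta>_zero)
qed

lemma bump_continuous: "continuous_on S (\<lambda>\<tau>. N * \<beta> (N * (\<tau> - s)))"
  using smooth_on_imp_continuous[OF bump_smooth] continuous_on_subset by blast

lemma bump_integral:
  assumes "0 < N"
  shows "has_bochner_integral lborel (\<lambda>\<tau>. N * \<beta> (N * (\<tau> - s))) 1"
proof -
  have "has_bochner_integral lborel (\<lambda>\<tau>. N * \<beta> (N * (\<tau> - s)) * indicator {s - 2/N..s + 2/N} \<tau>)
      (B (N * (s + 2/N - s)) - B (N * (s - 2/N - s)))"
  proof (rule has_bochner_integral_FTC_Icc_real)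
    show "isCont (\<lambda>\<tau>. N * \<beta> (N * (\<tau> - s))) x" for x
      using bump_continuous[of UNIV N s] by (simp add: continuous_on_eq_continuous_at)
  qed (use assms step_deriv in auto)
  moreover have "N * \<beta> (N * (\<tau> - s)) * indicator {s - 2/N..s + 2/N} \<tau> = N * \<beta> (N * (\<tau> - s))" for \<tau>
  proof (cases "2 / N < \<bar>\<tau> - s\<bar>")
    case True
    then show ?thesis
      by (simp only: bump_zero[OF assms] mult_zero_left)
  next
    case False
    then have "\<tau> \<in> {s - 2/N..s + 2/N}"
      unfolding not_less abs_le_iff atLeastAtMost_iff by linarith
    then show ?thesis by simp
  qed
  ultimately show ?thesis
    using assms B_zero[of "-2"] B_one[of 2] by simp
qed

lemma compact_support_continuous_integrable:
  fixes k f :: "real \<Rightarrow> real"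
  assumes "continuous_on UNIV k" "\<And>t. t \<notin> {a..b} \<Longrightarrow> k t = 0" "continuous_on {a..b} f"
  shows "integrable lborel (\<lambda>t. k t * f t)"
proof -
  have "continuous_on {a..b} (\<lambda>t. k t * f t)"
    by (intro continuous_intros assms(3) continuous_on_subset[OF assms(1)]) auto
  then have "set_integrable lborel {a..b} (\<lambda>t. k t * f t)"
    by (rule borel_integrable_atLeastAtMost')
  moreover have "indicator {a..b} t *\<^sub>R (k t * f t) = k t * f t" for t
    using assms(2)[of t] by (auto simp: indicator_def)
  ultimately show ?thesis
    unfolding set_integrable_def by (simp only:)
qed

lemma bump_tendsto:
  assumes w: "continuous_on {a..b} w" and s: "a < s" "s < b"
  shows "(\<lambda>n. LINT \<tau>|lborel. real (Suc n) * \<beta> (real (Suc n) * (\<tau> - s)) * w \<tau>) \<longlonglongrightarrow> w s"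
proof (rule LIMSEQ_I)
  fix e :: real assume "0 < e"
  then have e: "0 < e / 2" by simp
  from w s e obtain d where d: "d > 0" "\<And>\<tau>. \<tau> \<in> {a..b} \<Longrightarrow> \<bar>\<tau> - s\<bar> < d \<Longrightarrow> \<bar>w \<tau> - w s\<bar> < e / 2"
    unfolding continuous_on_iff dist_real_def by (metis atLeastAtMost_iff less_imp_le)
  \<comment> \<open>A bump narrower than \<open>d'\<close> sits inside \<open>{a..b}\<close>, where
    \<open>w\<close> is continuous, and sees only values of \<open>w\<close> within
    \<open>e / 2\<close> of \<open>w s\<close>.\<close>
  define d' where "d' = min d (min (s - a) (b - s))"
  have d': "d' > 0" using d s by (simp add: d'_def)
  obtain n0 :: nat where n0: "2 / d' < real n0"
    using reals_Archimedean2 by blast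
  have "norm ((LINT \<tau>|lborel. real (Suc n) * \<beta> (real (Suc n) * (\<tau> - s)) * w \<tau>) - w s) < e" if "n \<ge> n0" for n
  proof -
    let ?N = "real (Suc n)" let ?k = "\<lambda>\<tau>. ?N * \<beta> (?N * (\<tau> - s))"
    have "2 / d' < ?N" using n0 that by simp
    then have N: "?N > 0" "2 / ?N < d'"
      using d' by (simp_all add: field_simps)
    have k0: "?k \<tau> = 0" if "\<tau> \<notin> {a..b} \<or> d \<le> \<bar>\<tau> - s\<bar>" for \<tau>
    proof -
      have "d' \<le> \<bar>\<tau> - s\<bar>"
        using that by (auto simp: d'_def)
      then show ?thesis
        using bump_zero[OF N(1)] N(2) by simp
    qed
    have kint: "integrable lborel ?k" "(LINT \<tau>|lborel. ?k \<tau>) = 1"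
      using bump_integral[OF N(1), of s] by (auto simp: has_bochner_integral_iff)
    have kw: "integrable lborel (\<lambda>\<tau>. ?k \<tau> * w \<tau>)"
      by (rule compact_support_continuous_integrable[OF bump_continuous _ w]) (use k0 in auto)
    have "(LINT \<tau>|lborel. ?k \<tau> * w \<tau>) - w s = (LINT \<tau>|lborel. ?k \<tau> * w \<tau> - ?k \<tau> * w s)"
      using kw kint by simp
    also have "norm \<dots> \<le> (LINT \<tau>|lborel. ?k \<tau> * (e / 2))"
    proof (rule Bochner_Integration.integral_norm_bound_integral)
      fix \<tau>
      show "norm (?k \<tau> * w \<tau> - ?k \<tau> * w s) \<le> ?k \<tau> * (e / 2)"
      proof (cases "\<tau> \<notin> {a..b} \<or> d \<le> \<bar>\<tau> - s\<bar>")
        case True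
        show ?thesis unfolding k0[OF True] by simp
      next
        case False
        then have "\<bar>w \<tau> - w s\<bar> \<le> e / 2"
          using d(2)[of \<tau>] by auto
        moreover have "0 \<le> ?k \<tau>"
          using \<beta>_nonneg N(1) by (intro mult_nonneg_nonneg) auto
        ultimately have "?k \<tau> * \<bar>w \<tau> - w s\<bar> \<le> ?k \<tau> * (e / 2)"
          by (rule mult_left_mono)
        then show ?thesis
          unfolding right_diff_distrib[symmetric] real_norm_def abs_mult[of "?k \<tau>"]
            abs_of_nonneg[OF \<open>0 \<le> ?k \<tau>\<close>] .
      qed
    qed (use kw kint in auto)
    also have "\<dots> = e / 2" using kint by simp
    finally show ?thesis using \<open>0 < e\<close> by simp
  qed
  then show "\<exists>n0. \<forall>n\<ge>n0. norm ((LINT \<tau>|lborel. real (Suc n) * \<beta> (real (Suc n) * (\<tau> - s)) * w \<tau>) - w s) < e"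
    by blast
qed

lemma scaled_step_tendsto:
  assumes "\<tau> \<noteq> s"
  shows "(\<lambda>n. B (real (Suc n) * (\<tau> - s))) \<longlonglongrightarrow> (if s < \<tau> then 1 else 0)"
proof -
  obtain n0 :: nat where n0: "2 / \<bar>\<tau> - s\<bar> < real n0"
    using reals_Archimedean2 by blast
  have "B (real (Suc n) * (\<tau> - s)) = (if s < \<tau> then 1 else 0)" if "n \<ge> n0" for n
  proof -
    have "2 / \<bar>\<tau> - s\<bar> < real (Suc n)" using n0 that by simp
    then have "2 < real (Suc n) * \<bar>\<tau> - s\<bar>"
      using assms by (simp add: pos_divide_less_eq)
    then show ?thesis
      using assms B_one[of "real (Suc n) * (\<tau> - s)"] B_zero[of "real (Suc n) * (\<tau> - s)"]
      by (cases "s < \<tau>") (auto simp: abs_if algebra_simps split: if_splits)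
  qed
  then have "eventually (\<lambda>n. B (real (Suc n) * (\<tau> - s)) = (if s < \<tau> then 1 else 0)) sequentially"
    unfolding eventually_sequentially by blast
  then show ?thesis
    by (rule tendsto_eventually)
qed

text \<open>Tested with the difference of two steepening steps placed at \<open>s\<close> and
  \<open>t\<close>, the weak equation contains two approximate identities acting on
  \<open>w\<close>, which converge to its values, and a smoothed indicator of \<open>{s..t}\<close>
  acting on \<open>f\<close>, which converges by domination.\<close>

lemma du_bois_reymond:
  assumes w: "continuous_on {a..b} w"
    and f: "f \<in> borel_measurable borel" and M: "AE \<tau> in lborel. \<tau> \<in> {a..b} \<longrightarrow> \<bar>f \<tau>\<bar> \<le> M"
    and weak: "\<And>g g' c d. smooth_on UNIV g \<Longrightarrow> (\<And>t. (g has_real_derivative g' t) (at t)) \<Longrightarrow>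
      continuous_on UNIV g' \<Longrightarrow> a < c \<Longrightarrow> d < b \<Longrightarrow> (\<And>t. t \<notin> {c..d} \<Longrightarrow> g t = 0 \<and> g' t = 0) \<Longrightarrow>
      (LINT t|lborel. g' t * w t) + (LINT t|lborel. g t * f t) = 0"
    and st: "a < s" "s \<le> t" "t < b"
  shows "w t - w s = (LINT \<tau>:{s..t}|lborel. f \<tau>)"
proof -
  define d' where "d' = min (s - a) (b - t)"
  have d': "d' > 0" using st by (simp add: d'_def)
  obtain n0 :: nat where n0: "2 / d' < real n0"
    using reals_Archimedean2 by blast
  \<comment> \<open>The shift by \<open>n0\<close> makes every member of the sequence, not just late
    ones, supported inside the open interval from \<open>a\<close> to \<open>b\<close>.\<close>
  define N where "N n = real (Suc (n + n0))" for n
  have N: "N n > 0" "2 / N n < d'" for n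
  proof -
    show "N n > 0" by (simp add: N_def)
    have "2 / d' < N n" using n0 by (simp add: N_def)
    then show "2 / N n < d'"
      using d' \<open>N n > 0\<close> by (simp add: field_simps)
  qed
  define g where "g n \<tau> = B (N n * (\<tau> - s)) - B (N n * (\<tau> - t))" for n \<tau>
  define k where "k n r \<tau> = N n * \<beta> (N n * (\<tau> - r))" for n r \<tau>
  have gsm: "smooth_on UNIV (g n)" for n
  proof -
    have "smooth_on UNIV (\<lambda>\<tau>. B (N n * (\<tau> - s)) + (-1) * B (N n * (\<tau> - t)))"
      by (intro smooth_on_add smooth_on_cmult step_smooth)
    then show ?thesis by (simp add: g_def[abs_def])
  qed
  have gder: "(g n has_real_derivative (k n s \<tau> - k n t \<tau>)) (at \<tau>)" for n \<tau>
    unfolding g_def[abs_def] k_def by (intro derivative_intros step_deriv)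
  have kc: "continuous_on UNIV (k n r)" for n r
    unfolding k_def[abs_def] by (rule bump_continuous)
  have zero: "g n \<tau> = 0 \<and> k n s \<tau> = 0 \<and> k n t \<tau> = 0" if "\<tau> \<notin> {s - 2 / N n..t + 2 / N n}" for n \<tau>
  proof -
    have "2 / N n < \<bar>\<tau> - s\<bar>" "2 / N n < \<bar>\<tau> - t\<bar>"
      using that st by (auto simp: abs_if not_le)
    then have "k n s \<tau> = 0" "k n t \<tau> = 0"
      unfolding k_def using bump_zero[OF N(1)] by blast+
    moreover have "g n \<tau> = 0"
    proof (cases "\<tau> < s - 2 / N n")
      case True
      then have "\<tau> - s \<le> - 2 / N n" "\<tau> - t \<le> - 2 / N n" using st by auto
      then have "N n * (\<tau> - s) \<le> N n * (- 2 / N n)" "N n * (\<tau> - t) \<le> N n * (- 2 / N n)"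
        using N(1)[of n] by (intro mult_left_mono; simp)+
      then have "N n * (\<tau> - s) \<le> -2" "N n * (\<tau> - t) \<le> -2"
        using N(1)[of n] by simp_all
      then show ?thesis by (simp add: g_def B_zero)
    next
      case False
      then have "2 / N n \<le> \<tau> - s" "2 / N n \<le> \<tau> - t" using st that by auto
      then have "2 \<le> N n * (\<tau> - s)" "2 \<le> N n * (\<tau> - t)"
        using N(1)[of n] by (simp_all add: pos_divide_le_eq mult.commute)
      then show ?thesis by (simp add: g_def B_one)
    qed
    ultimately show ?thesis by simp
  qed
  have in_ab: "a < s - 2 / N n" "t + 2 / N n < b" for n
    using N(2)[of n] by (auto simp: d'_def)
  have kw: "integrable lborel (\<lambda>\<tau>. k n r \<tau> * w \<tau>)" if "r = s \<or> r = t" for n r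
    by (rule compact_support_continuous_integrable[OF kc _ w]) (use zero[of _ n] in_ab[of n] that in force)
  have eq: "(LINT \<tau>|lborel. g n \<tau> * f \<tau>) = (LINT \<tau>|lborel. k n t \<tau> * w \<tau>) - (LINT \<tau>|lborel. k n s \<tau> * w \<tau>)" for n
  proof -
    have "(LINT \<tau>|lborel. (k n s \<tau> - k n t \<tau>) * w \<tau>) + (LINT \<tau>|lborel. g n \<tau> * f \<tau>) = 0"
      by (rule weak[OF gsm gder _ in_ab]) (use zero in \<open>auto intro!: continuous_intros kc\<close>)
    then show ?thesis
      using kw[of s n] kw[of t n] by (simp add: left_diff_distrib)
  qed
  have "(\<lambda>n. LINT \<tau>|lborel. k n r \<tau> * w \<tau>) \<longlonglongrightarrow> w r" if "r = s \<or> r = t" for r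
    using LIMSEQ_ignore_initial_segment[OF bump_tendsto[OF w, of r], of n0] that st
    unfolding k_def N_def by auto
  then have lim1: "(\<lambda>n. LINT \<tau>|lborel. g n \<tau> * f \<tau>) \<longlonglongrightarrow> w t - w s"
    unfolding eq by (intro tendsto_diff) auto
  have "(\<lambda>n. LINT \<tau>|lborel. g n \<tau> * f \<tau>) \<longlonglongrightarrow> (LINT \<tau>|lborel. indicator {s..t} \<tau> * f \<tau>)"
  proof (rule integral_dominated_convergence)
    show "(\<lambda>\<tau>. indicator {s..t} \<tau> * f \<tau>) \<in> borel_measurable lborel"
      using f by simp
    show "(\<lambda>\<tau>. g n \<tau> * f \<tau>) \<in> borel_measurable lborel" for n
      using f borel_measurable_continuous_onI[OF smooth_on_imp_continuous[OF gsm]] by simp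
    show "integrable lborel (\<lambda>\<tau>. indicator {a..b} \<tau> * M)"
      by (intro integrable_mult_left) (simp add: integrable_indicator_iff emeasure_lborel_Icc_eq)
    show "AE \<tau> in lborel. norm (g n \<tau> * f \<tau>) \<le> indicator {a..b} \<tau> * M" for n
      using M
    proof eventually_elim
      case (elim \<tau>)
      show ?case
      proof (cases "\<tau> \<in> {a..b}")
        case True
        have "\<bar>g n \<tau>\<bar> \<le> 1"
          unfolding g_def using B_bounds[of "N n * (\<tau> - s)"] B_bounds[of "N n * (\<tau> - t)"] by (simp add: abs_le_iff)
        then have "\<bar>g n \<tau>\<bar> * \<bar>f \<tau>\<bar> \<le> 1 * M"
          using elim True by (intro mult_mono) auto
        then show ?thesis using True by (simp add: abs_mult)
      next
        case False
        then have "\<tau> \<notin> {s - 2 / N n..t + 2 / N n}"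
          using in_ab[of n] by auto
        from zero[OF this] False show ?thesis by simp
      qed
    qed
    \<comment> \<open>At \<open>s\<close> and at \<open>t\<close> one of the steps is evaluated at 0
      for every \<open>n\<close>, so the limit there need not be the value of the indicator; the two
      points are negligible.\<close>
    have "AE \<tau> in lborel. \<tau> \<noteq> s \<and> \<tau> \<noteq> t"
      using AE_lborel_singleton[of s] AE_lborel_singleton[of t] by eventually_elim simp
    then show "AE \<tau> in lborel. (\<lambda>n. g n \<tau> * f \<tau>) \<longlonglongrightarrow> indicator {s..t} \<tau> * f \<tau>"
    proof eventually_elim
      case (elim \<tau>)
      have "(\<lambda>n. g n \<tau>) \<longlonglongrightarrow> (if s < \<tau> then 1 else 0) - (if t < \<tau> then 1 else 0)"
        unfolding g_def N_def using elim
        by (intro tendsto_diff LIMSEQ_ignore_initial_segment[OF scaled_step_tendsto]) auto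
      moreover have "(if s < \<tau> then 1 else 0) - (if t < \<tau> then 1 else 0) = (indicator {s..t} \<tau> :: real)"
        using elim st by (auto simp: indicator_def)
      ultimately show ?case
        by (intro tendsto_mult tendsto_const) simp
    qed
  qed
  from LIMSEQ_unique[OF lim1 this] show ?thesis
    by (simp add: set_lebesgue_integral_def)
qed

end

section \<open>The vorticity equation of the filtered field\<close>

text \<open>Differentiating in the reflected variable changes the sign. The sign is put on the
  scalar \<open>g\<close>, so that the result has the form of the hypothesis again and a second
  application restores the sign.\<close>

lemma pd_reflected_kernels:
  fixes k1 k2 :: "real^3 \<Rightarrow> real" and c1 c2 :: "'b::real_normed_vector"
  assumes "smooth_on UNIV k1" "smooth_on UNIV k2"
  shows "pd j (\<lambda>y. g *\<^sub>R (k1 (x - y) *\<^sub>R c1 - k2 (x - y) *\<^sub>R c2))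
    = (\<lambda>y. (- g) *\<^sub>R (pd j k1 (x - y) *\<^sub>R c1 - pd j k2 (x - y) *\<^sub>R c2))"
proof
  fix y
  have d: "((\<lambda>y. k (x - y)) has_derivative (\<lambda>h. \<Sum>i\<in>UNIV. (- h) $ i *\<^sub>R pd i k (x - y))) (at y)"
    if "smooth_on UNIV k" for k :: "real^3 \<Rightarrow> real"
    by (rule has_derivative_compose[OF _ smooth_has_derivative_pd[OF that]])
       (auto intro!: derivative_eq_intros)
  have s: "(\<Sum>i\<in>UNIV. (- axis j (1::real)) $ i *\<^sub>R pd i k z) = - pd j k z" for k :: "real^3 \<Rightarrow> real" and z
    using sum_axis_scaleR[of j "\<lambda>i. pd i k z"] by (simp add: sum_negf)
  have "((\<lambda>y. g *\<^sub>R (k1 (x - y) *\<^sub>R c1 - k2 (x - y) *\<^sub>R c2)) has_derivative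
      (\<lambda>h. g *\<^sub>R ((\<Sum>i\<in>UNIV. (- h) $ i *\<^sub>R pd i k1 (x - y)) *\<^sub>R c1
         - (\<Sum>i\<in>UNIV. (- h) $ i *\<^sub>R pd i k2 (x - y)) *\<^sub>R c2))) (at y)"
    by (intro has_derivative_scaleR_right has_derivative_diff has_derivative_scaleR_left d assms)
  from pd_eqI[OF this, of j]
  show "pd j (\<lambda>y. g *\<^sub>R (k1 (x - y) *\<^sub>R c1 - k2 (x - y) *\<^sub>R c2)) y
    = (- g) *\<^sub>R (pd j k1 (x - y) *\<^sub>R c1 - pd j k2 (x - y) *\<^sub>R c2)"
    unfolding s by (simp add: algebra_simps)
qed

lemma test_function_space_time:
  fixes W :: "real^3 \<Rightarrow> 'b::real_normed_vector" and g :: "real \<Rightarrow> real"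
  assumes W: "smooth_on UNIV W" "\<And>y. R < norm y \<Longrightarrow> W y = 0"
    and g: "smooth_on UNIV g" "\<And>t. t \<notin> {a..b} \<Longrightarrow> g t = 0" and ab: "{a..b} \<subseteq> T"
  shows "test_function (UNIV \<times> T) (\<lambda>(y, s). g s *\<^sub>R W y)"
proof -
  have "smooth_on UNIV (\<lambda>z::(real^3) \<times> real. g (snd z + 0))" "smooth_on UNIV (\<lambda>z::(real^3) \<times> real. W (fst z + 0))"
    by (intro smooth_on_affine[OF _ g(1)] bounded_linear_snd smooth_on_affine[OF _ W(1)] bounded_linear_fst; simp)+
  then have "smooth_on UNIV (\<lambda>(y, s). g s *\<^sub>R W y)"
    using smooth_on_scaleR by (simp add: case_prod_unfold)
  moreover have sub: "{z. (case z of (y, s) \<Rightarrow> g s *\<^sub>R W y) \<noteq> 0} \<subseteq> cball 0 R \<times> {a..b}"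
  proof clarify
    fix y s assume "g s *\<^sub>R W y \<noteq> 0"
    then show "y \<in> cball 0 R \<and> s \<in> {a..b}"
      using W(2)[of y] g(2)[of s] by (auto simp: not_less[symmetric])
  qed
  have K: "compact (cball (0::real^3) R \<times> {a..b})"
    by (intro compact_Times) auto
  have cl: "closure {z. (case z of (y, s) \<Rightarrow> g s *\<^sub>R W y) \<noteq> 0} \<subseteq> cball 0 R \<times> {a..b}"
    by (rule closure_minimal[OF sub compact_imp_closed[OF K]])
  have "compact (closure {z. (case z of (y, s) \<Rightarrow> g s *\<^sub>R W y) \<noteq> 0})"
    using compact_Int_closed[OF K, of "closure {z. (case z of (y, s) \<Rightarrow> g s *\<^sub>R W y) \<noteq> 0}"] cl
    by (simp add: inf.absorb2)
  moreover have "closure {z. (case z of (y, s) \<Rightarrow> g s *\<^sub>R W y) \<noteq> 0} \<subseteq> UNIV \<times> T"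
    using cl ab by auto
  ultimately show ?thesis
    by (simp add: test_function_def)
qed

context filtered_field
begin

text \<open>Evaluates the weak formulation on a product of a time profile and a reflected kernel.
  \<open>q\<close> stands for one component of \<open>u\<close> or a product of two, and
  \<open>q'\<close> is its Borel version; a bound on local L1 norms for almost every time suffices
  for the space-time integral and the iterated one to agree.\<close>

lemma separated_integral:
  fixes q q' :: "(real^3) \<times> real \<Rightarrow> real"
  assumes q': "q' \<in> borel_measurable borel" "AE z in lborel. snd z \<in> T \<longrightarrow> q z = q' z"
    and bound: "\<And>R. \<exists>C. AE t in lborel. t \<in> {a..b} \<longrightarrow> (LINT y:cball 0 R|lebesgue. \<bar>q (y, t)\<bar>) \<le> C"
    and q: "\<And>t R. t \<in> T \<Longrightarrow> set_integrable lebesgue (cball 0 R) (\<lambda>y. q (y, t))"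
    and g: "continuous_on UNIV g" "\<And>t. t \<notin> {a..b} \<Longrightarrow> g t = 0" and ab: "{a..b} \<subseteq> T"
    and k: "continuous_on UNIV k" "\<And>y. R < norm y \<Longrightarrow> k y = 0"
  shows "integrable lebesgue (\<lambda>(y, s). g s * (k (x - y) * q (y, s)))"
    and "(LINT (y, s)|lebesgue. g s * (k (x - y) * q (y, s)))
      = (LINT s|lborel. g s * (LINT y|lborel. k (x - y) * q' (y, s)))"
    and "integrable lborel (\<lambda>s. g s * (LINT y|lborel. k (x - y) * q' (y, s)))"
proof -
  define H where "H z = g (snd z) * (k (x - fst z) * q' z)" for z
  have m1: "(\<lambda>z::(real^3) \<times> real. g (snd z)) \<in> borel_measurable borel"
    by (intro borel_measurable_continuous_onI continuous_on_compose2[OF g(1)] continuous_intros) auto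
  have m2: "(\<lambda>z::(real^3) \<times> real. k (x - fst z)) \<in> borel_measurable borel"
    by (intro borel_measurable_continuous_onI continuous_on_compose2[OF k(1)] continuous_intros) auto
  have Hm: "H \<in> borel_measurable borel"
    unfolding H_def[abs_def] by (intro borel_measurable_times m1 m2 q')
  obtain M where M: "M \<ge> 0" "\<And>y. \<bar>k y\<bar> \<le> M"
    using compact_support_bounded[OF k] by auto
  obtain G where G: "G \<ge> 0" "\<And>t. \<bar>g t\<bar> \<le> G"
  proof -
    have "bounded (g ` {a..b})"
      by (intro compact_imp_bounded compact_continuous_image continuous_on_subset[OF g(1)]) auto
    then obtain G where G: "\<forall>t\<in>{a..b}. \<bar>g t\<bar> \<le> G"
      unfolding bounded_iff by auto
    have "\<bar>g t\<bar> \<le> max G 0" for t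
      using bspec[OF G, of t] g(2)[of t] by (cases "t \<in> {a..b}") (auto simp: le_max_iff_disj)
    then show thesis by (intro that[of "max G 0"]) auto
  qed
  \<comment> \<open>The radius \<open>R + norm x\<close> covers the support of the kernel recentred
    at \<open>x\<close>.\<close>
  obtain C where C: "AE t in lborel. t \<in> {a..b} \<longrightarrow> (LINT y:cball 0 (R + norm x)|lebesgue. \<bar>q (y, t)\<bar>) \<le> C"
    using bound by blast
  have sm: "(\<lambda>y. H (y, t)) \<in> borel_measurable borel" for t
  proof -
    have "(\<lambda>y::real^3. (y, t)) \<in> borel_measurable borel"
      by (intro borel_measurable_continuous_onI continuous_intros)
    from measurable_compose[OF this Hm] show ?thesis .
  qed
  have slices: "AE t in lborel. integrable lborel (\<lambda>y. H (y, t)) \<and> (LINT y|lborel. \<bar>H (y, t)\<bar>) \<le> G * (M * max C 0)"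
    using AE_lborel_prod_swap[OF q'(2)] C
  proof eventually_elim
    case (elim t)
    show ?case
    proof (cases "t \<in> {a..b}")
      case False
      then have "H (y, t) = 0" for y by (simp add: H_def g(2))
      then show ?thesis using G(1) M(1) by simp
    next
      case True
      then have t: "t \<in> T" using ab by auto
      let ?kq = "\<lambda>y. k (x - y) * q (y, t)"
      have ae: "AE y in lebesgue. g t * ?kq y = H (y, t)"
        unfolding AE_completion_iff using elim(1) by eventually_elim (simp add: H_def t)
      have Hl: "(\<lambda>y. H (y, t)) \<in> borel_measurable lebesgue"
        by (rule measurable_completion) (simp add: sm)
      have i1: "integrable lebesgue ?kq"
        by (rule convolution_integrable[OF k q[OF t]])
      have i2: "integrable lebesgue (\<lambda>y. g t * ?kq y)"
        using i1 by simp
      have Hi: "integrable lebesgue (\<lambda>y. H (y, t))"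
        using integrable_cong_AE_imp[OF i2 Hl] ae by (simp add: eq_commute)
      have kabs: "continuous_on UNIV (\<lambda>z. \<bar>k z\<bar>)" by (intro continuous_intros k)
      have "(LINT y|lebesgue. \<bar>H (y, t)\<bar>) = (LINT y|lebesgue. \<bar>g t * ?kq y\<bar>)"
      proof (rule integral_cong_AE)
        show "AE y in lebesgue. \<bar>H (y, t)\<bar> = \<bar>g t * ?kq y\<bar>"
          using ae by eventually_elim simp
      qed (use Hi i2 in auto)
      also have "\<dots> = \<bar>g t\<bar> * (LINT y|lebesgue. \<bar>k (x - y)\<bar> * \<bar>q (y, t)\<bar>)"
        by (simp add: abs_mult)
      also have "\<dots> \<le> G * (M * max C 0)"
      proof (intro mult_mono G)
        have "\<bar>LINT y|lebesgue. \<bar>k (x - y)\<bar> * \<bar>q (y, t)\<bar>\<bar> \<le> M * (LINT y:cball 0 (R + norm x)|lebesgue. \<bar>\<bar>q (y, t)\<bar>\<bar>)"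
        proof (rule integrable_compact_support_mult(2))
          show "continuous_on UNIV (\<lambda>y. \<bar>k (x - y)\<bar>)"
            using translated_kernel(1)[OF k order_refl[of "norm x"]] by (intro continuous_intros)
          show "\<bar>k (x - y)\<bar> = 0" if "R + norm x < norm y" for y
            using translated_kernel(2)[OF k order_refl that] by simp
          show "\<bar>\<bar>k (x - y)\<bar>\<bar> \<le> M" for y using M by simp
          show "set_integrable lebesgue (cball 0 (R + norm x)) (\<lambda>y. \<bar>q (y, t)\<bar>)"
            by (rule set_integrable_abs[OF q[OF t]])
        qed
        also have "\<dots> \<le> M * max C 0"
          using elim(2) True M(1) by (intro mult_left_mono) (auto simp: le_max_iff_disj)
        finally show "(LINT y|lebesgue. \<bar>k (x - y)\<bar> * \<bar>q (y, t)\<bar>) \<le> M * max C 0" by simp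
        show "0 \<le> (LINT y|lebesgue. \<bar>k (x - y)\<bar> * \<bar>q (y, t)\<bar>)"
          by (intro Bochner_Integration.integral_nonneg) simp
      qed
      finally have "(LINT y|lebesgue. \<bar>H (y, t)\<bar>) \<le> G * (M * max C 0)" .
      then show ?thesis
        using Hi sm by (simp add: integrable_completion integral_completion)
    qed
  qed
  have z: "H (y, t) = 0" if "t \<notin> {a..b}" for y t
    using that by (simp add: H_def g(2))
  note I = iterated_integral_time_outer[OF Hm z slices]
  have orig: "AE z in lborel. H z = (case z of (y, s) \<Rightarrow> g s * (k (x - y) * q (y, s)))"
    using q'(2)
  proof eventually_elim
    case (elim z)
    then show ?case
      using g(2)[of "snd z"] ab by (cases "snd z \<in> {a..b}") (auto simp: H_def split: prod.split)
  qed
  have origm: "(\<lambda>(y, s). g s * (k (x - y) * q (y, s))) \<in> borel_measurable lebesgue"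
  proof (rule borel_measurable_AE)
    show "H \<in> borel_measurable lebesgue"
      using Hm by (simp add: measurable_completion)
  qed (use orig in \<open>simp add: AE_completion_iff\<close>)
  have Hl: "integrable lebesgue H" "(LINT z|lebesgue. H z) = (LINT z|lborel. H z)"
    using I(1) Hm by (simp_all add: integrable_completion integral_completion)
  have orig': "AE z in lebesgue. H z = (case z of (y, s) \<Rightarrow> g s * (k (x - y) * q (y, s)))"
    unfolding AE_completion_iff by (rule orig)
  show "integrable lebesgue (\<lambda>(y, s). g s * (k (x - y) * q (y, s)))"
    by (rule integrable_cong_AE_imp[OF Hl(1) origm orig'])
  have "(LINT (y, s)|lebesgue. g s * (k (x - y) * q (y, s))) = (LINT z|lebesgue. H z)"
    by (rule integral_cong_AE[OF origm]) (use Hl orig' in \<open>auto elim: eventually_mono\<close>)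
  also have "\<dots> = (LINT s|lborel. LINT y|lborel. H (y, s))"
    using Hl(2) I(2) by (rule trans)
  also have "\<dots> = (LINT s|lborel. g s * (LINT y|lborel. k (x - y) * q' (y, s)))"
    by (simp add: H_def)
  finally show "(LINT (y, s)|lebesgue. g s * (k (x - y) * q (y, s)))
      = (LINT s|lborel. g s * (LINT y|lborel. k (x - y) * q' (y, s)))" .
  show "integrable lborel (\<lambda>s. g s * (LINT y|lborel. k (x - y) * q' (y, s)))"
    using I(3) by (simp add: H_def)
qed

lemma test_function_kernel:
  fixes k :: "real^3 \<Rightarrow> real"
  assumes "test_function UNIV k"
  shows "continuous_on UNIV k" "\<exists>R. \<forall>x. R < norm x \<longrightarrow> k x = 0"
  using assms unfolding test_function_UNIV_iff by (auto intro: smooth_on_imp_continuous)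

lemma V_borel_version:
  assumes "continuous_on UNIV k"
  shows "AE t in lborel. t \<in> T \<longrightarrow> (LINT y|lborel. k (x - y) * v (y, t) $ i) = V k i x t"
  using v_AE_slices
proof eventually_elim
  case (elim t)
  show ?case
  proof
    assume t: "t \<in> T"
    have "AE y in lebesgue. u y t $ i = v (y, t) $ i"
      using elim[rule_format, OF t] by eventually_elim simp
    from convolution_borel_version[OF assms u_component_measurable[OF t] v_slice_borel this]
    show "(LINT y|lborel. k (x - y) * v (y, t) $ i) = V k i x t"
      by (simp add: V_def)
  qed
qed

context
  fixes g :: "real \<Rightarrow> real" and a b :: real
  assumes g: "continuous_on UNIV g" "\<And>t. t \<notin> {a..b} \<Longrightarrow> g t = 0" and ab: "a < b" "{a..b} \<subseteq> T"
begin

text \<open>As \<open>V\<close> is continuous in time, its product with \<open>g\<close> is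
  integrable, and the Borel version coming out of Fubini may be exchanged for \<open>V\<close>
  itself.\<close>

lemma separated_V:
  assumes k: "test_function UNIV k"
  shows "integrable lebesgue (\<lambda>(y, s). g s * (k (x - y) * u y s $ i))"
    and "(LINT (y, s)|lebesgue. g s * (k (x - y) * u y s $ i)) = (LINT s|lborel. g s * V k i x s)"
    and "integrable lborel (\<lambda>s. g s * V k i x s)"
proof -
  obtain R where R: "\<And>y. R < norm y \<Longrightarrow> k y = 0"
    using test_function_kernel[OF k] by blast
  note kc = test_function_kernel(1)[OF k]
  have bound: "\<exists>C. AE t in lborel. t \<in> {a..b} \<longrightarrow>
      (LINT y:cball 0 R|lebesgue. \<bar>case (y, t) of (y, t) \<Rightarrow> u y t $ i\<bar>) \<le> C" for R
  proof -
    obtain C where "AE t in lborel. t \<in> {a..b} \<longrightarrow> (LINT x:cball 0 R|lebesgue. (norm (u x t))\<^sup>2) \<le> C"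
      using energy_bound[OF ab(2)] by blast
    then have "AE t in lborel. t \<in> {a..b} \<longrightarrow>
      (LINT y:cball 0 R|lebesgue. \<bar>case (y, t) of (y, t) \<Rightarrow> u y t $ i\<bar>) \<le> measure lebesgue (cball (0::real^3) R) + C"
    proof eventually_elim
      case (elim t)
      then show ?case
        using u_component_L1[of t R i] ab(2) by auto
    qed
    then show ?thesis by blast
  qed
  have vae: "AE z in lborel. snd z \<in> T \<longrightarrow> (case z of (y, t) \<Rightarrow> u y t $ i) = v z $ i"
    using v_AE by eventually_elim (simp add: case_prod_unfold)
  have qi: "set_integrable lebesgue (cball 0 R) (\<lambda>y. case (y, t) of (y, t) \<Rightarrow> u y t $ i)" if "t \<in> T" for t R
    using u_component_integrable[OF that] by simp
  note S = separated_integral[OF v_component_borel vae bound qi g ab(2) kc R, where x=x]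
  have s: "(LINT s|lborel. g s * (LINT y|lborel. k (x - y) * v (y, s) $ i)) = (LINT s|lborel. g s * V k i x s)
    \<and> integrable lborel (\<lambda>s. g s * V k i x s)"
  proof -
    have "continuous_on {a..b} (V k i x)"
      by (rule continuous_on_subset[OF V_time_continuous[OF k] ab(2)])
    then have "set_integrable lborel {a..b} (\<lambda>s. g s * V k i x s)"
      by (intro borel_integrable_atLeastAtMost' continuous_intros continuous_on_subset[OF g(1)]) auto
    moreover have "indicator {a..b} s *\<^sub>R (g s * V k i x s) = g s * V k i x s" for s
      using g(2)[of s] by (cases "s \<in> {a..b}") simp_all
    ultimately have int: "integrable lborel (\<lambda>s. g s * V k i x s)"
      unfolding set_integrable_def by (simp only:)
    have ae: "AE s in lborel. g s * (LINT y|lborel. k (x - y) * v (y, s) $ i) = g s * V k i x s"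
      using V_borel_version[OF kc, of x i]
    proof eventually_elim
      case (elim s)
      then show ?case
        using g(2)[of s] ab(2) by (cases "s \<in> {a..b}") auto
    qed
    have "(LINT s|lborel. g s * (LINT y|lborel. k (x - y) * v (y, s) $ i)) = (LINT s|lborel. g s * V k i x s)"
      by (rule integral_cong_AE[OF _ _ ae])
         (use S(3) int in auto)
    with int show ?thesis by blast
  qed
  show "integrable lebesgue (\<lambda>(y, s). g s * (k (x - y) * u y s $ i))"
    using S(1) by simp
  show "(LINT (y, s)|lebesgue. g s * (k (x - y) * u y s $ i)) = (LINT s|lborel. g s * V k i x s)"
    using S(2) s by simp
  show "integrable lborel (\<lambda>s. g s * V k i x s)"
    using s by blast
qed

text \<open>The time integral is kept in terms of \<open>Qv\<close>, which is Borel in time;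
  \<open>Q\<close> is only known to agree with it for almost every time.\<close>

lemma separated_Q:
  assumes k: "test_function UNIV k"
  shows "integrable lebesgue (\<lambda>(y, s). g s * (k (x - y) * (u y s $ i * u y s $ j)))"
    and "(LINT (y, s)|lebesgue. g s * (k (x - y) * (u y s $ i * u y s $ j))) = (LINT s|lborel. g s * Qv k i j (x, s))"
    and "integrable lborel (\<lambda>s. g s * Qv k i j (x, s))"
proof -
  obtain R where R: "\<And>y. R < norm y \<Longrightarrow> k y = 0"
    using test_function_kernel[OF k] by blast
  note kc = test_function_kernel(1)[OF k]
  have bound: "\<exists>C. AE t in lborel. t \<in> {a..b} \<longrightarrow>
      (LINT y:cball 0 R|lebesgue. \<bar>case (y, t) of (y, t) \<Rightarrow> u y t $ i * u y t $ j\<bar>) \<le> C" for R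
  proof -
    obtain C where "AE t in lborel. t \<in> {a..b} \<longrightarrow> (LINT x:cball 0 R|lebesgue. (norm (u x t))\<^sup>2) \<le> C"
      using energy_bound[OF ab(2)] by blast
    then have "AE t in lborel. t \<in> {a..b} \<longrightarrow>
      (LINT y:cball 0 R|lebesgue. \<bar>case (y, t) of (y, t) \<Rightarrow> u y t $ i * u y t $ j\<bar>) \<le> C"
    proof eventually_elim
      case (elim t)
      then show ?case
        using u_product_L1[of t R i j] ab(2) by auto
    qed
    then show ?thesis by blast
  qed
  have vae: "AE z in lborel. snd z \<in> T \<longrightarrow> (case z of (y, t) \<Rightarrow> u y t $ i * u y t $ j) = v z $ i * v z $ j"
    using v_AE by eventually_elim (simp add: case_prod_unfold)
  have qi: "set_integrable lebesgue (cball 0 R) (\<lambda>y. case (y, t) of (y, t) \<Rightarrow> u y t $ i * u y t $ j)" if "t \<in> T" for t R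
    using u_product_integrable[OF that] by simp
  note S = separated_integral[OF borel_measurable_times[OF v_component_borel v_component_borel] vae bound qi g ab(2) kc R, where x=x]
  show "integrable lebesgue (\<lambda>(y, s). g s * (k (x - y) * (u y s $ i * u y s $ j)))"
    using S(1) by simp
  show "(LINT (y, s)|lebesgue. g s * (k (x - y) * (u y s $ i * u y s $ j))) = (LINT s|lborel. g s * Qv k i j (x, s))"
    using S(2) by (simp add: Qv_def)
  show "integrable lborel (\<lambda>s. g s * Qv k i j (x, s))"
    using S(3) by (simp add: Qv_def)
qed

end

end

lemma outer_inner_jacobian:
  "outer w w \<bullet> jacobian f (at x) = (\<Sum>j\<in>UNIV. w $ j * (w \<bullet> pd j f x))"
proof -
  have "outer w w \<bullet> jacobian f (at x) = (\<Sum>m\<in>UNIV. \<Sum>j\<in>UNIV. w $ m * w $ j * pd j f x $ m)"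
    by (simp add: inner_vec_def outer_def jacobian_def matrix_def pd_def)
  also have "\<dots> = (\<Sum>j\<in>UNIV. \<Sum>m\<in>UNIV. w $ m * w $ j * pd j f x $ m)"
    by (rule sum.swap)
  also have "\<dots> = (\<Sum>j\<in>UNIV. w $ j * (w \<bullet> pd j f x))"
    by (simp add: inner_vec_def sum_distrib_left mult_ac)
  finally show ?thesis .
qed

section \<open>Essentially bounded functions of time\<close>

definition ess_bounded :: "real \<Rightarrow> real \<Rightarrow> (real \<Rightarrow> real) \<Rightarrow> bool" where
  "ess_bounded a b f \<longleftrightarrow>
     set_borel_measurable lborel {a..b} f \<and> (\<exists>M. AE \<tau> in lborel. \<tau> \<in> {a..b} \<longrightarrow> \<bar>f \<tau>\<bar> \<le> M)"

lemma ess_bounded_add: "ess_bounded a b f \<Longrightarrow> ess_bounded a b g \<Longrightarrow> ess_bounded a b (\<lambda>t. f t + g t)"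
proof -
  assume f: "ess_bounded a b f" and g: "ess_bounded a b g"
  obtain M N where "AE \<tau> in lborel. \<tau> \<in> {a..b} \<longrightarrow> \<bar>f \<tau>\<bar> \<le> M" "AE \<tau> in lborel. \<tau> \<in> {a..b} \<longrightarrow> \<bar>g \<tau>\<bar> \<le> N"
    using f g unfolding ess_bounded_def by blast
  then have "AE \<tau> in lborel. \<tau> \<in> {a..b} \<longrightarrow> \<bar>f \<tau> + g \<tau>\<bar> \<le> M + N"
    by eventually_elim auto
  with f g show ?thesis
    unfolding ess_bounded_def by (blast intro: set_borel_measurable_add)
qed

lemma ess_bounded_continuous:
  assumes "continuous_on {a..b} f"
  shows "ess_bounded a b f"
proof -
  have "bounded (f ` {a..b})"
    using assms by (auto intro!: compact_imp_bounded compact_continuous_image)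
  then obtain M where "\<forall>x\<in>{a..b}. \<bar>f x\<bar> \<le> M"
    unfolding bounded_iff by auto
  then have "AE \<tau> in lborel. \<tau> \<in> {a..b} \<longrightarrow> \<bar>f \<tau>\<bar> \<le> M"
    by (intro AE_I2) auto
  then show ?thesis
    unfolding ess_bounded_def using set_borel_measurable_continuous[OF assms] by blast
qed

lemma ess_bounded_cmult: "ess_bounded a b f \<Longrightarrow> ess_bounded a b (\<lambda>t. c * f t)"
proof -
  assume f: "ess_bounded a b f"
  obtain M where "AE \<tau> in lborel. \<tau> \<in> {a..b} \<longrightarrow> \<bar>f \<tau>\<bar> \<le> M"
    using f unfolding ess_bounded_def by blast
  then have "AE \<tau> in lborel. \<tau> \<in> {a..b} \<longrightarrow> \<bar>c * f \<tau>\<bar> \<le> \<bar>c\<bar> * M"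
    by eventually_elim (auto simp: abs_mult intro: mult_left_mono)
  moreover have "set_borel_measurable lborel {a..b} (\<lambda>t. c * f t)"
    by (rule set_borel_measurable_mult[OF set_borel_measurable_continuous[OF continuous_on_const]])
       (use f in \<open>simp add: ess_bounded_def\<close>)
  ultimately show ?thesis
    unfolding ess_bounded_def by blast
qed

lemma ess_bounded_diff: "ess_bounded a b f \<Longrightarrow> ess_bounded a b g \<Longrightarrow> ess_bounded a b (\<lambda>t. f t - g t)"
  using ess_bounded_add[of a b f "\<lambda>t. -1 * g t"] ess_bounded_cmult[of a b g "-1"] by simp

lemma ess_bounded_sum:
  "finite A \<Longrightarrow> (\<And>j. j \<in> A \<Longrightarrow> ess_bounded a b (f j)) \<Longrightarrow> ess_bounded a b (\<lambda>t. \<Sum>j\<in>A. f j t)"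
  by (induction A rule: finite_induct) (auto intro: ess_bounded_continuous ess_bounded_add)

text \<open>\<open>ess_bounded\<close> controls \<open>f\<close> only on \<open>{a..b}\<close>.
  Multiplying by the indicator gives a Borel function on the line, and the admissible profiles
  \<open>g\<close> vanish off the interval, so the weak equation is unaffected.\<close>

lemma (in smooth_step) du_bois_reymond_set:
  assumes w: "continuous_on {a..b} w" and f: "ess_bounded a b f"
    and weak: "\<And>g g' c d. smooth_on UNIV g \<Longrightarrow> (\<And>t. (g has_real_derivative g' t) (at t)) \<Longrightarrow>
      continuous_on UNIV g' \<Longrightarrow> a < c \<Longrightarrow> d < b \<Longrightarrow> (\<And>t. t \<notin> {c..d} \<Longrightarrow> g t = 0 \<and> g' t = 0) \<Longrightarrow>
      (LINT t|lborel. g' t * w t) + (LINT t|lborel. g t * f t) = 0"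
    and st: "a < s" "s \<le> t" "t < b"
  shows "w t - w s = (LINT \<tau>:{s..t}|lborel. f \<tau>)"
proof -
  let ?f = "\<lambda>\<tau>. indicator {a..b} \<tau> * f \<tau>"
  obtain M where M: "AE \<tau> in lborel. \<tau> \<in> {a..b} \<longrightarrow> \<bar>f \<tau>\<bar> \<le> M"
    using f unfolding ess_bounded_def by blast
  have "w t - w s = (LINT \<tau>:{s..t}|lborel. ?f \<tau>)"
  proof (rule du_bois_reymond[OF w _ _ _ st])
    show "?f \<in> borel_measurable borel"
      using f unfolding ess_bounded_def set_borel_measurable_def by simp
    show "AE \<tau> in lborel. \<tau> \<in> {a..b} \<longrightarrow> \<bar>?f \<tau>\<bar> \<le> M"
      using M by eventually_elim auto
    fix g g' c d
    assume g: "smooth_on UNIV g" "\<And>t. (g has_real_derivative g' t) (at t)" "continuous_on UNIV g'"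
      "a < c" "d < b" "\<And>t. t \<notin> {c..d} \<Longrightarrow> g t = 0 \<and> g' t = 0"
    have "g t * ?f t = g t * f t" for t
      using g(4,5) g(6)[of t] by (cases "t \<in> {c..d}") (auto simp: indicator_def)
    then show "(LINT t|lborel. g' t * w t) + (LINT t|lborel. g t * ?f t) = 0"
      using weak[OF g] by presburger
  qed
  also have "\<dots> = (LINT \<tau>:{s..t}|lborel. f \<tau>)"
    by (rule set_lebesgue_integral_cong) (use st in auto)
  finally show ?thesis .
qed

section \<open>Time evolution and divergence of the filtered field\<close>

locale filtered_navier_stokes = filtered_field T u v + smooth_step \<beta> B
  for T u v \<beta> B +
  fixes p :: "real^3 \<Rightarrow> real \<Rightarrow> real" and K :: "real^3 \<Rightarrow> real"
  assumes ns: "weak_navier_stokes T u p" and K: "test_function UNIV K"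
begin

text \<open>
  \<open>vort a b = \<partial>\<^sub>a U\<^sub>b - \<partial>\<^sub>b U\<^sub>a\<close>, with time derivative \<open>rate a b\<close>. The latter uses the Borel version Qv
  because Q is defined pointwise in time only.
\<close>

definition vort :: "3 \<Rightarrow> 3 \<Rightarrow> real^3 \<Rightarrow> real \<Rightarrow> real" where
  "vort a b x t = V (pd a K) b x t - V (pd b K) a x t"

definition rate :: "3 \<Rightarrow> 3 \<Rightarrow> real^3 \<Rightarrow> real \<Rightarrow> real" where
  "rate a b x t =
     (\<Sum>j\<in>UNIV. V (pd j (pd j (pd a K))) b x t - V (pd j (pd j (pd b K))) a x t)
     - (\<Sum>j\<in>UNIV. Qv (pd j (pd a K)) b j (x, t) - Qv (pd j (pd b K)) a j (x, t))"

lemma K_smooth: "smooth_on UNIV K" "smooth_on UNIV (pd a K)" "smooth_on UNIV (pd j (pd a K))"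
  using K by (auto simp: test_function_def intro!: smooth_on_pd)

lemma K_test: "test_function UNIV (pd a K)" "test_function UNIV (pd j (pd a K))"
  "test_function UNIV (pd i (pd j (pd a K)))"
  by (intro test_function_pd K)+

lemma smooth_reflected:
  assumes "smooth_on UNIV k"
  shows "smooth_on UNIV (\<lambda>y::real^3. k (x - y) *\<^sub>R c)"
proof -
  have "smooth_on UNIV (\<lambda>y. k (- y + x))"
    by (intro smooth_on_affine[OF _ assms]) (auto intro: bounded_linear_minus bounded_linear_ident)
  then show ?thesis
    by (intro smooth_on_scaleR smooth_on_const) simp
qed

text \<open>
  The pressure disappears because the test field \<open>g (k\<^sub>a e\<^sub>b - k\<^sub>b e\<^sub>a)\<close> with
  \<open>k\<^sub>i = (\<partial>\<^sub>i K)(x - \<cdot>)\<close> is divergence free.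
\<close>

lemma weak_vorticity:
  assumes g: "smooth_on UNIV g" "\<And>t. (g has_real_derivative g' t) (at t)" "continuous_on UNIV g'"
    and zero: "\<And>t. t \<notin> {c..d} \<Longrightarrow> g t = 0" "\<And>t. t \<notin> {c..d} \<Longrightarrow> g' t = 0"
    and cd: "c < d" "{c..d} \<subseteq> T"
  shows "(LINT t|lborel. g' t * vort a b x t) + (LINT t|lborel. g t * rate a b x t) = 0"
proof -
  let ?ka = "pd a K" let ?kb = "pd b K"
  define W :: "real^3 \<Rightarrow> real^3" where "W y = ?ka (x - y) *\<^sub>R axis b 1 - ?kb (x - y) *\<^sub>R axis a 1" for y
  note gc = smooth_on_imp_continuous[OF g(1)]
  have Wsm: "smooth_on UNIV W"
  proof -
    have "smooth_on UNIV (\<lambda>y. ?ka (x - y) *\<^sub>R axis b 1 + (-1) *\<^sub>R (?kb (x - y) *\<^sub>R (axis a 1 :: real^3)))"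
      by (intro smooth_on_add smooth_on_scaleR smooth_on_const smooth_reflected K_smooth)
    then show ?thesis by (simp add: W_def[abs_def])
  qed
  obtain R where R: "\<And>y. R < norm y \<Longrightarrow> W y = 0"
  proof -
    obtain R1 R2 where R: "\<And>y. R1 < norm y \<Longrightarrow> ?ka y = 0" "\<And>y. R2 < norm y \<Longrightarrow> ?kb y = 0"
      using test_function_kernel(2)[OF K_test(1)] by meson
    have "W y = 0" if "max R1 R2 + norm x < norm y" for y
    proof -
      have "norm y \<le> norm (x - y) + norm x"
        using norm_triangle_sub[of y x] by (simp add: norm_minus_commute)
      then show ?thesis
        using R[of "x - y"] that by (simp add: W_def)
    qed
    then show thesis by (rule that)
  qed
  have tf: "test_function (UNIV \<times> T) (\<lambda>(y, s). g s *\<^sub>R W y)"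
    by (rule test_function_space_time[OF Wsm R g(1) zero(1) cd(2)])
  have vd: "vector_derivative (\<lambda>s. g s *\<^sub>R W y) (at t) = g' t *\<^sub>R W y" for y t
  proof -
    have "((\<lambda>s. g s *\<^sub>R W y) has_vector_derivative g t *\<^sub>R 0 + g' t *\<^sub>R W y) (at t)"
      by (rule has_vector_derivative_scaleR[OF g(2) has_vector_derivative_const])
    then show ?thesis
      by (simp add: vector_derivative_at)
  qed
  have pdW: "pd j (\<lambda>y. g t *\<^sub>R W y) =
      (\<lambda>y. (- g t) *\<^sub>R (pd j ?ka (x - y) *\<^sub>R axis b 1 - pd j ?kb (x - y) *\<^sub>R axis a 1))" for j t
    unfolding W_def by (rule pd_reflected_kernels[OF K_smooth(2,2)])
  have ppW: "pd j (pd j (\<lambda>y. g t *\<^sub>R W y)) y =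
      g t *\<^sub>R (pd j (pd j ?ka) (x - y) *\<^sub>R axis b 1 - pd j (pd j ?kb) (x - y) *\<^sub>R axis a 1)" for j t y
    unfolding pdW pd_reflected_kernels[OF K_smooth(3,3)] by simp
  \<comment> \<open>The divergence is a multiple of \<open>pd b (pd a K) - pd a (pd b K)\<close>,
    which vanishes by symmetry of second derivatives.\<close>
  have dw: "divergence (\<lambda>y. g t *\<^sub>R W y) y = 0" for t y
  proof -
    have "divergence (\<lambda>y. g t *\<^sub>R W y) y =
        (- g t) * ((\<Sum>j\<in>UNIV. axis b (1::real) $ j *\<^sub>R pd j ?ka (x - y)) - (\<Sum>j\<in>UNIV. axis a (1::real) $ j *\<^sub>R pd j ?kb (x - y)))"
      by (simp add: divergence_def pdW sum_subtractf[symmetric] sum_distrib_left mult_ac)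
    also have "\<dots> = 0"
      unfolding sum_axis_scaleR using pd_commute[OF K_smooth(1), of a b] by simp
    finally show ?thesis .
  qed
  \<comment> \<open>\<open>I m n\<close> collects the terms in which the kernel carries
    \<open>pd m\<close> and the velocity component is \<open>n\<close>; the test field is
    antisymmetric, so the integrand is \<open>I a b - I b a\<close>. The convection term has one
    reflected derivative and hence the opposite sign to the time and Laplacian terms, which have
    none and two.\<close>
  define I where "I m n z = g' (snd z) * (pd m K (x - fst z) * u (fst z) (snd z) $ n)
      + (\<Sum>j\<in>UNIV. g (snd z) * (pd j (pd j (pd m K)) (x - fst z) * u (fst z) (snd z) $ n))
      - (\<Sum>j\<in>UNIV. g (snd z) * (pd j (pd m K) (x - fst z) * (u (fst z) (snd z) $ n * u (fst z) (snd z) $ j)))" for m n z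
  have pw: "u y t \<bullet> vector_derivative (\<lambda>s. g s *\<^sub>R W y) (at t) + u y t \<bullet> laplacian (\<lambda>y. g t *\<^sub>R W y) y
      + outer (u y t) (u y t) \<bullet> jacobian (\<lambda>y. g t *\<^sub>R W y) (at y)
      + p y t * divergence (\<lambda>y. g t *\<^sub>R W y) y = I a b (y, t) - I b a (y, t)" for y t
  proof -
    have "u y t \<bullet> vector_derivative (\<lambda>s. g s *\<^sub>R W y) (at t)
        = g' t * (?ka (x - y) * u y t $ b) - g' t * (?kb (x - y) * u y t $ a)"
      unfolding vd by (simp add: W_def inner_diff_right inner_axis right_diff_distrib)
    moreover have "u y t \<bullet> laplacian (\<lambda>y. g t *\<^sub>R W y) y
        = (\<Sum>j\<in>UNIV. g t * (pd j (pd j ?ka) (x - y) * u y t $ b)) - (\<Sum>j\<in>UNIV. g t * (pd j (pd j ?kb) (x - y) * u y t $ a))"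
      unfolding laplacian_def ppW
      by (simp add: inner_sum_right inner_diff_right inner_axis right_diff_distrib sum_subtractf)
    moreover have "outer (u y t) (u y t) \<bullet> jacobian (\<lambda>y. g t *\<^sub>R W y) (at y)
        = (\<Sum>j\<in>UNIV. g t * (pd j ?kb (x - y) * (u y t $ a * u y t $ j))) - (\<Sum>j\<in>UNIV. g t * (pd j ?ka (x - y) * (u y t $ b * u y t $ j)))"
      unfolding outer_inner_jacobian pdW sum_subtractf[symmetric]
      by (intro sum.cong refl) (simp add: inner_diff_right inner_axis algebra_simps)
    ultimately show ?thesis
      unfolding dw by (simp add: I_def)
  qed
  have "(LINT z|lebesgue. I a b z - I b a z) = 0"
  proof -
    have "(LINT (y, t)|lebesgue. u y t \<bullet> vector_derivative (\<lambda>s. g s *\<^sub>R W y) (at t)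
           + u y t \<bullet> laplacian (\<lambda>y. g t *\<^sub>R W y) y
           + outer (u y t) (u y t) \<bullet> jacobian (\<lambda>y. g t *\<^sub>R W y) (at y)
           + p y t * divergence (\<lambda>y. g t *\<^sub>R W y) y) = 0"
      using ns tf unfolding weak_navier_stokes_def by blast
    then show ?thesis
      unfolding pw by (simp add: case_prod_unfold)
  qed
  moreover
  note sV' = separated_V[OF g(3) zero(2) cd K_test(1), unfolded case_prod_unfold]
  note sV = separated_V[OF gc zero(1) cd K_test(3), unfolded case_prod_unfold]
  note sQ = separated_Q[OF gc zero(1) cd K_test(2), unfolded case_prod_unfold]
  have I: "integrable lebesgue (I m n)" "(LINT z|lebesgue. I m n z) = (LINT s|lborel. g' s * V (pd m K) n x s)
      + (\<Sum>j\<in>UNIV. LINT s|lborel. g s * V (pd j (pd j (pd m K))) n x s)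
      - (\<Sum>j\<in>UNIV. LINT s|lborel. g s * Qv (pd j (pd m K)) n j (x, s))" for m n
    unfolding I_def using sV' sV sQ by simp_all
  ultimately have eq: "((LINT s|lborel. g' s * V ?ka b x s)
      + (\<Sum>j\<in>UNIV. LINT s|lborel. g s * V (pd j (pd j ?ka)) b x s)
      - (\<Sum>j\<in>UNIV. LINT s|lborel. g s * Qv (pd j ?ka) b j (x, s)))
     - ((LINT s|lborel. g' s * V ?kb a x s)
      + (\<Sum>j\<in>UNIV. LINT s|lborel. g s * V (pd j (pd j ?kb)) a x s)
      - (\<Sum>j\<in>UNIV. LINT s|lborel. g s * Qv (pd j ?kb) a j (x, s))) = 0"
    using I(1)[of a b] I(1)[of b a] by (simp add: I(2))
  have e1: "(LINT t|lborel. g' t * vort a b x t) = (LINT s|lborel. g' s * V ?ka b x s) - (LINT s|lborel. g' s * V ?kb a x s)"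
    unfolding vort_def right_diff_distrib using sV'(3) by simp
  have "g t * rate a b x t = (\<Sum>j\<in>UNIV. g t * V (pd j (pd j ?ka)) b x t - g t * V (pd j (pd j ?kb)) a x t)
      - (\<Sum>j\<in>UNIV. g t * Qv (pd j ?ka) b j (x, t) - g t * Qv (pd j ?kb) a j (x, t))" for t
    by (simp add: rate_def right_diff_distrib sum_distrib_left)
  then have "(LINT t|lborel. g t * rate a b x t) =
      (\<Sum>j\<in>UNIV. (LINT s|lborel. g s * V (pd j (pd j ?ka)) b x s) - (LINT s|lborel. g s * V (pd j (pd j ?kb)) a x s))
      - (\<Sum>j\<in>UNIV. (LINT s|lborel. g s * Qv (pd j ?ka) b j (x, s)) - (LINT s|lborel. g s * Qv (pd j ?kb) a j (x, s)))"
    using sV(3) sQ(3) by simp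
  with e1 eq show ?thesis
    by (simp add: sum_subtractf)
qed

text \<open>The viscous terms are linear in \<open>u\<close>, hence continuous in time. The
  quadratic ones are Borel as sections of \<open>Qv\<close>, and bounded for almost every time
  through their agreement with \<open>Q\<close>.\<close>

lemma rate_ess_bounded:
  assumes cd: "c < d" "{c..d} \<subseteq> T"
  shows "ess_bounded c d (rate a b x)"
proof -
  have V: "ess_bounded c d (V (pd i (pd j (pd m K))) n x)" for i j m n
    by (rule ess_bounded_continuous, rule continuous_on_subset[OF V_time_continuous[OF K_test(3)] cd(2)])
  have Q: "ess_bounded c d (\<lambda>t. Qv (pd i (pd m K)) n j (x, t))" for i j m n
    unfolding ess_bounded_def
  proof
    note kc = test_function_kernel(1)[OF K_test(2)[of i m]]
    have "(\<lambda>t::real. (x, t)) \<in> borel_measurable borel"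
      by (intro borel_measurable_continuous_onI continuous_intros)
    from measurable_compose[OF this Qv_borel[OF kc]]
    have "(\<lambda>t. Qv (pd i (pd m K)) n j (x, t)) \<in> borel_measurable borel" .
    then show "set_borel_measurable lborel {c..d} (\<lambda>t. Qv (pd i (pd m K)) n j (x, t))"
      unfolding set_borel_measurable_def by simp
    obtain M where "AE t in lborel. t \<in> {c..d} \<longrightarrow> (\<forall>y\<in>cball 0 (norm x). \<bar>Q (pd i (pd m K)) n j y t\<bar> \<le> M)"
      using Q_bounded[OF K_test(2) cd(2)] by blast
    then have "AE t in lborel. t \<in> {c..d} \<longrightarrow> \<bar>Qv (pd i (pd m K)) n j (x, t)\<bar> \<le> M"
      using Q_eq_Qv[OF kc, of n j]
    proof eventually_elim
      case (elim t)
      show ?case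
      proof
        assume t: "t \<in> {c..d}"
        then have "Q (pd i (pd m K)) n j x t = Qv (pd i (pd m K)) n j (x, t)"
          using elim(2) cd(2) by blast
        moreover have "x \<in> cball 0 (norm x)" by simp
        ultimately show "\<bar>Qv (pd i (pd m K)) n j (x, t)\<bar> \<le> M"
          using elim(1) t by metis
      qed
    qed
    then show "\<exists>M. AE t in lborel. t \<in> {c..d} \<longrightarrow> \<bar>Qv (pd i (pd m K)) n j (x, t)\<bar> \<le> M" by blast
  qed
  show ?thesis
    unfolding rate_def by (intro ess_bounded_diff ess_bounded_sum V Q) auto
qed

text \<open>The du Bois-Reymond argument reaches only interior times, so it is run on the larger
  interval \<open>{c..d}\<close> in order to include the endpoints \<open>s0\<close> and
  \<open>s1\<close>.\<close>

lemma vort_primitive: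
  assumes "c < s0" "s0 < s1" "s1 < d" "{c..d} \<subseteq> T"
  shows "bounded_primitive s0 s1 (vort a b x) (rate a b x)"
  unfolding bounded_primitive_def
proof (intro conjI allI impI)
  have "{s0..s1} \<subseteq> T" using assms by force
  from rate_ess_bounded[OF assms(2) this]
  show "set_borel_measurable lborel {s0..s1} (rate a b x)"
    "\<exists>M. AE \<tau> in lborel. \<tau> \<in> {s0..s1} \<longrightarrow> \<bar>rate a b x \<tau>\<bar> \<le> M"
    unfolding ess_bounded_def by auto
  fix s t assume st: "s0 \<le> s" "s \<le> t" "t \<le> s1"
  have cd: "c < d" using assms by simp
  show "vort a b x t - vort a b x s = (LINT \<tau>:{s..t}|lborel. rate a b x \<tau>)"
  proof (rule du_bois_reymond_set[of c d])
    show "continuous_on {c..d} (vort a b x)"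
      unfolding vort_def
      by (intro continuous_intros continuous_on_subset[OF V_time_continuous[OF K_test(1)] assms(4)])
    show "ess_bounded c d (rate a b x)"
      by (rule rate_ess_bounded[OF cd assms(4)])
    show "c < s" "s \<le> t" "t < d" using st assms by auto
    fix g g' :: "real \<Rightarrow> real" and c' d'
    assume g: "smooth_on UNIV g" "\<And>t. (g has_real_derivative g' t) (at t)" "continuous_on UNIV g'"
      "c < c'" "d' < d" "\<And>t. t \<notin> {c'..d'} \<Longrightarrow> g t = 0 \<and> g' t = 0"
    show "(LINT t|lborel. g' t * vort a b x t) + (LINT t|lborel. g t * rate a b x t) = 0"
      by (rule weak_vorticity[OF g(1-3) _ _ cd assms(4)]) (use g(4-6) in force)+
  qed
qed

text \<open>The weak constraint only says that the divergence at \<open>x\<close>, a continuous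
  function of time, integrates to zero against time profiles. Bumps shrinking to \<open>t\<close>
  recover its value at \<open>t\<close>.\<close>

lemma divergence_free:
  assumes t: "t \<in> T"
  shows "(\<Sum>i\<in>UNIV. V (pd i K) i x t) = 0"
proof -
  obtain e where e: "e > 0" "cball t e \<subseteq> T"
    using open_T t open_contains_cball by blast
  let ?a = "t - e" let ?b = "t + e"
  have ab: "?a < ?b" "{?a..?b} \<subseteq> T"
    using e by (auto simp: cball_eq_atLeastAtMost)
  define w where "w s = (\<Sum>i\<in>UNIV. V (pd i K) i x s)" for s
  have wc: "continuous_on {?a..?b} w"
    unfolding w_def
    by (intro continuous_intros continuous_on_subset[OF V_time_continuous[OF K_test(1)] ab(2)])
  obtain n0 :: nat where n0: "2 / e < real n0"
    using reals_Archimedean2 by blast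
  have "(LINT s|lborel. real (Suc n) * \<beta> (real (Suc n) * (s - t)) * w s) = 0" if "n \<ge> n0" for n
  proof -
    define g where "g s = real (Suc n) * \<beta> (real (Suc n) * (s - t))" for s
    have gsm: "smooth_on UNIV g"
      unfolding g_def[abs_def] by (rule bump_smooth)
    have "2 / e < real (Suc n)" using n0 that by simp
    then have N: "2 / real (Suc n) < e"
      using e(1) by (simp add: field_simps)
    have zero: "g s = 0" if "s \<notin> {?a..?b}" for s
    proof -
      have "2 / real (Suc n) < \<bar>s - t\<bar>"
        using that N by (auto simp: abs_if not_le)
      then show ?thesis
        unfolding g_def by (intro bump_zero) auto
    qed
    obtain R where R: "\<And>y. R < norm y \<Longrightarrow> K y = 0"
      using test_function_kernel(2)[OF K] by blast
    have sm: "smooth_on UNIV (\<lambda>y. K (x - y) *\<^sub>R (1::real))"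
      by (rule smooth_reflected[OF K_smooth(1)])
    have "K (x - y) *\<^sub>R (1::real) = 0" if "R + norm x < norm y" for y
    proof -
      have "norm y \<le> norm (x - y) + norm x"
        using norm_triangle_sub[of y x] by (simp add: norm_minus_commute)
      then show ?thesis
        using R[of "x - y"] that by simp
    qed
    from test_function_space_time[OF sm this gsm zero ab(2)]
    have "test_function (UNIV \<times> T) (\<lambda>(y, s). g s * K (x - y))"
      by simp
    then have "(LINT (y, s)|lebesgue. u y s \<bullet> grad (\<lambda>y. g s * K (x - y)) y) = 0"
      using ns unfolding weak_navier_stokes_def by blast
    moreover have "u y s \<bullet> grad (\<lambda>y. g s * K (x - y)) y = - (\<Sum>j\<in>UNIV. g s * (pd j K (x - y) * u y s $ j))" for y s
    proof -
      \<comment> \<open>The formula for two kernels is specialised to one by taking the second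
        kernel zero.\<close>
      have "pd j (\<lambda>y. g s * K (x - y)) y = - g s * pd j K (x - y)" for j
        using pd_reflected_kernels[OF K_smooth(1) smooth_on_const[of UNIV "0::real"], of j "g s" x "1::real" "1::real"]
          fun_cong[of "pd j (\<lambda>y. g s * K (x - y))" _ y]
        by (simp add: pd_eqI[OF has_derivative_const])
      then show ?thesis
        by (simp add: grad_def inner_vec_def sum_negf[symmetric] mult_ac)
    qed
    ultimately have eq: "(LINT z|lebesgue. (\<Sum>j\<in>UNIV. g (snd z) * (pd j K (x - fst z) * u (fst z) (snd z) $ j))) = 0"
      by (simp add: case_prod_unfold)
    note sV = separated_V[OF smooth_on_imp_continuous[OF gsm] zero ab K_test(1), unfolded case_prod_unfold]
    have "(LINT s|lborel. g s * w s) = 0"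
      unfolding w_def sum_distrib_left using eq sV by simp
    then show ?thesis by (simp add: g_def)
  qed
  then have "eventually (\<lambda>n. (LINT s|lborel. real (Suc n) * \<beta> (real (Suc n) * (s - t)) * w s) = 0) sequentially"
    unfolding eventually_sequentially by blast
  then have "(\<lambda>n. LINT s|lborel. real (Suc n) * \<beta> (real (Suc n) * (s - t)) * w s) \<longlonglongrightarrow> 0"
    by (rule tendsto_eventually)
  moreover have "(\<lambda>n. LINT s|lborel. real (Suc n) * \<beta> (real (Suc n) * (s - t)) * w s) \<longlonglongrightarrow> w t"
    by (rule bump_tendsto[OF wc]) (use e in auto)
  ultimately have "w t = 0"
    by (rule LIMSEQ_unique[symmetric])
  then show ?thesis by (simp add: w_def)
qed

end

section \<open>The near-field strain as an absolutely convergent integral\<close>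

text \<open>Lebesgue measure is determined by its values on boxes, and the preimage of a box is its
  image under the inverse, again orthogonal, which has the same measure.\<close>

lemma lborel_distr_orthogonal:
  fixes f :: "real^'n::{finite,wellorder} \<Rightarrow> real^'n::_"
  assumes f: "orthogonal_transformation f"
  shows "distr lborel borel f = lborel"
proof (rule sym, rule lborel_eqI)
  fix l u :: "real^'n::_"
  assume lu: "\<And>b. b \<in> Basis \<Longrightarrow> l \<bullet> b \<le> u \<bullet> b"
  have fm: "f \<in> borel_measurable borel"
    by (intro borel_measurable_continuous_onI linear_continuous_on linear_conv_bounded_linear[THEN iffD1]
        orthogonal_transformation_linear f)
  have bij: "bij f"
    by (rule orthogonal_transformation_bij[OF f])
  have inv: "orthogonal_transformation (inv f)"
    by (rule orthogonal_transformation_inv[OF f])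
  have pre: "f -` box l u = inv f ` box l u"
    using bij by (simp add: bij_vimage_eq_inv_image)
  have sb: "f -` box l u \<in> sets borel"
    using measurable_sets[OF fm, of "box l u"] by simp
  have meas: "inv f ` box l u \<in> lmeasurable" "measure lebesgue (inv f ` box l u) = measure lebesgue (box l u)"
    using measure_orthogonal_image[OF inv lmeasurable_box] measurable_orthogonal_image[OF inv lmeasurable_box] by auto
  have "emeasure (distr lborel borel f) (box l u) = emeasure lborel (f -` box l u)"
    using fm by (subst emeasure_distr) auto
  also have "\<dots> = emeasure lebesgue (inv f ` box l u)"
    using sb by (simp add: pre)
  also have "\<dots> = emeasure lebesgue (box l u)"
    unfolding emeasure_eq_measure2[OF meas(1)] emeasure_eq_measure2[OF lmeasurable_box] meas(2) ..
  also have "\<dots> = (\<Prod>b\<in>Basis. (u - l) \<bullet> b)"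
    using lu by simp
  finally show "emeasure (distr lborel borel f) (box l u) = (\<Prod>b\<in>Basis. (u - l) \<bullet> b)" .
qed simp

lemma integral_orthogonal:
  fixes f :: "real^'n::{finite,wellorder} \<Rightarrow> real^'n::_" and h :: "real^'n::_ \<Rightarrow> real"
  assumes "orthogonal_transformation f" "h \<in> borel_measurable borel"
  shows "(LINT z|lborel. h (f z)) = (LINT z|lborel. h z)"
proof -
  have fm: "f \<in> borel_measurable borel"
    by (intro borel_measurable_continuous_onI linear_continuous_on linear_conv_bounded_linear[THEN iffD1]
        orthogonal_transformation_linear assms(1))
  have "(LINT z|lborel. h z) = (LINT z|distr lborel borel f. h z)"
    by (simp add: lborel_distr_orthogonal[OF assms(1)])
  also have "\<dots> = (LINT z|lborel. h (f z))"
    by (rule integral_distr) (use fm assms(2) in auto)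
  finally show ?thesis by simp
qed

section \<open>Second moments of radial functions\<close>

lemma orthogonal_reflection: "orthogonal_transformation (\<lambda>z::real^'n. \<chi> i. if i = a then - z $ i else z $ i)"
  unfolding orthogonal_transformation_def
proof (intro conjI allI)
  show "linear (\<lambda>z::real^'n. \<chi> i. if i = a then - z $ i else z $ i)"
    by (rule linearI) (auto simp: vec_eq_iff)
  show "(\<chi> i. if i = a then - v $ i else v $ i) \<bullet> (\<chi> i. if i = a then - w $ i else w $ i) = v \<bullet> w"
    for v w :: "real^'n"
    unfolding inner_vec_def by (rule sum.cong) auto
qed

lemma orthogonal_swap:
  "orthogonal_transformation (\<lambda>z::real^'n. \<chi> i. z $ (if i = a then b else if i = b then a else i))"
  unfolding orthogonal_transformation_def
proof (intro conjI allI)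
  show "linear (\<lambda>z::real^'n. \<chi> i. z $ (if i = a then b else if i = b then a else i))"
    by (rule linearI) (auto simp: vec_eq_iff)
  let ?p = "\<lambda>i. if i = a then b else if i = b then a else i"
  show "(\<chi> i. v $ ?p i) \<bullet> (\<chi> i. w $ ?p i) = v \<bullet> w" for v w :: "real^'n"
    unfolding inner_vec_def by (rule sum.reindex_bij_witness[of _ ?p ?p]) auto
qed

lemma vec_nth_borel [measurable]: "(\<lambda>z::real^'n. z $ i) \<in> borel_measurable borel"
  by (intro borel_measurable_continuous_onI continuous_intros)

text \<open>A sign change of one coordinate maps an off-diagonal moment to its negative, and an
  exchange of two coordinates maps one diagonal moment to the other. Together: the moment matrix is
  a multiple of the identity.\<close>

lemma radial_second_moments:
  fixes g :: "real^'n::{finite,wellorder} \<Rightarrow> real"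
  assumes g: "g \<in> borel_measurable borel" "\<And>x y. norm x = norm y \<Longrightarrow> g x = g y"
  shows "a \<noteq> b \<Longrightarrow> (LINT z|lborel. g z * (z $ a * z $ b)) = 0"
    and "(LINT z|lborel. g z * (z $ a * z $ a)) = (LINT z|lborel. g z * (z $ b * z $ b))"
proof -
  have m: "(\<lambda>z. g z * (z $ a * z $ b)) \<in> borel_measurable borel" for a b
    by (intro borel_measurable_times g vec_nth_borel)
  show "(LINT z|lborel. g z * (z $ a * z $ b)) = 0" if "a \<noteq> b"
  proof -
    let ?f = "\<lambda>z::(real, 'n) vec. \<chi> i. if i = a then - z $ i else z $ i"
    have "g (?f z) = g z" for z
      by (rule g(2)) (rule orthogonal_transformation_norm[OF orthogonal_reflection])
    then have "(LINT z|lborel. g z * (z $ a * z $ b)) = (LINT z|lborel. - (g z * (z $ a * z $ b)))"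
      using integral_orthogonal[OF orthogonal_reflection[of a] m[of a b]] that by simp
    then show ?thesis by simp
  qed
  let ?f = "\<lambda>z::(real, 'n) vec. \<chi> i. z $ (if i = a then b else if i = b then a else i)"
  have "g (?f z) = g z" for z
    by (rule g(2)) (rule orthogonal_transformation_norm[OF orthogonal_swap])
  then show "(LINT z|lborel. g z * (z $ a * z $ a)) = (LINT z|lborel. g z * (z $ b * z $ b))"
    using integral_orthogonal[OF orthogonal_swap[of a b] m[of a a]] by simp
qed

text \<open>Dyadic decomposition. Where \<open>norm z\<close> exceeds \<open>d / 2 ^ Suc n\<close>
  the function is at most \<open>a n = 4 ^ Suc n / d\<^sup>2\<close>, while the ball of radius
  \<open>r n = d / 2 ^ n\<close> has volume \<open>c * r n ^ 3\<close>; the products are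
  \<open>4 * c * d * (1/2) ^ n\<close>, a convergent geometric series.\<close>

lemma inverse_square_integrable:
  assumes d: "0 < d"
  shows "integrable lborel (\<lambda>z::real^3. indicator (cball 0 d) z * inverse ((norm z)\<^sup>2))"
proof -
  define a where "a n = 4 ^ Suc n / d\<^sup>2" for n :: nat
  define r where "r n = d / 2 ^ n" for n :: nat
  define c where "c = unit_ball_vol (real DIM(real^3))"
  have a0: "0 \<le> a n" and r0: "0 < r n" for n
    using d by (simp_all add: a_def r_def)
  have pw: "ennreal (indicator (cball 0 d) z * inverse ((norm z)\<^sup>2))
      \<le> (\<Sum>n. ennreal (a n) * indicator (cball 0 (r n)) z)" for z :: "real^3"
  proof (cases "z = 0 \<or> d < norm z")
    case True
    then have "indicator (cball 0 d) z * inverse ((norm z)\<^sup>2) = (0::real)" by auto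
    then show ?thesis by (metis ennreal_0 zero_le)
  next
    case False
    then have z: "0 < norm z" "norm z \<le> d" by auto
    have "\<exists>n. d < norm z * 2 ^ n"
      using real_arch_pow[of 2 "d / norm z"] z by (auto simp: pos_divide_less_eq mult.commute)
    \<comment> \<open>The least such \<open>n\<close> is positive because
      \<open>norm z \<le> d\<close>; its predecessor \<open>m\<close> is the index of the shell from
      \<open>d / 2 ^ Suc m\<close> to \<open>d / 2 ^ m\<close> that contains
      \<open>z\<close>.\<close>
    define n where "n = (LEAST n. d < norm z * 2 ^ n)"
    have n: "d < norm z * 2 ^ n"
      unfolding n_def using \<open>\<exists>n. d < norm z * 2 ^ n\<close> by (rule LeastI_ex)
    then obtain m where m: "n = Suc m"
      using z by (cases n) auto
    have "\<not> d < norm z * 2 ^ m"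
      using not_less_Least[of m "\<lambda>n. d < norm z * 2 ^ n"] m n_def by simp
    then have zm: "z \<in> cball 0 (r m)"
      by (simp add: r_def pos_le_divide_eq)
    have "d\<^sup>2 \<le> (norm z * 2 ^ Suc m)\<^sup>2"
      using n d m by (intro power_mono) auto
    then have "inverse ((norm z)\<^sup>2) \<le> a m"
    proof -
      assume le: "d\<^sup>2 \<le> (norm z * 2 ^ Suc m)\<^sup>2"
      have "(norm z * 2 ^ Suc m)\<^sup>2 = (norm z)\<^sup>2 * 4 ^ Suc m"
        unfolding power_mult_distrib power_mult[symmetric] mult.commute[of "Suc m" 2]
        unfolding power_mult by simp
      with le have "d\<^sup>2 \<le> (norm z)\<^sup>2 * 4 ^ Suc m" by simp
      then show ?thesis
        using z d by (simp add: a_def field_simps)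
    qed
    then have "ennreal (indicator (cball 0 d) z * inverse ((norm z)\<^sup>2)) \<le> ennreal (a m) * indicator (cball 0 (r m)) z"
      using z zm by (simp add: ennreal_leI)
    also have "\<dots> \<le> (\<Sum>n. ennreal (a n) * indicator (cball 0 (r n)) z)"
    proof -
      have "h m \<le> suminf h" for h :: "nat \<Rightarrow> ennreal"
        using sum_le_suminf[of h "{m}"] by simp
      then show ?thesis .
    qed
    finally show ?thesis .
  qed
  have "(\<integral>\<^sup>+z. ennreal (indicator (cball (0::real^3) d) z * inverse ((norm z)\<^sup>2)) \<partial>lborel)
      \<le> (\<integral>\<^sup>+z. (\<Sum>n. ennreal (a n) * indicator (cball (0::real^3) (r n)) z) \<partial>lborel)"
    by (intro nn_integral_mono pw)
  also have "\<dots> = (\<Sum>n. \<integral>\<^sup>+z. ennreal (a n) * indicator (cball (0::real^3) (r n)) z \<partial>lborel)"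
  proof (rule nn_integral_suminf)
    have [measurable]: "cball (0::real^3) (r n) \<in> sets borel" for n by simp
    show "(\<lambda>z. ennreal (a n) * indicator (cball (0::real^3) (r n)) z) \<in> borel_measurable lborel" for n
      by measurable
  qed
  also have "\<dots> = (\<Sum>n. ennreal (4 * c * d * (1/2) ^ n))"
  proof (rule arg_cong[where f=suminf], rule ext)
    fix n
    have "(\<integral>\<^sup>+z. ennreal (a n) * indicator (cball (0::real^3) (r n)) z \<partial>lborel)
        = ennreal (a n) * emeasure lborel (cball (0::real^3) (r n))"
      by (simp add: nn_integral_cmult_indicator)
    also have "\<dots> = ennreal (a n) * ennreal (c * r n ^ 3)"
      using r0[of n] by (simp add: emeasure_cball c_def)
    also have "\<dots> = ennreal (a n * (c * r n ^ 3))"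
      using a0 by (simp add: ennreal_mult')
    also have "a n * (c * r n ^ 3) = 4 * c * d * (1/2) ^ n"
    proof -
      have e: "(4::real) ^ n = (2 ^ n)\<^sup>2"
        by (simp add: power2_eq_square flip: power_mult_distrib)
      show ?thesis
        using d by (simp add: a_def r_def e power_divide field_simps power2_eq_square power3_eq_cube)
    qed
    finally show "(\<integral>\<^sup>+z. ennreal (a n) * indicator (cball (0::real^3) (r n)) z \<partial>lborel)
        = ennreal (4 * c * d * (1/2) ^ n)" .
  qed
  also have "\<dots> < \<infinity>"
  proof -
    have "summable (\<lambda>n. 4 * c * d * (1/2::real) ^ n)"
      by (intro summable_mult summable_geometric) simp
    moreover have "0 \<le> 4 * c * d * (1/2::real) ^ n" for n
      using d by (simp add: c_def unit_ball_vol_nonneg)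
    ultimately have "(\<Sum>n. ennreal (4 * c * d * (1/2) ^ n)) \<noteq> top"
      by (rule ennreal_suminf_neq_top)
    then show ?thesis by (simp add: less_top)
  qed
  finally have fin: "(\<integral>\<^sup>+z. ennreal (indicator (cball (0::real^3) d) z * inverse ((norm z)\<^sup>2)) \<partial>lborel) < \<infinity>" .
  show ?thesis
  proof (rule integrableI_nonneg)
    show "(\<lambda>z::real^3. indicator (cball 0 d) z * inverse ((norm z)\<^sup>2)) \<in> borel_measurable lborel"
      unfolding measurable_lborel2
      by (intro borel_measurable_times borel_measurable_indicator borel_measurable_inverse
          borel_measurable_power borel_measurable_norm) simp
  qed (use fin in auto)
qed

text \<open>Numerator of the near-field integrand for direction \<open>e\<close> and vorticity
  \<open>w\<close>. It is linear in \<open>w\<close>, which allows subtracting a constant vorticity,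
  and quadratic in \<open>e\<close>, which brings in second moments.\<close>

definition strain_kernel :: "real^3 \<Rightarrow> real^3 \<Rightarrow> real^3^3" where
  "strain_kernel e w = outer (cross3 e w) e + outer e (cross3 e w)"

lemma norm_outer: "norm (outer a b) = norm a * norm b"
proof -
  have "outer a b $ i = a $ i *\<^sub>R b" for i
    by (simp add: outer_def vec_eq_iff)
  then have "norm (outer a b) = L2_set (\<lambda>i. norm (a $ i) * norm b) UNIV"
    by (simp add: norm_vec_def[of "outer a b"])
  also have "\<dots> = norm a * norm b"
    by (simp add: L2_set_left_distrib[symmetric] norm_vec_def[of a])
  finally show ?thesis .
qed

lemma norm_strain_kernel_le: "norm (strain_kernel e w) \<le> 2 * (norm e)\<^sup>2 * norm w"
proof -
  have "(norm (cross3 e w))\<^sup>2 \<le> (norm e * norm w)\<^sup>2"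
    by (simp add: norm_cross power_mult_distrib)
  then have c: "norm (cross3 e w) \<le> norm e * norm w"
    by (rule power2_le_imp_le) simp
  have "norm (strain_kernel e w) \<le> norm (cross3 e w) * norm e + norm e * norm (cross3 e w)"
    unfolding strain_kernel_def using norm_triangle_ineq[of "outer (cross3 e w) e" "outer e (cross3 e w)"]
    by (simp add: norm_outer)
  also have "\<dots> \<le> (norm e * norm w) * norm e + norm e * (norm e * norm w)"
    by (intro add_mono mult_right_mono mult_left_mono c) auto
  finally show ?thesis
    by (simp add: power2_eq_square mult_ac)
qed

lemma strain_kernel_diff: "strain_kernel e (w - w') = strain_kernel e w - strain_kernel e w'"
  by (simp add: strain_kernel_def outer_def vec_eq_iff right_diff_distrib left_diff_distrib cross3_simps)

lemma strain_kernel_scale: "strain_kernel (c *\<^sub>R e) w = c\<^sup>2 *\<^sub>R strain_kernel e w"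
  by (simp add: strain_kernel_def outer_def vec_eq_iff cross_mult_left power2_eq_square algebra_simps)

lemma continuous_strain_kernel: "continuous_on UNIV (\<lambda>x. strain_kernel (fst x) (snd x))"
  unfolding strain_kernel_def outer_def
  by (intro continuous_intros continuous_on_cross continuous_on_vec_lambda)

lemma borel_strain_kernel:
  assumes "f \<in> borel_measurable M" "g \<in> borel_measurable M"
  shows "(\<lambda>x. strain_kernel (f x) (g x)) \<in> borel_measurable M"
  by (rule borel_measurable_continuous_Pair[OF assms continuous_strain_kernel])

text \<open>Inserting the second moments, which are \<open>m 1 1\<close> times the identity, leaves
  that factor times the sum of the \<open>i\<close>-th component of the cross product of the
  \<open>j\<close>-th unit vector with \<open>c\<close> and the same with \<open>i\<close> and
  \<open>j\<close> exchanged. The cross product with \<open>c\<close> is an antisymmetric matrix, so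
  this sum is zero.\<close>

lemma radial_strain_kernel_integral:
  fixes g :: "real^3 \<Rightarrow> real"
  assumes g: "g \<in> borel_measurable borel" "\<And>x y. norm x = norm y \<Longrightarrow> g x = g y"
    and int: "\<And>a b. integrable lborel (\<lambda>z. g z * (z $ a * z $ b))"
  shows "(LINT z|lborel. g z * strain_kernel z c $ i $ j) = 0"
proof -
  define m where "m a b = (LINT z|lborel. g z * (z $ a * z $ b))" for a b
  have m: "a \<noteq> b \<Longrightarrow> m a b = 0" "m a a = m b b" for a b
    unfolding m_def using radial_second_moments[OF g] by blast+
  have comp: "g z * strain_kernel z c $ i $ j = (\<Sum>a\<in>UNIV. cross3 (axis a 1) c $ i * (g z * (z $ a * z $ j)))
      + (\<Sum>a\<in>UNIV. cross3 (axis a 1) c $ j * (g z * (z $ a * z $ i)))" for z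
  proof -
    have "cross3 z c $ n = (\<Sum>a\<in>UNIV. cross3 (axis a 1) c $ n * z $ a)" for n
      using exhaust_3[of n] by (auto simp: sum_3 cross3_def axis_def)
    then show ?thesis
      by (simp add: strain_kernel_def outer_def sum_distrib_left sum_distrib_right algebra_simps)
  qed
  have s: "(\<Sum>a\<in>UNIV. cross3 (axis a 1) c $ i * m a j) = cross3 (axis j 1) c $ i * m 1 1" for i j
  proof -
    have "cross3 (axis a 1) c $ i * m a j = (if a = j then cross3 (axis j 1) c $ i * m 1 1 else 0)" for a
      using m(1)[of a j] m(2)[of j 1] by simp
    then show ?thesis by simp
  qed
  have "(LINT z|lborel. g z * strain_kernel z c $ i $ j) =
      (\<Sum>a\<in>UNIV. cross3 (axis a 1) c $ i * m a j) + (\<Sum>a\<in>UNIV. cross3 (axis a 1) c $ j * m a i)"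
    unfolding comp m_def using int by simp
  also have "\<dots> = (cross3 (axis j 1) c $ i + cross3 (axis i 1) c $ j) * m 1 1"
    unfolding s by (simp add: algebra_simps)
  also have "cross3 (axis j 1) c $ i + cross3 (axis i 1) c $ j = 0"
    using exhaust_3[of i] exhaust_3[of j] by (auto simp: cross3_def axis_def)
  finally show ?thesis by simp
qed

section \<open>Truncation, principal value and continuity of the near-field integral\<close>

locale radial_cutoff =
  fixes \<theta> :: "real^3 \<Rightarrow> real" and d :: real
  assumes \<theta>_test: "test_function (ball 0 1) \<theta>" and \<theta>_radial: "norm x = norm y \<Longrightarrow> \<theta> x = \<theta> y"
    and \<theta>_nonneg: "0 \<le> \<theta> x" and \<theta>_le1: "\<theta> x \<le> 1" and d_pos: "0 < d"
begin

definition weight :: "real^3 \<Rightarrow> real" where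
  "weight z = \<theta> (z /\<^sub>R d) / norm z ^ 3"

text \<open>The principal value with \<open>w x\<close> subtracted. For locally Lipschitz
  \<open>w\<close> the subtraction lowers the singularity from order 3 to order 2, which is
  integrable in three dimensions. The factor \<open>3 / (8 * pi)\<close> is applied later, in
  \<open>near\<close>.\<close>

definition strain_integral :: "(real^3 \<Rightarrow> real^3) \<Rightarrow> real^3 \<Rightarrow> real^3^3" where
  "strain_integral w x = (LINT z|lborel. weight z *\<^sub>R strain_kernel (sgn z) (w (x - z) - w x))"

lemma weight_bound: "\<bar>weight z\<bar> \<le> indicator (cball 0 d) z * inverse (norm z ^ 3)"
proof (cases "norm z \<le> d")
  case True
  then show ?thesis
    using \<theta>_nonneg[of "z /\<^sub>R d"] \<theta>_le1[of "z /\<^sub>R d"]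
    by (simp add: weight_def abs_mult divide_inverse mult_left_le_one_le)
next
  case False
  have "\<theta> y = 0" if "1 \<le> norm y" for y
  proof -
    have "{x. \<theta> x \<noteq> 0} \<subseteq> ball 0 1"
      using \<theta>_test closure_subset[of "{x. \<theta> x \<noteq> 0}"] unfolding test_function_def by blast
    with that show ?thesis by auto
  qed
  moreover have "1 \<le> norm (z /\<^sub>R d)"
    using False d_pos by (simp add: field_simps)
  ultimately show ?thesis
    by (simp add: weight_def)
qed

lemma weight_borel: "weight \<in> borel_measurable borel"
proof -
  have "continuous_on UNIV \<theta>"
    using \<theta>_test by (auto simp: test_function_def intro: smooth_on_imp_continuous)
  then have "continuous_on UNIV (\<lambda>z. \<theta> (z /\<^sub>R d))"
    by (rule continuous_on_compose2) (auto intro: continuous_intros)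
  then have m: "(\<lambda>z. \<theta> (z /\<^sub>R d)) \<in> borel_measurable borel"
    by (rule borel_measurable_continuous_onI)
  show ?thesis
    unfolding weight_def[abs_def]
    by (intro borel_measurable_divide m borel_measurable_power borel_measurable_norm)
qed

text \<open>The Lipschitz bound contributes one power of \<open>norm z\<close> against the cubic
  singularity of the weight. At the origin both sides are 0 by the convention for division by
  zero.\<close>

lemma kernel_bound:
  assumes "norm w \<le> L * norm z"
  shows "norm (weight z *\<^sub>R strain_kernel (sgn z) w) \<le> 2 * L * (indicator (cball 0 d) z * inverse ((norm z)\<^sup>2))"
proof (cases "z = 0")
  case True
  then show ?thesis by (simp add: weight_def)
next
  case False
  have "norm (weight z *\<^sub>R strain_kernel (sgn z) w) = \<bar>weight z\<bar> * norm (strain_kernel (sgn z) w)"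
    by simp
  also have "\<dots> \<le> (indicator (cball 0 d) z * inverse (norm z ^ 3)) * (2 * (L * norm z))"
  proof (intro mult_mono weight_bound)
    show "norm (strain_kernel (sgn z) w) \<le> 2 * (L * norm z)"
      using norm_strain_kernel_le[of "sgn z" w] assms False by (simp add: norm_sgn)
  qed auto
  also have "\<dots> = 2 * L * (indicator (cball 0 d) z * inverse ((norm z)\<^sup>2))"
    using False by (simp add: field_simps power2_eq_square power3_eq_cube)
  finally show ?thesis .
qed

lemma sgn_borel: "(sgn :: real^3 \<Rightarrow> real^3) \<in> borel_measurable borel"
proof -
  have "(sgn :: real^3 \<Rightarrow> real^3) = (\<lambda>z. inverse (norm z) *\<^sub>R z)"
    by (simp add: fun_eq_iff sgn_div_norm)
  moreover have "(\<lambda>z::real^3. inverse (norm z) *\<^sub>R z) \<in> borel_measurable borel"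
    by (intro borel_measurable_scaleR borel_measurable_inverse borel_measurable_norm) simp_all
  ultimately show ?thesis by simp
qed

lemma integrand_borel:
  assumes "w \<in> borel_measurable borel"
  shows "(\<lambda>z. weight z *\<^sub>R strain_kernel (sgn z) (w z)) \<in> borel_measurable borel"
  by (intro borel_measurable_scaleR weight_borel borel_strain_kernel sgn_borel assms)

lemma integrand_integrable:
  assumes w: "w \<in> borel_measurable borel" and le: "\<And>z. norm z \<le> d \<Longrightarrow> norm (w z) \<le> L * norm z"
  shows "integrable lborel (\<lambda>z. weight z *\<^sub>R strain_kernel (sgn z) (w z))"
    and "norm (weight z *\<^sub>R strain_kernel (sgn z) (w z)) \<le> 2 * L * (indicator (cball 0 d) z * inverse ((norm z)\<^sup>2))"
proof -
  show b: "norm (weight z *\<^sub>R strain_kernel (sgn z) (w z)) \<le> 2 * L * (indicator (cball 0 d) z * inverse ((norm z)\<^sup>2))" for z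
  proof (cases "norm z \<le> d")
    case True
    then show ?thesis by (intro kernel_bound le)
  next
    case False
    then show ?thesis using weight_bound[of z] by simp
  qed
  have "integrable lborel (\<lambda>z::real^3. 2 * L * (indicator (cball 0 d) z * inverse ((norm z)\<^sup>2)))"
    by (intro integrable_mult_right inverse_square_integrable d_pos)
  then show "integrable lborel (\<lambda>z. weight z *\<^sub>R strain_kernel (sgn z) (w z))"
  proof (rule Bochner_Integration.integrable_bound)
    show "(\<lambda>z. weight z *\<^sub>R strain_kernel (sgn z) (w z)) \<in> borel_measurable lborel"
      using integrand_borel[OF w] by simp
    show "AE z in lborel. norm (weight z *\<^sub>R strain_kernel (sgn z) (w z))
        \<le> norm (2 * L * (indicator (cball 0 d) z * inverse ((norm z)\<^sup>2)))"
      by (rule AE_I2, rule order_trans[OF b]) (simp only: real_norm_def abs_ge_self)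
  qed
qed

text \<open>Off the ball of radius \<open>e\<close> the weight is bounded by
  \<open>inverse (e ^ 3)\<close> and lives in a ball, so the integrand is integrable; its integral
  is zero because it is a radial function times a quadratic kernel.\<close>

lemma truncated_constant:
  assumes e: "0 < e"
  shows "integrable lborel (\<lambda>z. indicator {z. e < norm z} z *\<^sub>R (weight z *\<^sub>R strain_kernel (sgn z) c))"
    and "(LINT z|lborel. indicator {z. e < norm z} z *\<^sub>R (weight z *\<^sub>R strain_kernel (sgn z) c)) = 0"
proof -
  let ?i = "\<lambda>z::real^3. indicator {z. e < norm z} z :: real"
  have S: "{z::real^3. e < norm z} \<in> sets borel"
    by (intro borel_open open_Collect_less continuous_intros)
  have ib: "?i \<in> borel_measurable borel"
    using S by simp
  have cb: "integrable lborel (\<lambda>z::real^3. M * indicator (cball 0 d) z)" for M :: real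
    using emeasure_lborel_cball_finite[of "0::real^3" d]
    by (intro integrable_mult_right) (simp add: integrable_indicator_iff)
  have wle: "?i z * \<bar>weight z\<bar> \<le> inverse (e ^ 3) * indicator (cball 0 d) z" for z
  proof (cases "e < norm z")
    case True
    then have "inverse (norm z ^ 3) \<le> inverse (e ^ 3)"
      using e by (intro le_imp_inverse_le power_mono) auto
    then have "indicator (cball 0 d) z * inverse (norm z ^ 3) \<le> inverse (e ^ 3) * indicator (cball 0 d) z"
      by (cases "z \<in> cball 0 d") auto
    then show ?thesis
      using order_trans[OF weight_bound] True by simp
  qed (use e in simp)
  have sb: "(\<lambda>z. ?i z *\<^sub>R (weight z *\<^sub>R strain_kernel (sgn z) c)) \<in> borel_measurable borel"
    by (intro borel_measurable_scaleR[OF ib] integrand_borel borel_measurable_const)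
  show int: "integrable lborel (\<lambda>z. ?i z *\<^sub>R (weight z *\<^sub>R strain_kernel (sgn z) c))"
  proof (rule Bochner_Integration.integrable_bound[OF cb[of "inverse (e ^ 3) * (2 * norm c)"]])
    show "AE z in lborel. norm (?i z *\<^sub>R (weight z *\<^sub>R strain_kernel (sgn z) c))
        \<le> norm (inverse (e ^ 3) * (2 * norm c) * indicator (cball 0 d) z)"
    proof (rule AE_I2)
      fix z :: "real^3"
      have "norm (sgn z) \<le> 1" by (simp add: norm_sgn)
      then have "(norm (sgn z))\<^sup>2 \<le> 1" by (simp add: power_le_one)
      then have "norm (strain_kernel (sgn z) c) \<le> 2 * norm c"
        using norm_strain_kernel_le[of "sgn z" c] mult_right_mono[of "(norm (sgn z))\<^sup>2" 1 "norm c"] by simp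
      then have "(?i z * \<bar>weight z\<bar>) * norm (strain_kernel (sgn z) c)
          \<le> (inverse (e ^ 3) * indicator (cball 0 d) z) * (2 * norm c)"
        using e by (intro mult_mono wle) auto
      then show "norm (?i z *\<^sub>R (weight z *\<^sub>R strain_kernel (sgn z) c))
          \<le> norm (inverse (e ^ 3) * (2 * norm c) * indicator (cball 0 d) z)"
        using e by (simp add: abs_mult mult_ac)
    qed
  qed (use sb in simp)
  \<comment> \<open>The kernel at \<open>sgn z\<close> is the kernel at \<open>z\<close> divided by
    the square of \<open>norm z\<close>; \<open>g\<close> absorbs this factor and is radial together
    with the truncation and the cutoff.\<close>
  define g where "g z = ?i z * (weight z * inverse ((norm z)\<^sup>2))" for z
  have gb: "g \<in> borel_measurable borel"
    unfolding g_def[abs_def]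
    by (intro borel_measurable_times ib weight_borel borel_measurable_inverse borel_measurable_power borel_measurable_norm)
  have gr: "g x = g y" if "norm x = norm y" for x y
  proof -
    have "\<theta> (x /\<^sub>R d) = \<theta> (y /\<^sub>R d)"
      by (rule \<theta>_radial) (simp add: that)
    then show ?thesis
      using that by (simp add: g_def weight_def indicator_def)
  qed
  have gi: "integrable lborel (\<lambda>z. g z * (z $ a * z $ b))" for a b
  proof (rule Bochner_Integration.integrable_bound[OF cb[of "inverse (e ^ 3)"]])
    show "(\<lambda>z. g z * (z $ a * z $ b)) \<in> borel_measurable lborel"
      using borel_measurable_times[OF gb borel_measurable_times[OF vec_nth_borel vec_nth_borel]] by simp
    show "AE z in lborel. norm (g z * (z $ a * z $ b)) \<le> norm (inverse (e ^ 3) * indicator (cball 0 d) z)"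
    proof (rule AE_I2)
      fix z :: "real^3"
      have "\<bar>z $ a * z $ b\<bar> \<le> (norm z)\<^sup>2"
        unfolding abs_mult power2_eq_square by (intro mult_mono component_le_norm_cart) auto
      then have "inverse ((norm z)\<^sup>2) * \<bar>z $ a * z $ b\<bar> \<le> 1"
        by (cases "z = 0") (simp_all add: field_simps)
      then have "(?i z * \<bar>weight z\<bar>) * (inverse ((norm z)\<^sup>2) * \<bar>z $ a * z $ b\<bar>) \<le> (inverse (e ^ 3) * indicator (cball 0 d) z) * 1"
        using e by (intro mult_mono wle) auto
      then show "norm (g z * (z $ a * z $ b)) \<le> norm (inverse (e ^ 3) * indicator (cball 0 d) z)"
        using e by (simp add: g_def abs_mult mult_ac)
    qed
  qed
  have gs: "?i z *\<^sub>R (weight z *\<^sub>R strain_kernel (sgn z) c) = g z *\<^sub>R strain_kernel z c" for z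
    unfolding g_def sgn_div_norm strain_kernel_scale by (simp add: power_inverse)
  have "(LINT z|lborel. ?i z *\<^sub>R (weight z *\<^sub>R strain_kernel (sgn z) c)) $ i $ j = 0" for i j
  proof -
    have "(LINT z|lborel. g z *\<^sub>R strain_kernel z c) $ i $ j = (LINT z|lborel. g z * strain_kernel z c $ i $ j)"
      using integral_bounded_linear[OF bounded_linear_compose[OF bounded_linear_vec_nth[of j] bounded_linear_vec_nth[of i]], of lborel "\<lambda>z. g z *\<^sub>R strain_kernel z c"]
        int unfolding gs by simp
    also have "\<dots> = 0"
      by (rule radial_strain_kernel_integral[OF gb gr gi])
    finally show ?thesis unfolding gs .
  qed
  then show "(LINT z|lborel. ?i z *\<^sub>R (weight z *\<^sub>R strain_kernel (sgn z) c)) = 0"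
    by (simp add: vec_eq_iff)
qed

text \<open>For each positive truncation radius the constant vorticity \<open>w x\<close>
  contributes nothing and may be subtracted. What remains is dominated by a multiple of the inverse
  square, so the truncation can be removed in the limit.\<close>

lemma principal_value:
  assumes w: "continuous_on UNIV w" and lip: "\<And>z. norm z \<le> d \<Longrightarrow> norm (w (x - z) - w x) \<le> L * norm z"
  shows "((\<lambda>e. LINT z:{z. e < norm z}|lebesgue. (\<theta> (z /\<^sub>R d) / norm z ^ 3) *\<^sub>R
      (outer (cross3 (sgn z) (w (x - z))) (sgn z) + outer (sgn z) (cross3 (sgn z) (w (x - z)))))
    \<longlongrightarrow> strain_integral w x) (at_right 0)"
proof -
  have wb: "(\<lambda>z. w (x - z)) \<in> borel_measurable borel"
    by (intro borel_measurable_continuous_onI continuous_on_compose2[OF w] continuous_intros) auto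
  have db: "(\<lambda>z. w (x - z) - w x) \<in> borel_measurable borel"
    by (intro borel_measurable_diff wb borel_measurable_const)
  let ?D = "\<lambda>z. weight z *\<^sub>R strain_kernel (sgn z) (w (x - z) - w x)"
  note Dint = integrand_integrable[OF db lip]
  have S: "{z::real^3. e < norm z} \<in> sets borel" for e
    by (intro borel_open open_Collect_less continuous_intros)
  have eq: "(LINT z:{z. e < norm z}|lebesgue. (\<theta> (z /\<^sub>R d) / norm z ^ 3) *\<^sub>R
      (outer (cross3 (sgn z) (w (x - z))) (sgn z) + outer (sgn z) (cross3 (sgn z) (w (x - z)))))
    = (LINT z|lborel. indicator {z. e < norm z} z *\<^sub>R ?D z)" if e: "0 < e" for e
  proof -
    let ?i = "\<lambda>z::real^3. indicator {z. e < norm z} z :: real"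
    have ib: "?i \<in> borel_measurable borel"
      using S by simp
    have iD: "integrable lborel (\<lambda>z. ?i z *\<^sub>R ?D z)"
    proof (rule Bochner_Integration.integrable_bound[OF Dint(1)])
      show "(\<lambda>z. ?i z *\<^sub>R ?D z) \<in> borel_measurable lborel"
        using borel_measurable_scaleR[OF ib integrand_borel[OF db]] by simp
    qed (auto simp: indicator_def)
    have bm: "(\<lambda>z. ?i z *\<^sub>R (weight z *\<^sub>R strain_kernel (sgn z) (w (x - z)))) \<in> borel_measurable lborel"
      using borel_measurable_scaleR[OF ib integrand_borel[OF wb]] by simp
    have "(LINT z:{z. e < norm z}|lebesgue. (\<theta> (z /\<^sub>R d) / norm z ^ 3) *\<^sub>R
        (outer (cross3 (sgn z) (w (x - z))) (sgn z) + outer (sgn z) (cross3 (sgn z) (w (x - z)))))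
      = (LINT z|lborel. ?i z *\<^sub>R (weight z *\<^sub>R strain_kernel (sgn z) (w (x - z))))"
      unfolding set_lebesgue_integral_def weight_def[symmetric] strain_kernel_def[symmetric]
      by (rule integral_completion[OF bm])
    also have "\<dots> = (LINT z|lborel. ?i z *\<^sub>R ?D z + ?i z *\<^sub>R (weight z *\<^sub>R strain_kernel (sgn z) (w x)))"
      by (simp add: strain_kernel_diff algebra_simps)
    also have "\<dots> = (LINT z|lborel. ?i z *\<^sub>R ?D z)"
      using Bochner_Integration.integral_add[OF iD truncated_constant(1)[OF e, of "w x"]] truncated_constant(2)[OF e, of "w x"]
      by simp
    finally show ?thesis .
  qed
  have lim: "((\<lambda>e. LINT z|lborel. indicator {z. e < norm z} z *\<^sub>R ?D z) \<longlongrightarrow> strain_integral w x) (at_right 0)"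
    unfolding tendsto_at_iff_sequentially comp_def
  proof (intro allI impI)
    fix X :: "nat \<Rightarrow> real"
    assume X: "\<forall>i. X i \<in> {0<..} - {0}" "X \<longlonglongrightarrow> 0"
    show "(\<lambda>n. LINT z|lborel. indicator {z. X n < norm z} z *\<^sub>R ?D z) \<longlonglongrightarrow> strain_integral w x"
      unfolding strain_integral_def
    proof (rule integral_dominated_convergence)
      show "integrable lborel (\<lambda>z::real^3. 2 * L * (indicator (cball 0 d) z * inverse ((norm z)\<^sup>2)))"
        by (intro integrable_mult_right inverse_square_integrable d_pos)
      show "?D \<in> borel_measurable lborel"
        using integrand_borel[OF db] by simp
      show "(\<lambda>z. indicator {z. X n < norm z} z *\<^sub>R ?D z) \<in> borel_measurable lborel" for n
        using borel_measurable_scaleR[OF borel_measurable_indicator[OF S] integrand_borel[OF db]] by simp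
      show "AE z in lborel. (\<lambda>n. indicator {z. X n < norm z} z *\<^sub>R ?D z) \<longlonglongrightarrow> ?D z"
      proof (rule AE_I2)
        fix z :: "real^3"
        show "(\<lambda>n. indicator {z. X n < norm z} z *\<^sub>R ?D z) \<longlonglongrightarrow> ?D z"
        \<comment> \<open>At the origin every term is zero since \<open>weight 0 = 0\<close>; at any
          other \<open>z\<close> the truncation is eventually inactive.\<close>
        proof (cases "z = 0")
          case True
          then show ?thesis by (simp add: weight_def)
        next
          case False
          then have "eventually (\<lambda>n. X n < norm z) sequentially"
            using order_tendstoD(2)[OF X(2), of "norm z"] by simp
          then have "eventually (\<lambda>n. indicator {z. X n < norm z} z *\<^sub>R ?D z = ?D z) sequentially"
            by eventually_elim simp
          then show ?thesis by (rule tendsto_eventually)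
        qed
      qed
      show "AE z in lborel. norm (indicator {z. X n < norm z} z *\<^sub>R ?D z)
          \<le> 2 * L * (indicator (cball 0 d) z * inverse ((norm z)\<^sup>2))" for n
      proof (rule AE_I2)
        fix z :: "real^3"
        have "norm (indicator {z. X n < norm z} z *\<^sub>R ?D z) \<le> norm (?D z)"
          by (simp add: indicator_def)
        then show "norm (indicator {z. X n < norm z} z *\<^sub>R ?D z)
          \<le> 2 * L * (indicator (cball 0 d) z * inverse ((norm z)\<^sup>2))"
          using Dint(2)[of z] by (rule order_trans)
      qed
    qed
  qed
  have "eventually (\<lambda>e. 0 < e) (at_right (0::real))"
    by (rule eventually_at_right_less)
  then have "eventually (\<lambda>e. (LINT z|lborel. indicator {z. e < norm z} z *\<^sub>R ?D z)
    = (LINT z:{z. e < norm z}|lebesgue. (\<theta> (z /\<^sub>R d) / norm z ^ 3) *\<^sub>R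
      (outer (cross3 (sgn z) (w (x - z))) (sgn z) + outer (sgn z) (cross3 (sgn z) (w (x - z)))))) (at_right 0)"
    by eventually_elim (simp only: eq)
  from Lim_transform_eventually[OF lim this] show ?thesis .
qed

text \<open>Dominated convergence along sequences of space-time points; the Lipschitz constant on
  balls is uniform in time, so one multiple of the inverse square dominates all integrands.\<close>

lemma strain_integral_continuous:
  fixes w :: "real^3 \<Rightarrow> real \<Rightarrow> real^3"
  assumes w: "continuous_on (UNIV \<times> {a..b}) (\<lambda>(x, t). w x t)"
    and lip: "\<And>r. \<exists>L. \<forall>t\<in>{a..b}. \<forall>x\<in>cball 0 r. \<forall>y\<in>cball 0 r. norm (w x t - w y t) \<le> L * norm (x - y)"
  shows "continuous_on (UNIV \<times> {a..b}) (\<lambda>(x, t). strain_integral (\<lambda>y. w y t) x)"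
  unfolding continuous_on_sequentially
proof (intro ballI allI impI)
  fix Z :: "nat \<Rightarrow> (real^3) \<times> real" and z0
  assume z0: "z0 \<in> UNIV \<times> {a..b}" and Z: "(\<forall>n. Z n \<in> UNIV \<times> {a..b}) \<and> Z \<longlonglongrightarrow> z0"
  define X where "X n = fst (Z n)" for n
  define \<tau> where "\<tau> n = snd (Z n)" for n
  define x where "x = fst z0"
  define t where "t = snd z0"
  have lim: "X \<longlonglongrightarrow> x" "\<tau> \<longlonglongrightarrow> t"
    unfolding X_def[abs_def] \<tau>_def[abs_def] x_def t_def using Z by (auto intro: tendsto_fst tendsto_snd)
  have t: "t \<in> {a..b}" "\<And>n. \<tau> n \<in> {a..b}"
    using z0 Z by (auto simp: t_def \<tau>_def mem_Times_iff)
  obtain r where r: "\<And>n. norm (X n) \<le> r"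
    using convergent_imp_bounded[OF lim(1)] unfolding bounded_iff by auto
  \<comment> \<open>The radius \<open>r + d\<close> covers all points \<open>X n - z\<close> with
    \<open>norm z \<le> d\<close>, the only \<open>z\<close> at which the weight can be
    nonzero.\<close>
  obtain L where L: "\<And>t x y. t \<in> {a..b} \<Longrightarrow> x \<in> cball 0 (r + d) \<Longrightarrow> y \<in> cball 0 (r + d)
      \<Longrightarrow> norm (w x t - w y t) \<le> L * norm (x - y)"
    using lip[of "r + d"] by blast
  have wlim: "(\<lambda>n. w (X n - z) (\<tau> n)) \<longlonglongrightarrow> w (x - z) t" for z
  proof -
    have "(\<lambda>n. (X n - z, \<tau> n)) \<longlonglongrightarrow> (x - z, t)"
      by (intro tendsto_intros lim)
    from continuous_on_tendsto_compose[OF w this] show ?thesis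
      using t by simp
  qed
  have wb: "(\<lambda>z. w (y - z) s - w y s) \<in> borel_measurable borel" if "s \<in> {a..b}" for y s
  proof -
    have "continuous_on UNIV (\<lambda>z. (\<lambda>(x, t). w x t) (y - z, s))"
      by (rule continuous_on_compose2[OF w]) (use that in \<open>auto intro!: continuous_intros\<close>)
    then have "continuous_on UNIV (\<lambda>z. w (y - z) s - w y s)"
      by (intro continuous_intros) simp
    then show ?thesis by (rule borel_measurable_continuous_onI)
  qed
  have "(\<lambda>n. strain_integral (\<lambda>y. w y (\<tau> n)) (X n)) \<longlonglongrightarrow> strain_integral (\<lambda>y. w y t) x"
    unfolding strain_integral_def
  proof (rule integral_dominated_convergence)
    show "integrable lborel (\<lambda>z::real^3. 2 * L * (indicator (cball 0 d) z * inverse ((norm z)\<^sup>2)))"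
      by (intro integrable_mult_right inverse_square_integrable d_pos)
    show "(\<lambda>z. weight z *\<^sub>R strain_kernel (sgn z) (w (x - z) t - w x t)) \<in> borel_measurable lborel"
      using integrand_borel[OF wb[OF t(1)]] by simp
    show "(\<lambda>z. weight z *\<^sub>R strain_kernel (sgn z) (w (X n - z) (\<tau> n) - w (X n) (\<tau> n))) \<in> borel_measurable lborel" for n
      using integrand_borel[OF wb[OF t(2)]] by simp
    show "AE z in lborel. (\<lambda>n. weight z *\<^sub>R strain_kernel (sgn z) (w (X n - z) (\<tau> n) - w (X n) (\<tau> n)))
        \<longlonglongrightarrow> weight z *\<^sub>R strain_kernel (sgn z) (w (x - z) t - w x t)"
    proof (rule AE_I2)
      fix z :: "real^3"
      have "(\<lambda>n. (sgn z, w (X n - z) (\<tau> n) - w (X n) (\<tau> n))) \<longlonglongrightarrow> (sgn z, w (x - z) t - w x t)"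
        using wlim[of z] wlim[of 0] by (intro tendsto_intros) simp_all
      from continuous_on_tendsto_compose[OF continuous_strain_kernel this]
      show "(\<lambda>n. weight z *\<^sub>R strain_kernel (sgn z) (w (X n - z) (\<tau> n) - w (X n) (\<tau> n)))
        \<longlonglongrightarrow> weight z *\<^sub>R strain_kernel (sgn z) (w (x - z) t - w x t)"
        by (intro tendsto_intros) simp
    qed
    show "AE z in lborel. norm (weight z *\<^sub>R strain_kernel (sgn z) (w (X n - z) (\<tau> n) - w (X n) (\<tau> n)))
        \<le> 2 * L * (indicator (cball 0 d) z * inverse ((norm z)\<^sup>2))" for n
    proof (rule AE_I2)
      fix z
      show "norm (weight z *\<^sub>R strain_kernel (sgn z) (w (X n - z) (\<tau> n) - w (X n) (\<tau> n)))
        \<le> 2 * L * (indicator (cball 0 d) z * inverse ((norm z)\<^sup>2))"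
      proof (rule integrand_integrable(2)[OF wb[OF t(2)]])
        fix y :: "real^3" assume y: "norm y \<le> d"
        have "norm (X n - y) \<le> r + d"
          using norm_triangle_ineq4[of "X n" y] r[of n] y by simp
        then show "norm (w (X n - y) (\<tau> n) - w (X n) (\<tau> n)) \<le> L * norm y"
          using L[OF t(2)[of n], of "X n - y" "X n"] r[of n] d_pos by simp
      qed
    qed
  qed
  then show "((\<lambda>(x, t). strain_integral (\<lambda>y. w y t) x) \<circ> Z) \<longlonglongrightarrow> (\<lambda>(x, t). strain_integral (\<lambda>y. w y t) x) z0"
    by (simp add: comp_def case_prod_unfold X_def \<tau>_def x_def t_def)
qed

end

section \<open>Componentwise calculus\<close>

text \<open>Embedding one entry as a bounded linear map lets derivatives and integrals of vector
  fields be assembled from their components. The entries may themselves be vectors, so two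
  applications treat matrix fields.\<close>

lemma bounded_linear_axis: "bounded_linear (\<lambda>y::'b::real_normed_vector. axis i y :: 'b^'n)"
proof (rule bounded_linear_intro[where K=1])
  show "norm (axis i y :: 'b^'n) \<le> norm y * 1" for y
  proof -
    have "norm (axis i y :: 'b^'n) \<le> (\<Sum>j\<in>UNIV. norm ((axis i y :: 'b^'n) $ j))"
      unfolding norm_vec_def by (rule L2_set_le_sum) simp
    also have "\<dots> = (\<Sum>j\<in>UNIV. if j = i then norm y else 0)"
      by (rule sum.cong) (auto simp: axis_def)
    finally show ?thesis by simp
  qed
qed (auto simp: vec_eq_iff axis_def)

lemma vec_sum_axis: "(\<Sum>i\<in>UNIV. axis i (f $ i)) = (f :: 'b::real_normed_vector^'n)"
proof -
  have "(\<Sum>i\<in>UNIV. axis i (f $ i)) $ j = f $ j" for j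
  proof -
    have "(\<Sum>i\<in>UNIV. axis i (f $ i)) $ j = (\<Sum>i\<in>UNIV. if i = j then f $ j else 0)"
      unfolding sum_component by (rule sum.cong) (auto simp: axis_def)
    then show ?thesis by simp
  qed
  then show ?thesis by (simp add: vec_eq_iff)
qed

lemma integral_vec_nth:
  fixes f :: "'a \<Rightarrow> 'b::euclidean_space^'n"
  assumes "\<And>i. integrable M (\<lambda>x. f x $ i)"
  shows "integrable M f" "(LINT x|M. f x) $ i = (LINT x|M. f x $ i)"
proof -
  have "integrable M (\<lambda>x. \<Sum>i\<in>UNIV. axis i (f x $ i))"
    by (intro Bochner_Integration.integrable_sum integrable_bounded_linear[OF bounded_linear_axis] assms)
  then show 1: "integrable M f"
    by (simp add: vec_sum_axis)
  show "(LINT x|M. f x) $ i = (LINT x|M. f x $ i)"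
    by (rule integral_bounded_linear[OF bounded_linear_vec_nth 1, symmetric])
qed

lemma has_derivative_vecI:
  fixes f :: "'a::real_normed_vector \<Rightarrow> 'b::real_normed_vector^'n"
  assumes "\<And>i. ((\<lambda>x. f x $ i) has_derivative f' i) F"
  shows "(f has_derivative (\<lambda>h. \<chi> i. f' i h)) F"
proof -
  have "((\<lambda>x. \<Sum>i\<in>UNIV. axis i (f x $ i)) has_derivative (\<lambda>h. \<Sum>i\<in>UNIV. axis i (f' i h))) F"
    by (intro has_derivative_sum bounded_linear.has_derivative[OF bounded_linear_axis] assms)
  moreover have "(\<lambda>h. \<Sum>i\<in>UNIV. axis i (f' i h)) = (\<lambda>h. \<chi> i. f' i h)"
    using vec_sum_axis[of "\<chi> i. f' i _"] by (auto simp: fun_eq_iff)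
  ultimately show ?thesis
    by (simp add: vec_sum_axis)
qed

lemma pd_vec_nth:
  fixes f :: "real^3 \<Rightarrow> 'b::real_normed_vector^'n"
  assumes "\<And>i. (\<lambda>y. f y $ i) differentiable (at x)"
  shows "f differentiable (at x)" "pd j f x $ i = pd j (\<lambda>y. f y $ i) x"
proof -
  have d: "((\<lambda>y. f y $ i) has_derivative frechet_derivative (\<lambda>y. f y $ i) (at x)) (at x)" for i
    using assms frechet_derivative_works by blast
  from has_derivative_vecI[OF d]
  have f: "(f has_derivative (\<lambda>h. \<chi> i. frechet_derivative (\<lambda>y. f y $ i) (at x) h)) (at x)" .
  then show "f differentiable (at x)"
    by (rule differentiableI)
  show "pd j f x $ i = pd j (\<lambda>y. f y $ i) x"
    using pd_eqI[OF f, of j] by (simp add: pd_def)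
qed

lemma has_derivative_pd:
  fixes f :: "real^3 \<Rightarrow> 'b::real_normed_vector"
  assumes "f differentiable (at x)"
  shows "(f has_derivative (\<lambda>h. \<Sum>i\<in>UNIV. h $ i *\<^sub>R pd i f x)) (at x)"
proof -
  have "(f has_derivative frechet_derivative f (at x)) (at x)"
    using assms frechet_derivative_works by blast
  from this has_derivative_vec_expand[OF this] show ?thesis
    unfolding pd_def by simp
qed

section \<open>Rules for partial derivatives\<close>

lemma pd_add:
  fixes f g :: "real^3 \<Rightarrow> 'b::real_normed_vector"
  assumes "f differentiable (at x)" "g differentiable (at x)"
  shows "pd i (\<lambda>y. f y + g y) x = pd i f x + pd i g x"
  by (subst pd_eqI[OF has_derivative_add[OF has_derivative_pd[OF assms(1)] has_derivative_pd[OF assms(2)]]])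
     (simp only: sum_axis_scaleR)

lemma pd_diff:
  fixes f g :: "real^3 \<Rightarrow> 'b::real_normed_vector"
  assumes "f differentiable (at x)" "g differentiable (at x)"
  shows "pd i (\<lambda>y. f y - g y) x = pd i f x - pd i g x"
  by (subst pd_eqI[OF has_derivative_diff[OF has_derivative_pd[OF assms(1)] has_derivative_pd[OF assms(2)]]])
     (simp only: sum_axis_scaleR)

lemma pd_mult:
  fixes f g :: "real^3 \<Rightarrow> real"
  assumes "f differentiable (at x)" "g differentiable (at x)"
  shows "pd i (\<lambda>y. f y * g y) x = pd i f x * g x + f x * pd i g x"
  using pd_eqI[OF has_derivative_mult[OF has_derivative_pd[OF assms(1)] has_derivative_pd[OF assms(2)]], of i]
  by (simp only: sum_axis_scaleR add.commute)

lemma pd_sum: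
  fixes f :: "'a \<Rightarrow> real^3 \<Rightarrow> 'b::real_normed_vector"
  assumes "finite A" "\<And>j. j \<in> A \<Longrightarrow> f j differentiable (at x)"
  shows "pd i (\<lambda>y. \<Sum>j\<in>A. f j y) x = (\<Sum>j\<in>A. pd i (f j) x)"
proof -
  have "((\<lambda>y. \<Sum>j\<in>A. f j y) has_derivative (\<lambda>h. \<Sum>j\<in>A. \<Sum>i\<in>UNIV. h $ i *\<^sub>R pd i (f j) x)) (at x)"
    by (intro has_derivative_sum has_derivative_pd assms)
  from pd_eqI[OF this, of i] show ?thesis
    by (simp only: sum_axis_scaleR)
qed

section \<open>Continuously differentiable functions on space\<close>

text \<open>Expressed through \<open>pd\<close>, the operator in which the filtered quantities, the
  flux and the differential operators of the statement are all written.\<close>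

definition C1 :: "(real^3 \<Rightarrow> real) \<Rightarrow> bool" where
  "C1 f \<longleftrightarrow> (\<forall>x. f differentiable (at x)) \<and> (\<forall>j. continuous_on UNIV (pd j f))"

lemma C1D:
  assumes "C1 f"
  shows "f differentiable (at x)" "continuous_on UNIV (pd j f)" "continuous_on UNIV f"
  using assms unfolding C1_def
  by (auto intro!: differentiable_imp_continuous_on simp: differentiable_on_def)

lemma C1_add: "C1 f \<Longrightarrow> C1 g \<Longrightarrow> C1 (\<lambda>x. f x + g x)"
proof -
  assume f: "C1 f" and g: "C1 g"
  have "pd j (\<lambda>x. f x + g x) = (\<lambda>x. pd j f x + pd j g x)" for j
    by (rule ext) (intro pd_add C1D f g)
  with f g show ?thesis
    unfolding C1_def by (auto intro: continuous_intros)
qed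

lemma C1_diff: "C1 f \<Longrightarrow> C1 g \<Longrightarrow> C1 (\<lambda>x. f x - g x)"
proof -
  assume f: "C1 f" and g: "C1 g"
  have "pd j (\<lambda>x. f x - g x) = (\<lambda>x. pd j f x - pd j g x)" for j
    by (rule ext) (intro pd_diff C1D f g)
  with f g show ?thesis
    unfolding C1_def by (auto intro: continuous_intros)
qed

lemma C1_mult: "C1 f \<Longrightarrow> C1 g \<Longrightarrow> C1 (\<lambda>x. f x * g x)"
proof -
  assume f: "C1 f" and g: "C1 g"
  have "pd j (\<lambda>x. f x * g x) = (\<lambda>x. pd j f x * g x + f x * pd j g x)" for j
    by (rule ext) (intro pd_mult C1D f g)
  moreover have "continuous_on UNIV (\<lambda>x. pd j f x * g x + f x * pd j g x)" for j
    by (intro continuous_intros C1D f g)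
  moreover have "(\<lambda>x. f x * g x) differentiable (at x)" for x
    by (intro differentiable_mult C1D f g)
  ultimately show ?thesis
    unfolding C1_def by simp
qed

lemma C1_const: "C1 (\<lambda>_. c)"
proof -
  have "pd j (\<lambda>_. c) = (\<lambda>_. 0)" for j
    by (rule ext) (rule pd_eqI[OF has_derivative_const])
  then show ?thesis
    by (simp add: C1_def)
qed

lemma C1_sum: "finite A \<Longrightarrow> (\<And>j. j \<in> A \<Longrightarrow> C1 (f j)) \<Longrightarrow> C1 (\<lambda>x. \<Sum>j\<in>A. f j x)"
  by (induction A rule: finite_induct) (auto intro: C1_const C1_add)

text \<open>A partial derivative is the convolution with \<open>pd i k\<close>, again a test kernel,
  so it is differentiable and in particular continuous.\<close>

lemma C1_convolution:
  fixes k f :: "real^3 \<Rightarrow> real"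
  assumes k: "test_function UNIV k" and f: "\<And>R. set_integrable lebesgue (cball 0 R) f"
  shows "C1 (convolution k f)"
proof -
  have d: "convolution k f differentiable (at x)" if "test_function UNIV k" for k x
    by (rule differentiableI[OF convolution_has_derivative[OF that f]])
  show ?thesis
    unfolding C1_def pd_convolution[OF k f] using d[OF k] d[OF test_function_pd[OF k]]
    by (auto intro!: differentiable_imp_continuous_on simp: differentiable_on_def)
qed

lemma integral_pd_C1:
  assumes h: "C1 h" and supp: "\<And>x. R < norm x \<Longrightarrow> h x = 0"
  shows "integrable lebesgue (pd i h)" "(LINT x|lebesgue. pd i h x) = 0"
proof -
  have der: "(h has_derivative (\<lambda>v. v \<bullet> (\<chi> i. pd i h x))) (at x)" for x
    using has_derivative_pd[OF C1D(1)[OF h]] by (simp add: inner_vec_def)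
  have c: "continuous_on UNIV (\<lambda>x. \<chi> i. pd i h x)"
    by (intro continuous_on_vec_lambda C1D(2)[OF h])
  show "integrable lebesgue (pd i h)" "(LINT x|lebesgue. pd i h x) = 0"
    using integral_pd_compact_support[OF der c supp, where i=i] by auto
qed

section \<open>Smooth functions on a slab\<close>

text \<open>A case distinction suffices: the derivative of \<open>f\<close> within \<open>S\<close>
  serves for \<open>g\<close> unchanged, so the lower orders are inherited verbatim.\<close>

lemma Ck_on_cong:
  assumes "Ck_on k S f" "\<And>x. x \<in> S \<Longrightarrow> f x = g x"
  shows "Ck_on k S g"
proof (cases k)
  case 0
  then show ?thesis using assms continuous_on_cong[of S S f g] by simp
next
  case (Suc j)
  then obtain f' where f': "\<forall>x\<in>S. (f has_derivative f' x) (at x within S)" "\<forall>v. Ck_on j S (\<lambda>x. f' x v)"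
    using assms(1) by auto
  have "(g has_derivative f' x) (at x within S)" if "x \<in> S" for x
    by (rule has_derivative_transform[OF that _ bspec[OF f'(1) that]]) (simp add: assms(2))
  with f'(2) show ?thesis
    unfolding Suc Ck_on.simps by blast
qed

text \<open>The whole slice at time \<open>t\<close> lies in the slab, so the derivative within the
  slab gives a full spatial derivative even at an end time.\<close>

lemma slab_space_derivative:
  fixes f :: "(real^3) \<times> real \<Rightarrow> real"
  assumes der: "(f has_derivative f') (at (x, t) within UNIV \<times> I)" and t: "t \<in> I"
  shows "((\<lambda>y. f (y, t)) has_derivative (\<lambda>h. f' (h, 0))) (at x)"
proof -
  have "((\<lambda>y. f (y, t)) has_derivative (\<lambda>h. f' (h, 0))) (at x within UNIV)"
  proof (rule has_derivative_in_compose[where f="\<lambda>y. (y, t)" and f'="\<lambda>h. (h, 0)" and g=f and g'=f'])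
    show "((\<lambda>y. (y, t)) has_derivative (\<lambda>h. (h, 0))) (at x within UNIV)"
      by (intro derivative_intros)
    show "(f has_derivative f') (at (x, t) within (\<lambda>y. (y, t)) ` UNIV)"
      by (rule has_derivative_subset[OF der]) (use t in auto)
  qed
  then show ?thesis by simp
qed

text \<open>The spatial partial derivative is the slab derivative in the direction
  \<open>(axis j 1, 0)\<close>. The result is smooth on the slab again, so second derivatives follow
  by a second application.\<close>

lemma smooth_slab_pd:
  fixes f :: "(real^3) \<times> real \<Rightarrow> real"
  assumes f: "smooth_on (UNIV \<times> I) f"
  shows "t \<in> I \<Longrightarrow> (\<lambda>y. f (y, t)) differentiable (at x)"
    and "smooth_on (UNIV \<times> I) (\<lambda>z. pd j (\<lambda>y. f (y, snd z)) (fst z))"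
proof -
  have *: "\<exists>f'. (\<forall>z\<in>UNIV \<times> I. (f has_derivative f' z) (at z within UNIV \<times> I)) \<and> (\<forall>v. Ck_on k (UNIV \<times> I) (\<lambda>z. f' z v))" for k
    using f[unfolded smooth_on_def, rule_format, of "Suc k"] by auto
  show "(\<lambda>y. f (y, t)) differentiable (at x)" if "t \<in> I"
  proof -
    obtain f' where "\<forall>z\<in>UNIV \<times> I. (f has_derivative f' z) (at z within UNIV \<times> I)"
      using *[of 0] by blast
    then have "(f has_derivative f' (x, t)) (at (x, t) within UNIV \<times> I)"
      using that by auto
    from slab_space_derivative[OF this that] show ?thesis
      by (rule differentiableI)
  qed
  show "smooth_on (UNIV \<times> I) (\<lambda>z. pd j (\<lambda>y. f (y, snd z)) (fst z))"
    unfolding smooth_on_def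
  proof
    fix k
    obtain f' where f': "\<forall>z\<in>UNIV \<times> I. (f has_derivative f' z) (at z within UNIV \<times> I)"
      "\<forall>v. Ck_on k (UNIV \<times> I) (\<lambda>z. f' z v)"
      using *[of k] by blast
    show "Ck_on k (UNIV \<times> I) (\<lambda>z. pd j (\<lambda>y. f (y, snd z)) (fst z))"
    proof (rule Ck_on_cong)
      show "Ck_on k (UNIV \<times> I) (\<lambda>z. f' z (axis j 1, 0))"
        using f'(2) by blast
      fix z assume z: "z \<in> (UNIV :: (real^3) set) \<times> I"
      then have "(f has_derivative f' (fst z, snd z)) (at (fst z, snd z) within UNIV \<times> I)" "snd z \<in> I"
        using f'(1) by auto
      from pd_eqI[OF slab_space_derivative[OF this], of j]
      show "f' z (axis j 1, 0) = pd j (\<lambda>y. f (y, snd z)) (fst z)"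
        by simp
    qed
  qed
qed

text \<open>Derivatives are taken within the closed interval, hence one-sided at its ends;
  \<open>a < b\<close> makes them unique, so that \<open>vector_derivative\<close> agrees with the
  slab derivative in direction \<open>(0, 1)\<close>.\<close>

lemma smooth_slab_time:
  fixes f :: "(real^3) \<times> real \<Rightarrow> real"
  assumes f: "smooth_on (UNIV \<times> {a..b}) f" and ab: "a < b"
  shows "t \<in> {a..b} \<Longrightarrow> ((\<lambda>s. f (x, s)) has_vector_derivative
      vector_derivative (\<lambda>s. f (x, s)) (at t within {a..b})) (at t within {a..b})"
    and "continuous_on (UNIV \<times> {a..b}) (\<lambda>z. vector_derivative (\<lambda>s. f (fst z, s)) (at (snd z) within {a..b}))"
proof -
  let ?S = "(UNIV :: (real^3) set) \<times> {a..b}"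
  obtain f' where f': "\<forall>z\<in>?S. (f has_derivative f' z) (at z within ?S)"
      "\<forall>v. Ck_on 0 ?S (\<lambda>z. f' z v)"
    using f[unfolded smooth_on_def, rule_format, of "Suc 0"] by auto
  have der: "((\<lambda>s. f (x, s)) has_vector_derivative f' (x, t) (0, 1)) (at t within {a..b})"
    if t: "t \<in> {a..b}" for x t
  proof -
    have d: "(f has_derivative f' (x, t)) (at (x, t) within ?S)"
      using f'(1) t by auto
    have "((\<lambda>s. f (x, s)) has_derivative (\<lambda>h. f' (x, t) (0, h))) (at t within {a..b})"
    proof (rule has_derivative_in_compose[where f="\<lambda>s. (x, s)" and f'="\<lambda>h. (0, h)" and g=f and g'="f' (x, t)"])
      show "((\<lambda>s. (x, s)) has_derivative (\<lambda>h. (0, h))) (at t within {a..b})"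
        by (intro derivative_intros)
      show "(f has_derivative f' (x, t)) (at (x, t) within (\<lambda>s. (x, s)) ` {a..b})"
        by (rule has_derivative_subset[OF d]) auto
    qed
    moreover have fe: "(\<lambda>h. f' (x, t) (0, h)) = (\<lambda>h. h *\<^sub>R f' (x, t) (0, 1))"
    proof
      show "f' (x, t) (0, h) = h *\<^sub>R f' (x, t) (0, 1)" for h
        using linear_cmul[OF has_derivative_linear[OF d], of h "(0, 1)"] by simp
    qed
    ultimately show ?thesis
      unfolding has_vector_derivative_def fe by blast
  qed
  have eq: "vector_derivative (\<lambda>s. f (x, s)) (at t within {a..b}) = f' (x, t) (0, 1)" if "t \<in> {a..b}" for x t
    by (rule vector_derivative_within_closed_interval[OF ab that der[OF that]])
  show "((\<lambda>s. f (x, s)) has_vector_derivative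
      vector_derivative (\<lambda>s. f (x, s)) (at t within {a..b})) (at t within {a..b})" if "t \<in> {a..b}"
    unfolding eq[OF that] by (rule der[OF that])
  have "continuous_on ?S (\<lambda>z. f' z (0, 1))"
    using f'(2) by simp
  then show "continuous_on ?S (\<lambda>z. vector_derivative (\<lambda>s. f (fst z, s)) (at (snd z) within {a..b}))"
  proof (rule continuous_on_eq)
    fix z assume "z \<in> ?S"
    then have "snd z \<in> {a..b}" by auto
    from eq[OF this, of "fst z"]
    show "f' z (0, 1) = vector_derivative (\<lambda>s. f (fst z, s)) (at (snd z) within {a..b})"
      by simp
  qed
qed

section \<open>Integration over a space-time slab\<close>

lemma slab_continuous_slice:
  fixes f :: "(real^3) \<times> real \<Rightarrow> 'b::real_normed_vector"
  assumes "continuous_on (UNIV \<times> I) f" "t \<in> I"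
  shows "continuous_on UNIV (\<lambda>x. f (x, t))"
  by (rule continuous_on_compose2[OF assms(1)]) (use assms(2) in \<open>auto intro!: continuous_intros\<close>)

lemma slab_bound:
  fixes f :: "(real^3) \<times> real \<Rightarrow> real"
  assumes f: "continuous_on (UNIV \<times> {a..b}) f"
    and supp: "\<And>x t. t \<in> {a..b} \<Longrightarrow> R < norm x \<Longrightarrow> f (x, t) = 0"
  shows "\<exists>M\<ge>0. \<forall>t\<in>{a..b}. \<forall>x. \<bar>f (x, t)\<bar> \<le> M * indicator (cball 0 R) x"
proof -
  have "compact (f ` (cball 0 R \<times> {a..b}))"
    by (intro compact_continuous_image continuous_on_subset[OF f] compact_Times) auto
  then have "bounded (f ` (cball 0 R \<times> {a..b}))"
    by (rule compact_imp_bounded)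
  then obtain M where M: "\<forall>z\<in>cball 0 R \<times> {a..b}. \<bar>f z\<bar> \<le> M"
    unfolding bounded_iff by auto
  have "\<bar>f (x, t)\<bar> \<le> max M 0 * indicator (cball 0 R) x" if "t \<in> {a..b}" for x t
  proof (cases "norm x \<le> R")
    case True
    then have "(x, t) \<in> cball 0 R \<times> {a..b}" using that by simp
    with M True show ?thesis by (auto simp: le_max_iff_disj)
  qed (use supp[OF that] in auto)
  then show ?thesis
    by (intro exI[of _ "max M 0"]) auto
qed

text \<open>The shape of \<open>f\<close> anticipates the time derivative of the weighted enstrophy
  density: \<open>A\<close> collects what is continuous, and each \<open>q i\<close> is a quadratic
  quantity, Borel and bounded only for almost every time, multiplied by a continuous compactly
  supported \<open>G i\<close>.\<close>

lemma slab_fubini: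
  fixes A :: "(real^3) \<times> real \<Rightarrow> real" and G q :: "3 \<Rightarrow> (real^3) \<times> real \<Rightarrow> real"
  assumes A: "continuous_on (UNIV \<times> {a..b}) A" "\<And>x t. t \<in> {a..b} \<Longrightarrow> R < norm x \<Longrightarrow> A (x, t) = 0"
    and G: "\<And>i. continuous_on (UNIV \<times> {a..b}) (G i)" "\<And>i x t. t \<in> {a..b} \<Longrightarrow> R < norm x \<Longrightarrow> G i (x, t) = 0"
    and q: "\<And>i. q i \<in> borel_measurable borel"
      "\<And>i. \<exists>M. AE t in lborel. t \<in> {a..b} \<longrightarrow> (\<forall>x\<in>cball 0 R. \<bar>q i (x, t)\<bar> \<le> M)"
  defines "f \<equiv> \<lambda>z. A z + (\<Sum>i\<in>UNIV. G i z * q i z)"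
  shows "set_integrable lborel {a..b} (\<lambda>t. LINT x|lborel. f (x, t))"
    and "(LINT x|lborel. (LINT t:{a..b}|lborel. f (x, t))) = (LINT t:{a..b}|lborel. LINT x|lborel. f (x, t))"
proof -
  let ?S = "(UNIV :: (real^3) set) \<times> {a..b}"
  have S: "?S \<in> sets borel"
    by (intro borel_closed closed_Times closed_UNIV closed_atLeastAtMost)
  \<comment> \<open>Extension by zero off the slab makes \<open>A\<close> and \<open>G i\<close>,
    known to be continuous only there, into Borel functions on all of space-time.\<close>
  define H where "H z = indicator ?S z * A z + (\<Sum>i\<in>UNIV. (indicator ?S z * G i z) * q i z)" for z
  note mA = borel_measurable_continuous_on_indicator[OF S A(1), unfolded real_scaleR_def]
  note mG = borel_measurable_continuous_on_indicator[OF S G(1), unfolded real_scaleR_def]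
  have Hm: "H \<in> borel_measurable borel"
    unfolding H_def[abs_def]
    by (intro borel_measurable_add[OF mA] borel_measurable_sum borel_measurable_times[OF mG q(1)])
  have H1: "H (x, t) = f (x, t)" if "t \<in> {a..b}" for x t
    using that by (simp add: H_def f_def)
  have H0: "H (x, t) = 0" if "t \<notin> {a..b}" for x t
    using that by (simp add: H_def)
  obtain MA where MA: "MA \<ge> 0" "\<And>t x. t \<in> {a..b} \<Longrightarrow> \<bar>A (x, t)\<bar> \<le> MA * indicator (cball 0 R) x"
    using slab_bound[OF A] by blast
  have "\<forall>i. \<exists>M. M \<ge> 0 \<and> (\<forall>t\<in>{a..b}. \<forall>x. \<bar>G i (x, t)\<bar> \<le> M * indicator (cball 0 R) x)"
    using slab_bound[OF G] by blast
  from choice[OF this] obtain MG where MG: "\<And>i. MG i \<ge> 0"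
      "\<And>i t x. t \<in> {a..b} \<Longrightarrow> \<bar>G i (x, t)\<bar> \<le> MG i * indicator (cball 0 R) x"
    by blast
  have "\<forall>i. \<exists>M. AE t in lborel. t \<in> {a..b} \<longrightarrow> (\<forall>x\<in>cball 0 R. \<bar>q i (x, t)\<bar> \<le> M)"
    using q(2) by blast
  from choice[OF this] obtain Mq where
    "\<And>i. AE t in lborel. t \<in> {a..b} \<longrightarrow> (\<forall>x\<in>cball 0 R. \<bar>q i (x, t)\<bar> \<le> Mq i)"
    by blast
  then have Mq: "AE t in lborel. \<forall>i. t \<in> {a..b} \<longrightarrow> (\<forall>x\<in>cball 0 R. \<bar>q i (x, t)\<bar> \<le> Mq i)"
    unfolding AE_all_countable by blast
  define M where "M = MA + (\<Sum>i\<in>UNIV. MG i * \<bar>Mq i\<bar>)"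
  have M0: "0 \<le> M"
    unfolding M_def using MA(1) MG(1) by (intro add_nonneg_nonneg sum_nonneg) auto
  have ci: "integrable lborel (\<lambda>x::real^3. M * indicator (cball 0 R) x)"
    using emeasure_lborel_cball_finite[of "0::real^3" R]
    by (intro integrable_mult_right) (simp add: integrable_indicator_iff)
  have Hb: "AE t in lborel. integrable lborel (\<lambda>x. H (x, t)) \<and> (LINT x|lborel. \<bar>H (x, t)\<bar>)
      \<le> (LINT x::real^3|lborel. M * indicator (cball 0 R) x)"
    using Mq
  proof eventually_elim
    case (elim t)
    have b: "\<bar>H (x, t)\<bar> \<le> M * indicator (cball 0 R) x" for x :: "real^3"
    proof (cases "t \<in> {a..b}")
      case True
      show ?thesis
      proof (cases "norm x \<le> R")
        case xR: True
        have "\<bar>H (x, t)\<bar> \<le> \<bar>A (x, t)\<bar> + (\<Sum>i\<in>UNIV. \<bar>G i (x, t) * q i (x, t)\<bar>)"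
          unfolding H1[OF True] f_def
          using abs_triangle_ineq[of "A (x, t)" "\<Sum>i\<in>UNIV. G i (x, t) * q i (x, t)"]
            sum_abs[of "\<lambda>i. G i (x, t) * q i (x, t)" UNIV] by linarith
        also have "\<dots> \<le> MA + (\<Sum>i\<in>UNIV. MG i * \<bar>Mq i\<bar>)"
        proof (intro add_mono sum_mono)
          show "\<bar>A (x, t)\<bar> \<le> MA" using MA(2)[OF True, of x] xR by simp
          show "\<bar>G i (x, t) * q i (x, t)\<bar> \<le> MG i * \<bar>Mq i\<bar>" for i
          proof -
            have "\<bar>q i (x, t)\<bar> \<le> Mq i"
              using elim True xR by simp
            then have "\<bar>q i (x, t)\<bar> \<le> \<bar>Mq i\<bar>" by linarith
            then show ?thesis
              unfolding abs_mult using MG(2)[OF True, of i x] xR MG(1)[of i] by (intro mult_mono) auto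
          qed
        qed
        finally show ?thesis using xR by (simp add: M_def)
      next
        case False
        then have "H (x, t) = 0"
          unfolding H1[OF True] f_def using A(2)[OF True] G(2)[OF True] by simp
        then show ?thesis using M0 by simp
      qed
    next
      case False
      then show ?thesis using M0 by (simp add: H0)
    qed
    have sm: "(\<lambda>x. H (x, t)) \<in> borel_measurable lborel"
    proof -
      have "(\<lambda>x::real^3. (x, t)) \<in> borel_measurable borel"
        by (intro borel_measurable_continuous_onI continuous_intros)
      from measurable_compose[OF this Hm] show ?thesis by simp
    qed
    have i: "integrable lborel (\<lambda>x. H (x, t))"
    proof (rule Bochner_Integration.integrable_bound[OF ci sm], rule AE_I2)
      fix x :: "real^3"
      show "norm (H (x, t)) \<le> norm (M * indicator (cball 0 R) x)"
        using b[of x] by simp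
    qed
    show ?case
      using i integral_mono[OF integrable_abs[OF i] ci b] by blast
  qed
  note F = iterated_integral_time_outer[OF Hm H0 Hb]
  have ind: "(LINT x|lborel. H (x, t)) = indicator {a..b} t *\<^sub>R (LINT x|lborel. f (x, t))" for t
    by (cases "t \<in> {a..b}") (simp_all add: H0 H1)
  show "set_integrable lborel {a..b} (\<lambda>t. LINT x|lborel. f (x, t))"
    unfolding set_integrable_def ind[symmetric] by (rule F(3))
  have ind2: "(LINT t|lborel. H (x, t)) = (LINT t:{a..b}|lborel. f (x, t))" for x
    unfolding set_lebesgue_integral_def
    by (rule Bochner_Integration.integral_cong) (auto simp: indicator_def H0 H1)
  have "integrable (lborel \<Otimes>\<^sub>M lborel) (\<lambda>(x, t). H (x, t))"
    using F(1) by (simp add: lborel_prod)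
  from lborel_pair.Fubini_integral[of "\<lambda>x t. H (x, t)", OF this]
  show "(LINT x|lborel. (LINT t:{a..b}|lborel. f (x, t))) = (LINT t:{a..b}|lborel. LINT x|lborel. f (x, t))"
    unfolding ind ind2 by (simp add: set_lebesgue_integral_def)
qed

lemma slab_integrals:
  fixes f :: "(real^3) \<times> real \<Rightarrow> real"
  assumes f: "continuous_on (UNIV \<times> {a..b}) f"
    and supp: "\<And>x t. t \<in> {a..b} \<Longrightarrow> R < norm x \<Longrightarrow> f (x, t) = 0"
  shows "set_integrable lebesgue {a..b} (\<lambda>t. LINT x|lebesgue. f (x, t))"
proof -
  have eq: "indicator {a..b} t *\<^sub>R (LINT x|lebesgue. f (x, t)) = indicator {a..b} t *\<^sub>R (LINT x|lborel. f (x, t))" for t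
  proof (cases "t \<in> {a..b}")
    case True
    have "(\<lambda>x. f (x, t)) \<in> borel_measurable lborel"
      unfolding measurable_lborel2
      by (rule borel_measurable_continuous_onI[OF slab_continuous_slice[OF f True]])
    then show ?thesis by (simp add: integral_completion)
  qed simp
  have "set_integrable lborel {a..b} (\<lambda>t. LINT x|lborel. f (x, t) + (\<Sum>i\<in>(UNIV :: 3 set). 0 * 0))"
  proof (rule slab_fubini(1)[OF f supp, where R=R and G="\<lambda>_ _. 0" and q="\<lambda>_ _. 0"])
    show "\<exists>M. AE t in lborel. t \<in> {a..b} \<longrightarrow> (\<forall>x\<in>cball 0 R. \<bar>0::real\<bar> \<le> M)"
      by (rule exI[of _ 0]) simp
  qed simp_all
  then have "integrable lborel (\<lambda>t. indicator {a..b} t *\<^sub>R (LINT x|lborel. f (x, t)))"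
    by (simp add: set_integrable_def)
  then show ?thesis
    unfolding set_integrable_def eq using integrable_completion[OF borel_measurable_integrable] by blast
qed

lemma continuous_compact_support_integrable:
  fixes f :: "'a::euclidean_space \<Rightarrow> real"
  assumes f: "continuous_on UNIV f" "\<And>x. R < norm x \<Longrightarrow> f x = 0"
  shows "integrable lebesgue f"
proof -
  obtain M where M: "\<And>x. \<bar>f x\<bar> \<le> M"
    using compact_support_bounded[OF f] by auto
  have "set_integrable lebesgue (cball 0 R) (\<lambda>_::'a. 1::real)"
    using emeasure_lborel_cball_finite[of "0::'a" R]
    unfolding set_integrable_def by (simp add: integrable_indicator_iff)
  from integrable_compact_support_mult(1)[OF f M this] show ?thesis
    by simp
qed

section \<open>The localized enstrophy identity\<close>

text \<open>
  Cyclic successor of an index, so that component i of a curl is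
  \<open>\<partial>\<^bsub>rot i\<^esub> f\<^bsub>rot (rot i)\<^esub> - \<partial>\<^bsub>rot (rot i)\<^esub> f\<^bsub>rot i\<^esub>\<close>.
\<close>

definition rot :: "3 \<Rightarrow> 3" where
  "rot i = (if i = 1 then 2 else if i = 2 then 3 else 1)"

lemma rot_simps [simp]: "rot 1 = 2" "rot 2 = 3" "rot 3 = 1"
  by (simp_all add: rot_def)

section \<open>Pointwise algebra of curl, convection and enstrophy\<close>

lemma curl_nth: "curl f x $ i = pd (rot i) f x $ rot (rot i) - pd (rot (rot i)) f x $ rot i"
  using exhaust_3[of i] by (auto simp: curl_def)

lemma norm_jacobian_squared: "(norm (jacobian f (at x)))\<^sup>2 = (\<Sum>i\<in>UNIV. \<Sum>j\<in>UNIV. (pd j f x $ i)\<^sup>2)"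
  for f :: "real^3 \<Rightarrow> real^3"
  unfolding power2_norm_eq_inner
  by (simp add: inner_vec_def jacobian_def matrix_def pd_def power2_eq_square)

lemma matrix_vector_inner: "(A *v w) \<bullet> w = (\<Sum>i\<in>UNIV. \<Sum>j\<in>UNIV. A $ i $ j * (w $ i * w $ j))"
  for w :: "real^3"
  by (simp add: inner_vec_def matrix_vector_mult_def sum_distrib_left sum_distrib_right mult_ac)

text \<open>Here \<open>D j i\<close> is the derivative of the \<open>i\<close>-th velocity
  component in direction \<open>j\<close>. Taking the curl of the convection term leaves these
  products of first derivatives; they equal vorticity times divergence minus the stretching term,
  and the divergence is zero. Eliminating \<open>D 1 1\<close> by the trace condition reduces it to
  a polynomial identity for each \<open>i\<close>.\<close>

lemma cross_gradient_identity:
  fixes D :: "3 \<Rightarrow> 3 \<Rightarrow> real"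
  assumes "(\<Sum>j\<in>UNIV. D j j) = 0"
  shows "(\<Sum>j\<in>UNIV. D j (rot (rot i)) * D (rot i) j - D j (rot i) * D (rot (rot i)) j)
    = - (\<Sum>j\<in>UNIV. (D (rot j) (rot (rot j)) - D (rot (rot j)) (rot j)) * D j i)"
proof -
  have tr: "D 1 1 = - D 2 2 - D 3 3"
    using assms by (simp add: sum_3)
  show ?thesis
    using exhaust_3[of i] by (auto simp: sum_3 tr algebra_simps)
qed

text \<open>With \<open>w\<close> the velocity, \<open>c a b\<close> is the
  \<open>a\<close>-derivative of the divergence of velocity component \<open>b\<close> times the
  velocity, fully expanded. For divergence-free fields the curl of this is transport of vorticity
  minus stretching.\<close>

lemma curl_convection_identity:
  fixes D :: "3 \<Rightarrow> 3 \<Rightarrow> real" and D2 :: "3 \<Rightarrow> 3 \<Rightarrow> 3 \<Rightarrow> real" and w :: "3 \<Rightarrow> real"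
  assumes tr: "(\<Sum>j\<in>UNIV. D j j) = 0" "\<And>a. (\<Sum>j\<in>UNIV. D2 a j j) = 0"
    and sym: "\<And>a j m. D2 a j m = D2 j a m"
  defines "c \<equiv> \<lambda>a b. \<Sum>j\<in>UNIV. D2 a j b * w j + D j b * D a j + D a b * D j j + w b * D2 a j j"
  shows "c (rot i) (rot (rot i)) - c (rot (rot i)) (rot i)
    = (\<Sum>j\<in>UNIV. w j * (D2 j (rot i) (rot (rot i)) - D2 j (rot (rot i)) (rot i)))
      - (\<Sum>j\<in>UNIV. (D (rot j) (rot (rot j)) - D (rot (rot j)) (rot j)) * D j i)"
proof -
  have c: "c a b = (\<Sum>j\<in>UNIV. w j * D2 j a b) + (\<Sum>j\<in>UNIV. D j b * D a j)" for a b
  proof -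
    have "c a b = (\<Sum>j\<in>UNIV. D2 a j b * w j) + (\<Sum>j\<in>UNIV. D j b * D a j)
        + D a b * (\<Sum>j\<in>UNIV. D j j) + w b * (\<Sum>j\<in>UNIV. D2 a j j)"
      by (simp add: c_def sum.distrib sum_distrib_left)
    moreover have "(\<Sum>j\<in>UNIV. D2 a j b * w j) = (\<Sum>j\<in>UNIV. w j * D2 j a b)"
      by (rule sum.cong) (simp_all add: sym[of a] mult.commute)
    ultimately show ?thesis
      by (simp add: tr)
  qed
  show ?thesis
    unfolding c using cross_gradient_identity[of D i, OF tr(1)]
    by (simp add: right_diff_distrib sum_subtractf)
qed

text \<open>Now \<open>w\<close> is the vorticity, \<open>dw\<close> and \<open>ddw\<close> its
  first and pure second derivatives, \<open>r\<close> its rate; \<open>ch\<close>,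
  \<open>ct\<close>, \<open>cj\<close>, \<open>cjj\<close> are the weight and its derivatives. The
  large first sum is the divergence of (weight times gradient of \<open>q\<close>) minus
  (\<open>q\<close> times gradient of the weight) minus (weight times \<open>q\<close> times
  velocity): diffusion and transport are moved onto the weight at the cost of this
  divergence.\<close>

lemma enstrophy_density_identity:
  fixes D dw ddw :: "3 \<Rightarrow> 3 \<Rightarrow> real" and w U F r cj cjj :: "3 \<Rightarrow> real" and ch ct q :: real
  assumes tr: "(\<Sum>j\<in>UNIV. D j j) = 0"
    and r: "\<And>i. r i = (\<Sum>j\<in>UNIV. ddw j i) + F i - (\<Sum>j\<in>UNIV. U j * dw j i) + (\<Sum>j\<in>UNIV. w j * D j i)"
    and q: "q = (\<Sum>i\<in>UNIV. (w i)\<^sup>2)"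
  shows "ct * q + 2 * ch * (\<Sum>i\<in>UNIV. w i * r i) =
    (\<Sum>j\<in>UNIV. cj j * (\<Sum>i\<in>UNIV. 2 * (w i * dw j i)) + ch * (\<Sum>i\<in>UNIV. 2 * ((dw j i)\<^sup>2 + w i * ddw j i))
       - ((\<Sum>i\<in>UNIV. 2 * (w i * dw j i)) * cj j + q * cjj j)
       - (cj j * (U j * q) + ch * (D j j * q + U j * (\<Sum>i\<in>UNIV. 2 * (w i * dw j i)))))
    + q * (ct + (\<Sum>j\<in>UNIV. cjj j) + (\<Sum>j\<in>UNIV. U j * cj j))
    - 2 * (ch * (\<Sum>i\<in>UNIV. \<Sum>j\<in>UNIV. (dw j i)\<^sup>2))
    + 2 * (ch * (\<Sum>i\<in>UNIV. \<Sum>j\<in>UNIV. (D j i + D i j) / 2 * (w i * w j)))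
    + 2 * (ch * (\<Sum>i\<in>UNIV. F i * w i))"
proof -
  let ?g = "\<lambda>j. \<Sum>i\<in>UNIV. 2 * (w i * dw j i)"
  have "(\<Sum>j\<in>UNIV. cj j * ?g j + ch * (\<Sum>i\<in>UNIV. 2 * ((dw j i)\<^sup>2 + w i * ddw j i))
       - (?g j * cj j + q * cjj j) - (cj j * (U j * q) + ch * (D j j * q + U j * ?g j)))
    = (\<Sum>j\<in>UNIV. ch * (\<Sum>i\<in>UNIV. 2 * ((dw j i)\<^sup>2 + w i * ddw j i)) - ch * (U j * ?g j)
       - q * cjj j - q * (U j * cj j) - ch * q * D j j)"
    by (rule sum.cong) (simp_all add: algebra_simps)
  also have "\<dots> = ch * (\<Sum>j\<in>UNIV. \<Sum>i\<in>UNIV. 2 * ((dw j i)\<^sup>2 + w i * ddw j i)) - ch * (\<Sum>j\<in>UNIV. U j * ?g j)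
       - q * (\<Sum>j\<in>UNIV. cjj j) - q * (\<Sum>j\<in>UNIV. U j * cj j) - ch * q * (\<Sum>j\<in>UNIV. D j j)"
    by (simp only: sum_subtractf sum_distrib_left)
  finally have h: "(\<Sum>j\<in>UNIV. cj j * ?g j + ch * (\<Sum>i\<in>UNIV. 2 * ((dw j i)\<^sup>2 + w i * ddw j i))
       - (?g j * cj j + q * cjj j) - (cj j * (U j * q) + ch * (D j j * q + U j * ?g j)))
    = ch * (\<Sum>j\<in>UNIV. \<Sum>i\<in>UNIV. 2 * ((dw j i)\<^sup>2 + w i * ddw j i)) - ch * (\<Sum>j\<in>UNIV. U j * ?g j)
       - q * (\<Sum>j\<in>UNIV. cjj j) - q * (\<Sum>j\<in>UNIV. U j * cj j)"
    by (simp add: tr)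
  \<comment> \<open>The stretching term pairs the velocity gradient with the symmetric matrix
    \<open>w i * w j\<close>, so only its symmetric part, the strain, survives.\<close>
  have e1: "(\<Sum>i\<in>UNIV. w i * r i) = (\<Sum>j\<in>UNIV. \<Sum>i\<in>UNIV. w i * ddw j i) + (\<Sum>i\<in>UNIV. F i * w i)
      - (\<Sum>j\<in>UNIV. U j * (\<Sum>i\<in>UNIV. w i * dw j i)) + (\<Sum>i\<in>UNIV. \<Sum>j\<in>UNIV. (D j i + D i j) / 2 * (w i * w j))"
    unfolding r sum_3 by (simp add: algebra_simps)
  have e2: "(\<Sum>j\<in>UNIV. \<Sum>i\<in>UNIV. 2 * ((dw j i)\<^sup>2 + w i * ddw j i))
      = 2 * (\<Sum>i\<in>UNIV. \<Sum>j\<in>UNIV. (dw j i)\<^sup>2) + 2 * (\<Sum>j\<in>UNIV. \<Sum>i\<in>UNIV. w i * ddw j i)"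
    unfolding sum_3 by (simp add: algebra_simps)
  have e3: "(\<Sum>j\<in>UNIV. U j * ?g j) = 2 * (\<Sum>j\<in>UNIV. U j * (\<Sum>i\<in>UNIV. w i * dw j i))"
    by (simp add: sum_distrib_left mult_ac)
  show ?thesis
    unfolding h e1 e2 e3 by (simp add: algebra_simps)
qed

lemma pd_zero_outside:
  fixes f :: "real^3 \<Rightarrow> real"
  assumes "\<And>x. R < norm x \<Longrightarrow> f x = 0" "R < norm x"
  shows "pd j f x = 0"
proof -
  have "open {x::real^3. R < norm x}"
    by (intro open_Collect_less continuous_intros)
  then have "(f has_derivative (\<lambda>_. 0)) (at x)"
    by (rule has_derivative_transform_within_open[OF has_derivative_const]) (use assms in auto)
  from pd_eqI[OF this] show ?thesis .
qed

lemma bounded_primitive_sum: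
  assumes "finite A" "\<And>i. i \<in> A \<Longrightarrow> bounded_primitive a b (F i) (f i)"
  shows "bounded_primitive a b (\<lambda>t. \<Sum>i\<in>A. F i t) (\<lambda>t. \<Sum>i\<in>A. f i t)"
  using assms
proof (induction A rule: finite_induct)
  case empty
  have "bounded_primitive a b (\<lambda>_. 0) (\<lambda>_. 0)"
    by (rule bounded_primitive_C1) (auto intro: continuous_intros)
  then show ?case by simp
next
  case (insert i A)
  have "bounded_primitive a b (\<lambda>t. F i t + (\<Sum>i\<in>A. F i t)) (\<lambda>t. f i t + (\<Sum>i\<in>A. f i t))"
    by (rule bounded_primitive_add) (use insert in auto)
  then show ?case using insert by simp
qed

text \<open>The times \<open>c\<close> and \<open>e\<close> provide the room on either side of
  \<open>{s0..s1}\<close> required by \<open>vort_primitive\<close>; \<open>R\<close> is a common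
  radius for the supports of the weight, and \<open>d\<close> is the near-field radius.\<close>

locale weighted_enstrophy =
  filtered_navier_stokes T u v \<beta> B p "rescaled \<phi> l" + radial_cutoff \<theta> d
  for T u v \<beta> B p \<phi> l \<theta> d +
  fixes \<eta> :: "real^3 \<Rightarrow> real \<Rightarrow> real" and c s0 s1 e R :: real
  assumes times: "c < s0" "s0 < s1" "s1 < e" "{c..e} \<subseteq> T"
    and \<eta>_smooth: "smooth_on (UNIV \<times> {s0..s1}) (\<lambda>(x, t). \<eta> x t)"
    and \<eta>_support: "\<And>x t. t \<in> {s0..s1} \<Longrightarrow> R < norm x \<Longrightarrow> \<eta> x t = 0"
begin

abbreviation "K \<equiv> rescaled \<phi> l"
abbreviation "I \<equiv> {s0..s1}"

lemma I_subset: "I \<subseteq> T"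
  using times by force

lemma I_T: "t \<in> I \<Longrightarrow> t \<in> T"
  using I_subset by blast

lemma V_pd:
  assumes t: "t \<in> T" and k: "test_function UNIV k"
  shows "(\<lambda>x. V k i x t) differentiable (at x)" "pd j (\<lambda>x. V k i x t) = (\<lambda>x. V (pd j k) i x t)"
    "C1 (\<lambda>x. V k i x t)"
  unfolding V_def pd_convolution[OF k u_component_integrable[OF t]]
  by (rule C1D(1)[OF C1_convolution[OF k u_component_integrable[OF t]]], rule refl, rule C1_convolution[OF k u_component_integrable[OF t]])

lemma Q_pd:
  assumes t: "t \<in> T" and k: "test_function UNIV k"
  shows "(\<lambda>x. Q k m n x t) differentiable (at x)" "pd j (\<lambda>x. Q k m n x t) = (\<lambda>x. Q (pd j k) m n x t)"
    "C1 (\<lambda>x. Q k m n x t)"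
  unfolding Q_def pd_convolution[OF k u_product_integrable[OF t]]
  by (rule C1D(1)[OF C1_convolution[OF k u_product_integrable[OF t]]], rule refl, rule C1_convolution[OF k u_product_integrable[OF t]])

lemma V_slab: "test_function UNIV k \<Longrightarrow> continuous_on (UNIV \<times> I) (\<lambda>z. V k i (fst z) (snd z))"
  using V_continuous[OF _ times(2) I_subset, of k i] by (simp add: case_prod_unfold)

definition Om :: "3 \<Rightarrow> real^3 \<Rightarrow> real \<Rightarrow> real" where
  "Om i = vort (rot i) (rot (rot i))"

definition dOm :: "3 \<Rightarrow> 3 \<Rightarrow> real^3 \<Rightarrow> real \<Rightarrow> real" where
  "dOm j i x t = V (pd j (pd (rot i) K)) (rot (rot i)) x t - V (pd j (pd (rot (rot i)) K)) (rot i) x t"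

text \<open>Only the pure second derivatives, whose sum over \<open>j\<close> is the Laplacian of
  component \<open>i\<close>.\<close>

definition ddOm :: "3 \<Rightarrow> 3 \<Rightarrow> real^3 \<Rightarrow> real \<Rightarrow> real" where
  "ddOm j i x t = V (pd j (pd j (pd (rot i) K))) (rot (rot i)) x t - V (pd j (pd j (pd (rot (rot i)) K))) (rot i) x t"

lemma Om_pd:
  assumes t: "t \<in> T"
  shows "C1 (\<lambda>x. Om i x t)" "pd j (\<lambda>x. Om i x t) = (\<lambda>x. dOm j i x t)"
    "C1 (\<lambda>x. dOm j i x t)" "pd j (\<lambda>x. dOm j i x t) = (\<lambda>x. ddOm j i x t)"
proof -
  show "C1 (\<lambda>x. Om i x t)"
    unfolding Om_def vort_def by (intro C1_diff V_pd t K_test)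
  show "C1 (\<lambda>x. dOm j i x t)"
    unfolding dOm_def by (intro C1_diff V_pd t K_test)
  show "pd j (\<lambda>x. Om i x t) = (\<lambda>x. dOm j i x t)"
    unfolding Om_def vort_def dOm_def
    by (rule ext, subst pd_diff) (simp_all add: V_pd t K_test)
  show "pd j (\<lambda>x. dOm j i x t) = (\<lambda>x. ddOm j i x t)"
    unfolding ddOm_def dOm_def
    by (rule ext, subst pd_diff) (simp_all add: V_pd t K_test)
qed

section \<open>Components of the filtered fields\<close>

lemma velocity_nth:
  assumes "t \<in> T"
  shows "filtered_velocity \<phi> l u x t $ i = V K i x t"
proof -
  obtain R where R: "\<And>x. R < norm x \<Longrightarrow> K x = 0"
    using test_function_kernel(2)[OF K] by blast
  have "integrable lebesgue (\<lambda>y. (K (x - y) *\<^sub>R u y t) $ i)" for i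
    using convolution_integrable[OF test_function_kernel(1)[OF K] R u_component_integrable[OF assms]] by simp
  from integral_vec_nth(2)[OF this, of i] show ?thesis
    by (simp add: filtered_velocity_def V_def convolution_def)
qed

lemma velocity_pd:
  assumes "t \<in> T"
  shows "(\<lambda>y. filtered_velocity \<phi> l u y t) differentiable (at x)"
    "pd j (\<lambda>y. filtered_velocity \<phi> l u y t) x $ i = V (pd j K) i x t"
proof -
  have eq: "(\<lambda>y. filtered_velocity \<phi> l u y t $ i) = (\<lambda>y. V K i y t)" for i
    using velocity_nth[OF assms] by blast
  have d: "(\<lambda>y. filtered_velocity \<phi> l u y t $ i) differentiable (at x)" for i
    unfolding eq by (rule V_pd(1)[OF assms K])
  show "(\<lambda>y. filtered_velocity \<phi> l u y t) differentiable (at x)"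
    "pd j (\<lambda>y. filtered_velocity \<phi> l u y t) x $ i = V (pd j K) i x t"
    using pd_vec_nth[of "\<lambda>y. filtered_velocity \<phi> l u y t", OF d] V_pd(2)[OF assms K]
    unfolding eq by simp_all
qed

lemma vorticity_nth:
  assumes "t \<in> T"
  shows "filtered_vorticity \<phi> l u x t $ i = Om i x t"
  unfolding filtered_vorticity_def curl_nth velocity_pd(2)[OF assms] Om_def vort_def ..

lemma vorticity_pd:
  assumes "t \<in> T"
  shows "pd j (\<lambda>y. filtered_vorticity \<phi> l u y t) x $ i = dOm j i x t"
proof -
  have eq: "(\<lambda>y. filtered_vorticity \<phi> l u y t $ i) = (\<lambda>y. Om i y t)" for i
    using vorticity_nth[OF assms] by blast
  have d: "(\<lambda>y. filtered_vorticity \<phi> l u y t $ i) differentiable (at x)" for i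
    unfolding eq by (rule C1D(1)[OF Om_pd(1)[OF assms]])
  show ?thesis
    using pd_vec_nth(2)[of "\<lambda>y. filtered_vorticity \<phi> l u y t", OF d] Om_pd(2)[OF assms]
    unfolding eq by simp
qed

lemma vorticity_norm:
  assumes "t \<in> T"
  shows "(norm (filtered_vorticity \<phi> l u x t))\<^sup>2 = (\<Sum>i\<in>UNIV. (Om i x t)\<^sup>2)"
  unfolding power2_norm_eq_inner inner_vec_def
  by (simp add: vorticity_nth[OF assms] power2_eq_square)

lemma strain_nth:
  assumes "t \<in> T"
  shows "filtered_strain \<phi> l u x t $ i $ j = (V (pd j K) i x t + V (pd i K) j x t) / 2"
proof -
  have "jacobian (\<lambda>y. filtered_velocity \<phi> l u y t) (at x) $ i $ j = V (pd j K) i x t" for i j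
    using velocity_pd(2)[OF assms, of j x i] by (simp add: jacobian_def matrix_def pd_def)
  then show ?thesis
    by (simp add: filtered_strain_def Let_def transpose_def)
qed

lemma stress_nth:
  assumes "t \<in> T"
  shows "commutator_stress \<phi> l u x t $ m $ n = Q K m n x t - V K m x t * V K n x t"
proof -
  obtain R where R: "\<And>x. R < norm x \<Longrightarrow> K x = 0"
    using test_function_kernel(2)[OF K] by blast
  have i: "integrable lebesgue (\<lambda>y. (K (x - y) *\<^sub>R outer (u y t) (u y t)) $ m $ n)" for m n
    using convolution_integrable[OF test_function_kernel(1)[OF K] R u_product_integrable[OF assms]]
    by (simp add: outer_def)
  have "convolution K (\<lambda>y. outer (u y t) (u y t)) x $ m $ n = Q K m n x t"
    unfolding convolution_def integral_vec_nth(2)[OF integral_vec_nth(1)[OF i]] integral_vec_nth(2)[OF i]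
    by (simp add: outer_def Q_def convolution_def)
  then show ?thesis
    by (simp add: commutator_stress_def outer_def velocity_nth[OF assms])
qed

lemma stress_divergence:
  assumes t: "t \<in> T"
  shows "div_matrix (\<lambda>y. commutator_stress \<phi> l u y t) x $ m =
    (\<Sum>j\<in>UNIV. Q (pd j K) m j x t - (V (pd j K) m x t * V K j x t + V K m x t * V (pd j K) j x t))"
proof -
  let ?A = "\<lambda>y. commutator_stress \<phi> l u y t"
  have eq: "(\<lambda>y. ?A y $ m $ n) = (\<lambda>y. Q K m n y t - V K m y t * V K n y t)" for m n
    using stress_nth[OF t] by blast
  have d: "(\<lambda>y. ?A y $ m $ n) differentiable (at x)" for m n x
    unfolding eq by (intro derivative_intros differentiable_diff differentiable_mult V_pd Q_pd t K)
  have "pd j ?A x $ m $ j = Q (pd j K) m j x t - (V (pd j K) m x t * V K j x t + V K m x t * V (pd j K) j x t)" for j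
  proof -
    have "pd j ?A x $ m $ j = pd j (\<lambda>y. ?A y $ m) x $ j"
      using pd_vec_nth(2)[of ?A, OF pd_vec_nth(1)[OF d]] by simp
    also have "\<dots> = pd j (\<lambda>y. ?A y $ m $ j) x"
      by (rule pd_vec_nth(2)[OF d])
    also have "\<dots> = pd j (\<lambda>y. Q K m j y t) x - pd j (\<lambda>y. V K m y t * V K j y t) x"
      unfolding eq by (intro pd_diff differentiable_mult V_pd Q_pd t K)
    also have "pd j (\<lambda>y. V K m y t * V K j y t) x = V (pd j K) m x t * V K j x t + V K m x t * V (pd j K) j x t"
      by (subst pd_mult) (simp_all add: V_pd t K)
    also have "pd j (\<lambda>y. Q K m j y t) x = Q (pd j K) m j x t"
      by (simp add: Q_pd t K)
    finally show ?thesis .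
  qed
  then show ?thesis
    by (simp add: div_matrix_def)
qed

text \<open>Minus the curl of the divergence of the stress is split into its filtered part, with
  kernels differentiated twice, and the part from the product of filtered velocities, which enters
  with a plus sign. \<open>cv\<close> is left fully expanded, divergence terms included, to match
  \<open>curl_convection_identity\<close>.\<close>

lemma forcing_nth:
  assumes t: "t \<in> T"
  defines "cv \<equiv> \<lambda>a b x. \<Sum>j\<in>UNIV. V (pd a (pd j K)) b x t * V K j x t + V (pd j K) b x t * V (pd a K) j x t
      + V (pd a K) b x t * V (pd j K) j x t + V K b x t * V (pd a (pd j K)) j x t"
  shows "commutator_forcing \<phi> l u x t $ i =
    - (\<Sum>j\<in>UNIV. Q (pd (rot i) (pd j K)) (rot (rot i)) j x t - Q (pd (rot (rot i)) (pd j K)) (rot i) j x t)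
    + (cv (rot i) (rot (rot i)) x - cv (rot (rot i)) (rot i) x)"
proof -
  let ?S = "div_matrix (\<lambda>y. commutator_stress \<phi> l u y t)"
  let ?f = "\<lambda>m j x. Q (pd j K) m j x t - (V (pd j K) m x t * V K j x t + V K m x t * V (pd j K) j x t)"
  have eq: "(\<lambda>y. ?S y $ m) = (\<lambda>x. \<Sum>j\<in>UNIV. ?f m j x)" for m
    using stress_divergence[OF t] by blast
  have fd: "(\<lambda>x. ?f m j x) differentiable (at x)" for m j x
    by (intro differentiable_diff differentiable_add differentiable_mult V_pd Q_pd t K K_test)
  have fpd: "pd a (\<lambda>x. ?f m j x) x = Q (pd a (pd j K)) m j x t
      - (V (pd a (pd j K)) m x t * V K j x t + V (pd j K) m x t * V (pd a K) j x t
      + V (pd a K) m x t * V (pd j K) j x t + V K m x t * V (pd a (pd j K)) j x t)" for a m j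
  proof -
    have "pd a (\<lambda>x. ?f m j x) x = pd a (\<lambda>x. Q (pd j K) m j x t) x
        - (pd a (\<lambda>x. V (pd j K) m x t * V K j x t) x + pd a (\<lambda>x. V K m x t * V (pd j K) j x t) x)"
      by (subst pd_diff; (subst pd_add)?) (intro differentiable_add differentiable_mult V_pd Q_pd t K K_test refl)+
    also have "pd a (\<lambda>x. V (pd j K) m x t * V K j x t) x
        = V (pd a (pd j K)) m x t * V K j x t + V (pd j K) m x t * V (pd a K) j x t"
      by (subst pd_mult) (simp_all add: V_pd t K K_test)
    also have "pd a (\<lambda>x. V K m x t * V (pd j K) j x t) x
        = V (pd a K) m x t * V (pd j K) j x t + V K m x t * V (pd a (pd j K)) j x t"
      by (subst pd_mult) (simp_all add: V_pd t K K_test)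
    finally show ?thesis
      by (simp add: Q_pd t K_test)
  qed
  have Sd: "(\<lambda>y. ?S y $ m) differentiable (at x)" for m
    unfolding eq by (intro differentiable_sum) (auto intro: fd)
  have "pd a ?S x $ m = (\<Sum>j\<in>UNIV. Q (pd a (pd j K)) m j x t) - cv a m x" for a m
  proof -
    have "pd a ?S x $ m = pd a (\<lambda>x. \<Sum>j\<in>UNIV. ?f m j x) x"
      using pd_vec_nth(2)[of ?S, OF Sd] unfolding eq .
    also have "\<dots> = (\<Sum>j\<in>UNIV. pd a (\<lambda>x. ?f m j x) x)"
      by (rule pd_sum) (auto intro: fd)
    finally show ?thesis
      unfolding fpd cv_def by (simp add: sum_subtractf)
  qed
  then show ?thesis
    by (simp add: commutator_forcing_def curl_nth sum_subtractf)
qed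

lemma forcing_continuous:
  assumes t: "t \<in> T"
  shows "continuous_on UNIV (\<lambda>x. commutator_forcing \<phi> l u x t $ i)"
  unfolding forcing_nth[OF t]
  by (intro continuous_intros C1D(3)[OF Q_pd(3)[OF t]] C1D(3)[OF V_pd(3)[OF t]] K K_test)

lemma pd_K_commute: "pd a (pd j K) = pd j (pd a K)"
  by (rule ext) (rule pd_commute[OF K_smooth(1)])

text \<open>The divergence vanishes at every point of the slice, so the identity may be
  differentiated in \<open>x\<close>.\<close>

lemma divergence_free_pd:
  assumes t: "t \<in> T"
  shows "(\<Sum>j\<in>UNIV. V (pd a (pd j K)) j x t) = 0"
proof -
  have "(\<Sum>j\<in>UNIV. V (pd a (pd j K)) j x t) = (\<Sum>j\<in>UNIV. pd a (\<lambda>x. V (pd j K) j x t) x)"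
    by (simp add: V_pd t K_test)
  also have "\<dots> = pd a (\<lambda>x. \<Sum>j\<in>UNIV. V (pd j K) j x t) x"
    by (rule pd_sum[symmetric]) (auto intro: V_pd t K_test)
  also have "\<dots> = 0"
    unfolding divergence_free[OF t] by (rule pd_eqI[OF has_derivative_const])
  finally show ?thesis .
qed

text \<open>At a time where \<open>Q\<close> and \<open>Qv\<close> agree, the filtered quadratic
  part of \<open>rate\<close> is the forcing minus the curl of the divergence of the tensor square
  of the filtered velocity. The latter is transport minus stretching. Derivatives of the kernel come
  in the opposite order in the forcing, hence \<open>pd_K_commute\<close>.\<close>

lemma rate_eq:
  assumes t: "t \<in> T" and Q: "\<And>a j m n. Q (pd j (pd a K)) m n x t = Qv (pd j (pd a K)) m n (x, t)"
  shows "rate (rot i) (rot (rot i)) x t = (\<Sum>j\<in>UNIV. ddOm j i x t) + commutator_forcing \<phi> l u x t $ i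
    - (\<Sum>j\<in>UNIV. V K j x t * dOm j i x t) + (\<Sum>j\<in>UNIV. Om j x t * V (pd j K) i x t)"
proof -
  note ci = curl_convection_identity[of "\<lambda>j m. V (pd j K) m x t" "\<lambda>a j m. V (pd a (pd j K)) m x t" i "\<lambda>j. V K j x t",
      OF divergence_free[OF t] divergence_free_pd[OF t]]
  have sym: "V (pd a (pd j K)) m x t = V (pd j (pd a K)) m x t" for a j m
    by (simp only: pd_K_commute)
  have "commutator_forcing \<phi> l u x t $ i =
    - (\<Sum>j\<in>UNIV. Q (pd j (pd (rot i) K)) (rot (rot i)) j x t - Q (pd j (pd (rot (rot i)) K)) (rot i) j x t)
    + ((\<Sum>j\<in>UNIV. V K j x t * dOm j i x t) - (\<Sum>j\<in>UNIV. Om j x t * V (pd j K) i x t))"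
  proof -
    have f: "commutator_forcing \<phi> l u x t $ i =
      - (\<Sum>j\<in>UNIV. Q (pd (rot i) (pd j K)) (rot (rot i)) j x t - Q (pd (rot (rot i)) (pd j K)) (rot i) j x t)
      + ((\<Sum>j\<in>UNIV. V K j x t * (V (pd j (pd (rot i) K)) (rot (rot i)) x t - V (pd j (pd (rot (rot i)) K)) (rot i) x t))
      - (\<Sum>j\<in>UNIV. (V (pd (rot j) K) (rot (rot j)) x t - V (pd (rot (rot j)) K) (rot j) x t) * V (pd j K) i x t))"
      unfolding forcing_nth[OF t] ci[OF sym] ..
    show ?thesis
      unfolding f Om_def vort_def dOm_def pd_K_commute[of "rot i"] pd_K_commute[of "rot (rot i)"] ..
  qed
  then show ?thesis
    unfolding rate_def ddOm_def Q by simp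
qed

section \<open>The weight and its derivatives\<close>

definition et :: "real^3 \<Rightarrow> real \<Rightarrow> real" where
  "et x t = vector_derivative (\<lambda>s. \<eta> x s) (at t within I)"

abbreviation "\<eta>p j x t \<equiv> pd j (\<lambda>y. \<eta> y t) x"
abbreviation "\<eta>pp j x t \<equiv> pd j (pd j (\<lambda>y. \<eta> y t)) x"

lemma \<eta>_time:
  "t \<in> I \<Longrightarrow> (\<eta> x has_vector_derivative et x t) (at t within I)"
  "continuous_on (UNIV \<times> I) (\<lambda>z. et (fst z) (snd z))"
  using smooth_slab_time[OF \<eta>_smooth times(2)] by (simp_all add: et_def)

lemma \<eta>_space:
  shows "t \<in> I \<Longrightarrow> C1 (\<lambda>y. \<eta> y t)" "t \<in> I \<Longrightarrow> C1 (pd j (\<lambda>y. \<eta> y t))"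
    and "continuous_on (UNIV \<times> I) (\<lambda>z. \<eta> (fst z) (snd z))"
    and "continuous_on (UNIV \<times> I) (\<lambda>z. \<eta>p j (fst z) (snd z))"
    and "continuous_on (UNIV \<times> I) (\<lambda>z. \<eta>pp j (fst z) (snd z))"
proof -
  have s0: "smooth_on (UNIV \<times> I) (\<lambda>z. \<eta> (fst z) (snd z))"
    using \<eta>_smooth by (simp add: case_prod_unfold)
  note p1 = smooth_slab_pd[OF s0, unfolded fst_conv snd_conv]
  note p2 = smooth_slab_pd[OF p1(2), unfolded fst_conv snd_conv]
  note c0 = smooth_on_imp_continuous[OF s0]
  note c1 = smooth_on_imp_continuous[OF p1(2)]
  note c2 = smooth_on_imp_continuous[OF p2(2)]
  show "continuous_on (UNIV \<times> I) (\<lambda>z. \<eta> (fst z) (snd z))"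
    "continuous_on (UNIV \<times> I) (\<lambda>z. \<eta>p j (fst z) (snd z))"
    "continuous_on (UNIV \<times> I) (\<lambda>z. \<eta>pp j (fst z) (snd z))"
    by (rule c0, rule c1, rule c2)
  show "C1 (\<lambda>y. \<eta> y t)" if "t \<in> I"
    unfolding C1_def using p1(1)[OF that] slab_continuous_slice[OF c1 that] by simp
  show "C1 (pd j (\<lambda>y. \<eta> y t))" if "t \<in> I"
    unfolding C1_def using p2(1)[OF that] slab_continuous_slice[OF c2 that] by simp
qed

lemma \<eta>_zero_outside:
  assumes t: "t \<in> I" and x: "R < norm x"
  shows "\<eta> x t = 0" "\<eta>p j x t = 0" "\<eta>pp j x t = 0" "et x t = 0"
proof -
  show "\<eta> x t = 0" by (rule \<eta>_support[OF t x])
  show p: "\<eta>p j x t = 0" by (rule pd_zero_outside[OF \<eta>_support[OF t] x])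
  show "\<eta>pp j x t = 0"
    by (rule pd_zero_outside[OF pd_zero_outside[OF \<eta>_support[OF t]] x])
  \<comment> \<open>For \<open>x\<close> outside the ball the weight is zero throughout
    \<open>I\<close>, and its derivative within \<open>I\<close> is unique, also at the end
    times.\<close>
  have "((\<lambda>_. 0) has_vector_derivative et x t) (at t within I)"
    by (rule has_vector_derivative_transform[OF t _ \<eta>_time(1)[OF t]]) (use \<eta>_support x in auto)
  from vector_derivative_within_closed_interval[OF times(2) t this]
  show "et x t = 0"
    using vector_derivative_within_closed_interval[OF times(2) t has_vector_derivative_const[of "0::real"]] by simp
qed

definition q :: "real^3 \<Rightarrow> real \<Rightarrow> real" where
  "q x t = (\<Sum>i\<in>UNIV. (Om i x t)\<^sup>2)"

text \<open>The first two terms are the Green pair that exchanges the Laplacian of \<open>q\<close>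
  for that of the weight; the third is the transport of \<open>q\<close>.\<close>

definition flux :: "3 \<Rightarrow> real^3 \<Rightarrow> real \<Rightarrow> real" where
  "flux j x t = \<eta> x t * (\<Sum>i\<in>UNIV. 2 * (Om i x t * dOm j i x t)) - q x t * \<eta>p j x t - \<eta> x t * (V K j x t * q x t)"

text \<open>
  fP, fN, fM, fR and fL are the integrands of \<open>P_eta\<close>, \<open>V_near_eta\<close>, \<open>V_rem_eta\<close>, \<open>R_eta\<close> and \<open>2 L_eta\<close> without the factor r;
  fG is the time derivative of \<open>\<eta> |\<Omega>|\<^sup>2\<close>, and it differs from their combination by the divergence of the flux.
\<close>

definition fG :: "(real^3) \<times> real \<Rightarrow> real" where
  "fG z = et (fst z) (snd z) * q (fst z) (snd z)
     + 2 * \<eta> (fst z) (snd z) * (\<Sum>i\<in>UNIV. Om i (fst z) (snd z) * rate (rot i) (rot (rot i)) (fst z) (snd z))"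

definition fP :: "(real^3) \<times> real \<Rightarrow> real" where
  "fP z = \<eta> (fst z) (snd z) * (\<Sum>i\<in>UNIV. \<Sum>j\<in>UNIV. (dOm j i (fst z) (snd z))\<^sup>2)"

definition near :: "(real^3) \<times> real \<Rightarrow> real^3^3" where
  "near z = (3 / (8 * pi)) *\<^sub>R strain_integral (\<lambda>y. filtered_vorticity \<phi> l u y (snd z)) (fst z)"

definition fN :: "(real^3) \<times> real \<Rightarrow> real" where
  "fN z = \<eta> (fst z) (snd z) * (\<Sum>i\<in>UNIV. \<Sum>j\<in>UNIV. near z $ i $ j * (Om i (fst z) (snd z) * Om j (fst z) (snd z)))"

definition fM :: "(real^3) \<times> real \<Rightarrow> real" where
  "fM z = \<eta> (fst z) (snd z) * (\<Sum>i\<in>UNIV. \<Sum>j\<in>UNIV.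
     ((V (pd j K) i (fst z) (snd z) + V (pd i K) j (fst z) (snd z)) / 2 - near z $ i $ j)
       * (Om i (fst z) (snd z) * Om j (fst z) (snd z)))"

definition fL :: "(real^3) \<times> real \<Rightarrow> real" where
  "fL z = q (fst z) (snd z) * (et (fst z) (snd z) + (\<Sum>j\<in>UNIV. \<eta>pp j (fst z) (snd z))
     + (\<Sum>j\<in>UNIV. V K j (fst z) (snd z) * \<eta>p j (fst z) (snd z)))"

definition fR :: "(real^3) \<times> real \<Rightarrow> real" where
  "fR z = \<eta> (fst z) (snd z) * (\<Sum>i\<in>UNIV. commutator_forcing \<phi> l u (fst z) (snd z) $ i * Om i (fst z) (snd z))"

section \<open>Continuity and support of the integrands on the slab\<close>

lemma Om_slab:
  "continuous_on (UNIV \<times> I) (\<lambda>z. Om i (fst z) (snd z))"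
  "continuous_on (UNIV \<times> I) (\<lambda>z. dOm j i (fst z) (snd z))"
  "continuous_on (UNIV \<times> I) (\<lambda>z. ddOm j i (fst z) (snd z))"
  "continuous_on (UNIV \<times> I) (\<lambda>z. q (fst z) (snd z))"
  unfolding q_def Om_def vort_def dOm_def ddOm_def by (intro continuous_intros V_slab K_test)+

lemma Om_lipschitz:
  "\<exists>L. \<forall>t\<in>I. \<forall>x\<in>cball 0 r. \<forall>y\<in>cball 0 r. \<bar>Om i x t - Om i y t\<bar> \<le> L * norm (x - y)"
proof -
  obtain L1 where L1: "\<forall>t\<in>I. \<forall>x\<in>cball 0 r. \<forall>y\<in>cball 0 r.
      \<bar>V (pd (rot i) K) (rot (rot i)) x t - V (pd (rot i) K) (rot (rot i)) y t\<bar> \<le> L1 * norm (x - y)"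
    using V_lipschitz[OF K_test(1) times(2) I_subset] by blast
  obtain L2 where L2: "\<forall>t\<in>I. \<forall>x\<in>cball 0 r. \<forall>y\<in>cball 0 r.
      \<bar>V (pd (rot (rot i)) K) (rot i) x t - V (pd (rot (rot i)) K) (rot i) y t\<bar> \<le> L2 * norm (x - y)"
    using V_lipschitz[OF K_test(1) times(2) I_subset] by blast
  have "\<bar>Om i x t - Om i y t\<bar> \<le> (L1 + L2) * norm (x - y)"
    if "t \<in> I" "x \<in> cball 0 r" "y \<in> cball 0 r" for t x y
    using bspec[OF bspec[OF bspec[OF L1 that(1)] that(2)] that(3)]
      bspec[OF bspec[OF bspec[OF L2 that(1)] that(2)] that(3)]
    unfolding Om_def vort_def by (simp add: distrib_right abs_le_iff)
  then show ?thesis by blast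
qed

lemma vorticity_lipschitz:
  "\<exists>L. \<forall>t\<in>I. \<forall>x\<in>cball 0 r. \<forall>y\<in>cball 0 r.
    norm (filtered_vorticity \<phi> l u x t - filtered_vorticity \<phi> l u y t) \<le> L * norm (x - y)"
proof -
  have "\<forall>i. \<exists>L. \<forall>t\<in>I. \<forall>x\<in>cball 0 r. \<forall>y\<in>cball 0 r. \<bar>Om i x t - Om i y t\<bar> \<le> L * norm (x - y)"
    using Om_lipschitz by blast
  from choice[OF this] obtain L where
    L: "\<forall>i. \<forall>t\<in>I. \<forall>x\<in>cball 0 r. \<forall>y\<in>cball 0 r. \<bar>Om i x t - Om i y t\<bar> \<le> L i * norm (x - y)"
    by blast
  have "norm (filtered_vorticity \<phi> l u x t - filtered_vorticity \<phi> l u y t) \<le> (\<Sum>i\<in>UNIV. L i) * norm (x - y)"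
    if that: "t \<in> I" "x \<in> cball 0 r" "y \<in> cball 0 r" for t x y
  proof -
    have "norm (filtered_vorticity \<phi> l u x t - filtered_vorticity \<phi> l u y t)
        \<le> (\<Sum>i\<in>UNIV. \<bar>(filtered_vorticity \<phi> l u x t - filtered_vorticity \<phi> l u y t) $ i\<bar>)"
      by (rule norm_le_l1_cart)
    also have "\<dots> \<le> (\<Sum>i\<in>UNIV. L i * norm (x - y))"
      by (rule sum_mono) (use L that in \<open>simp add: vorticity_nth[OF I_T]\<close>)
    finally show ?thesis by (simp add: sum_distrib_right)
  qed
  then show ?thesis by blast
qed

lemma vorticity_slab: "continuous_on (UNIV \<times> I) (\<lambda>(x, t). filtered_vorticity \<phi> l u x t)"
proof -
  have "continuous_on (UNIV \<times> I) (\<lambda>z. \<chi> i. Om i (fst z) (snd z))"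
    by (intro continuous_on_vec_lambda Om_slab)
  then show ?thesis
    by (rule continuous_on_eq) (auto simp: vec_eq_iff vorticity_nth[OF I_T])
qed

lemma near_slab: "continuous_on (UNIV \<times> I) near"
  using strain_integral_continuous[OF vorticity_slab vorticity_lipschitz]
  unfolding near_def[abs_def] case_prod_unfold by (intro continuous_intros)

text \<open>Translations by at most \<open>d\<close> stay in the ball of radius
  \<open>norm x + d\<close>, where the vorticity is Lipschitz; there the principal value exists, and
  \<open>Lim\<close> picks that limit.\<close>

lemma near_strain_eq:
  assumes t: "t \<in> I"
  shows "near_strain \<theta> d \<phi> l u x t = near (x, t)"
proof -
  obtain L where L: "\<forall>t\<in>I. \<forall>y\<in>cball 0 (norm x + d). \<forall>z\<in>cball 0 (norm x + d).
    norm (filtered_vorticity \<phi> l u y t - filtered_vorticity \<phi> l u z t) \<le> L * norm (y - z)"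
    using vorticity_lipschitz by blast
  have c: "continuous_on UNIV (\<lambda>y. filtered_vorticity \<phi> l u y t)"
    using slab_continuous_slice[OF vorticity_slab t] by simp
  have "norm (filtered_vorticity \<phi> l u (x - z) t - filtered_vorticity \<phi> l u x t) \<le> L * norm z"
    if "norm z \<le> d" for z
  proof -
    have "x - z \<in> cball 0 (norm x + d)" "x \<in> cball 0 (norm x + d)"
      using norm_triangle_ineq4[of x z] that d_pos by auto
    from bspec[OF bspec[OF bspec[OF L t] this(1)] this(2)] show ?thesis by simp
  qed
  from tendsto_Lim[OF trivial_limit_at_right_real principal_value[OF c this]]
  show ?thesis
    unfolding near_strain_def near_def by simp
qed

lemma slab_functions:
  "continuous_on (UNIV \<times> I) fP" "continuous_on (UNIV \<times> I) fN"
  "continuous_on (UNIV \<times> I) fM" "continuous_on (UNIV \<times> I) fL"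
proof -
  show "continuous_on (UNIV \<times> I) fP"
    unfolding fP_def[abs_def] by (intro continuous_intros Om_slab \<eta>_space)
  show "continuous_on (UNIV \<times> I) fN"
    unfolding fN_def[abs_def] by (intro continuous_intros Om_slab \<eta>_space near_slab)
  show "continuous_on (UNIV \<times> I) fM"
    unfolding fM_def[abs_def] by (intro continuous_intros Om_slab \<eta>_space near_slab V_slab K_test) auto
  show "continuous_on (UNIV \<times> I) fL"
    unfolding fL_def[abs_def] by (intro continuous_intros Om_slab \<eta>_space \<eta>_time V_slab K)
qed

lemma slab_functions_support:
  assumes "t \<in> I" "R < norm x"
  shows "fP (x, t) = 0" "fN (x, t) = 0" "fM (x, t) = 0" "fL (x, t) = 0" "fR (x, t) = 0"
  using \<eta>_zero_outside[OF assms]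
  by (simp_all add: fP_def fN_def fM_def fL_def fR_def)

section \<open>Flux and pointwise enstrophy identity\<close>

lemma flux_C1:
  assumes t: "t \<in> I"
  shows "C1 (\<lambda>x. flux j x t)"
  unfolding flux_def q_def power2_eq_square
  by (intro C1_diff C1_mult C1_sum C1_const Om_pd \<eta>_space t I_T V_pd K) auto

lemma pd_square_sum:
  assumes t: "t \<in> T"
  shows "C1 (\<lambda>x. q x t)" "pd j (\<lambda>x. q x t) x = (\<Sum>i\<in>UNIV. 2 * (Om i x t * dOm j i x t))"
proof -
  show "C1 (\<lambda>x. q x t)"
    unfolding q_def power2_eq_square by (intro C1_mult C1_sum Om_pd t) auto
  have "pd j (\<lambda>x. \<Sum>i\<in>UNIV. (Om i x t)\<^sup>2) x = (\<Sum>i\<in>UNIV. pd j (\<lambda>x. Om i x t * Om i x t) x)"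
    unfolding power2_eq_square
    by (rule pd_sum) (auto intro!: C1D C1_mult Om_pd t)
  also have "\<dots> = (\<Sum>i\<in>UNIV. 2 * (Om i x t * dOm j i x t))"
    by (rule sum.cong) (simp_all add: pd_mult C1D(1)[OF Om_pd(1)[OF t]] Om_pd(2)[OF t])
  finally show "pd j (\<lambda>x. q x t) x = (\<Sum>i\<in>UNIV. 2 * (Om i x t * dOm j i x t))"
    unfolding q_def .
qed

text \<open>Product rule only; no cancellation is carried out, so that the result has literally the
  form of the divergence terms in \<open>enstrophy_density_identity\<close>.\<close>

lemma pd_flux:
  assumes t: "t \<in> I"
  shows "pd j (\<lambda>x. flux j x t) x =
    \<eta>p j x t * (\<Sum>i\<in>UNIV. 2 * (Om i x t * dOm j i x t))
      + \<eta> x t * (\<Sum>i\<in>UNIV. 2 * ((dOm j i x t)\<^sup>2 + Om i x t * ddOm j i x t))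
      - ((\<Sum>i\<in>UNIV. 2 * (Om i x t * dOm j i x t)) * \<eta>p j x t + q x t * \<eta>pp j x t)
      - (\<eta>p j x t * (V K j x t * q x t)
         + \<eta> x t * (V (pd j K) j x t * q x t + V K j x t * (\<Sum>i\<in>UNIV. 2 * (Om i x t * dOm j i x t))))"
proof -
  note tT = I_T[OF t]
  let ?g = "\<lambda>x. \<Sum>i\<in>UNIV. 2 * (Om i x t * dOm j i x t)"
  note d\<eta> = C1D(1)[OF \<eta>_space(1)[OF t]]
  note d\<eta>p = C1D(1)[OF \<eta>_space(2)[OF t]]
  note dq = C1D(1)[OF pd_square_sum(1)[OF tT]]
  note dU = V_pd(1)[OF tT K]
  have gC: "C1 ?g"
    by (intro C1_sum C1_mult C1_const Om_pd tT) auto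
  note dg = C1D(1)[OF gC]
  have pg: "pd j ?g x = (\<Sum>i\<in>UNIV. 2 * ((dOm j i x t)\<^sup>2 + Om i x t * ddOm j i x t))"
  proof -
    have "pd j ?g x = (\<Sum>i\<in>UNIV. pd j (\<lambda>x. 2 * (Om i x t * dOm j i x t)) x)"
      by (rule pd_sum) (auto intro!: C1D C1_mult C1_const Om_pd tT)
    also have "\<dots> = (\<Sum>i\<in>UNIV. 2 * ((dOm j i x t)\<^sup>2 + Om i x t * ddOm j i x t))"
    proof (rule sum.cong[OF refl])
      fix i
      have "pd j (\<lambda>x. 2 * (Om i x t * dOm j i x t)) x = pd j (\<lambda>x. 2) x * (Om i x t * dOm j i x t)
          + 2 * pd j (\<lambda>x. Om i x t * dOm j i x t) x"
        by (rule pd_mult) (intro C1D C1_mult C1_const Om_pd tT)+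
      also have "pd j (\<lambda>x. 2::real) x = 0"
        by (rule pd_eqI[OF has_derivative_const])
      also have "pd j (\<lambda>x. Om i x t * dOm j i x t) x = dOm j i x t * dOm j i x t + Om i x t * ddOm j i x t"
        using pd_mult[OF C1D(1)[OF Om_pd(1)[OF tT]] C1D(1)[OF Om_pd(3)[OF tT]]] by (simp add: Om_pd tT)
      finally show "pd j (\<lambda>x. 2 * (Om i x t * dOm j i x t)) x = 2 * ((dOm j i x t)\<^sup>2 + Om i x t * ddOm j i x t)"
        by (simp add: power2_eq_square)
    qed
    finally show ?thesis .
  qed
  have "pd j (\<lambda>x. flux j x t) x = pd j (\<lambda>x. \<eta> x t * ?g x) x - pd j (\<lambda>x. q x t * \<eta>p j x t) x
      - pd j (\<lambda>x. \<eta> x t * (V K j x t * q x t)) x"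
    unfolding flux_def by (subst pd_diff; (subst pd_diff)?) (intro differentiable_diff differentiable_mult d\<eta> d\<eta>p dq dU dg refl)+
  also have "pd j (\<lambda>x. \<eta> x t * ?g x) x = \<eta>p j x t * ?g x + \<eta> x t * pd j ?g x"
    by (rule pd_mult[OF d\<eta> dg])
  also have "pd j (\<lambda>x. q x t * \<eta>p j x t) x = ?g x * \<eta>p j x t + q x t * \<eta>pp j x t"
    using pd_mult[OF dq d\<eta>p] by (simp only: pd_square_sum(2)[OF tT])
  also have "pd j (\<lambda>x. \<eta> x t * (V K j x t * q x t)) x
      = \<eta>p j x t * (V K j x t * q x t) + \<eta> x t * pd j (\<lambda>x. V K j x t * q x t) x"
    by (rule pd_mult[OF d\<eta> differentiable_mult[OF dU dq]])
  also have "pd j (\<lambda>x. V K j x t * q x t) x = V (pd j K) j x t * q x t + V K j x t * ?g x"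
    using pd_mult[OF dU dq] by (simp only: pd_square_sum(2)[OF tT] V_pd(2)[OF tT K])
  finally show ?thesis
    unfolding pg .
qed

text \<open>The algebraic identity evaluated on the filtered solution. The second hypothesis singles
  out the times at which the Borel versions are correct, which are almost all of them.\<close>

lemma density_identity:
  assumes t: "t \<in> I"
    and Q: "\<And>a j m n x. Q (pd j (pd a K)) m n x t = Qv (pd j (pd a K)) m n (x, t)"
  shows "fG (x, t) = (\<Sum>j\<in>UNIV. pd j (\<lambda>x. flux j x t) x) + fL (x, t) - 2 * fP (x, t)
    + 2 * (fN (x, t) + fM (x, t)) + 2 * fR (x, t)"
proof -
  note tT = I_T[OF t]
  \<comment> \<open>The near-field terms cancel: the algebraic identity involves only the full
    strain, and the decomposition into near field and remainder is reinstated here.\<close>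
  have S: "fN (x, t) + fM (x, t) = \<eta> x t * (\<Sum>i\<in>UNIV. \<Sum>j\<in>UNIV.
      (V (pd j K) i x t + V (pd i K) j x t) / 2 * (Om i x t * Om j x t))"
    by (simp add: fN_def fM_def distrib_left[symmetric] sum.distrib[symmetric] left_diff_distrib)
  show ?thesis
    unfolding S pd_flux[OF t]
    using enstrophy_density_identity[of "\<lambda>j m. V (pd j K) m x t" "\<lambda>i. rate (rot i) (rot (rot i)) x t"
        "\<lambda>j i. ddOm j i x t" "\<lambda>i. commutator_forcing \<phi> l u x t $ i" "\<lambda>j. V K j x t" "\<lambda>j i. dOm j i x t"
        "\<lambda>i. Om i x t" "q x t" "et x t" "\<eta> x t" "\<lambda>j. \<eta>p j x t" "\<lambda>j. \<eta>pp j x t",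
        OF divergence_free[OF tT] rate_eq[OF tT Q] q_def]
    by (simp add: fG_def fL_def fP_def fR_def)
qed

end

section \<open>Bounds uniform in space for almost every time\<close>

lemma AE_bounded_diff:
  fixes f g :: "'a \<times> real \<Rightarrow> real"
  assumes "\<exists>M. AE t in lborel. t \<in> I \<longrightarrow> (\<forall>x\<in>C. \<bar>f (x, t)\<bar> \<le> M)"
    "\<exists>M. AE t in lborel. t \<in> I \<longrightarrow> (\<forall>x\<in>C. \<bar>g (x, t)\<bar> \<le> M)"
  shows "\<exists>M. AE t in lborel. t \<in> I \<longrightarrow> (\<forall>x\<in>C. \<bar>f (x, t) - g (x, t)\<bar> \<le> M)"
proof -
  obtain M N where "AE t in lborel. t \<in> I \<longrightarrow> (\<forall>x\<in>C. \<bar>f (x, t)\<bar> \<le> M)"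
    "AE t in lborel. t \<in> I \<longrightarrow> (\<forall>x\<in>C. \<bar>g (x, t)\<bar> \<le> N)"
    using assms by blast
  then have "AE t in lborel. t \<in> I \<longrightarrow> (\<forall>x\<in>C. \<bar>f (x, t) - g (x, t)\<bar> \<le> M + N)"
  proof eventually_elim
    case (elim t)
    show ?case
    proof (intro impI ballI)
      fix x assume "t \<in> I" "x \<in> C"
      then have "\<bar>f (x, t)\<bar> \<le> M" "\<bar>g (x, t)\<bar> \<le> N"
        using elim by blast+
      then show "\<bar>f (x, t) - g (x, t)\<bar> \<le> M + N"
        using abs_triangle_ineq4[of "f (x, t)" "g (x, t)"] by linarith
    qed
  qed
  then show ?thesis by blast
qed

lemma AE_bounded_sum:
  fixes f :: "'i::finite \<Rightarrow> 'a \<times> real \<Rightarrow> real"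
  assumes "\<And>i. \<exists>M. AE t in lborel. t \<in> I \<longrightarrow> (\<forall>x\<in>C. \<bar>f i (x, t)\<bar> \<le> M)"
  shows "\<exists>M. AE t in lborel. t \<in> I \<longrightarrow> (\<forall>x\<in>C. \<bar>\<Sum>i\<in>UNIV. f i (x, t)\<bar> \<le> M)"
proof -
  have "\<forall>i. \<exists>M. AE t in lborel. t \<in> I \<longrightarrow> (\<forall>x\<in>C. \<bar>f i (x, t)\<bar> \<le> M)"
    using assms by blast
  from choice[OF this] obtain M where
    "\<And>i. AE t in lborel. t \<in> I \<longrightarrow> (\<forall>x\<in>C. \<bar>f i (x, t)\<bar> \<le> M i)"
    by blast
  then have "AE t in lborel. \<forall>i. t \<in> I \<longrightarrow> (\<forall>x\<in>C. \<bar>f i (x, t)\<bar> \<le> M i)"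
    unfolding AE_all_countable by blast
  then have "AE t in lborel. t \<in> I \<longrightarrow> (\<forall>x\<in>C. \<bar>\<Sum>i\<in>UNIV. f i (x, t)\<bar> \<le> (\<Sum>i\<in>UNIV. M i))"
  proof eventually_elim
    case (elim t)
    show ?case
    proof (intro impI ballI)
      fix x assume "t \<in> I" "x \<in> C"
      then have "\<bar>f i (x, t)\<bar> \<le> M i" for i
        using elim by blast
      then show "\<bar>\<Sum>i\<in>UNIV. f i (x, t)\<bar> \<le> (\<Sum>i\<in>UNIV. M i)"
        by (intro order_trans[OF sum_abs] sum_mono)
    qed
  qed
  then show ?thesis by blast
qed

section \<open>Exchange of space and time integration\<close>

context weighted_enstrophy
begin

lemma Qv_AE_bounded:
  assumes k: "test_function UNIV k"
  shows "\<exists>M. AE t in lborel. t \<in> I \<longrightarrow> (\<forall>x\<in>cball 0 R. \<bar>Qv k m n (x, t)\<bar> \<le> M)"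
proof -
  obtain M where "AE t in lborel. t \<in> I \<longrightarrow> (\<forall>x\<in>cball 0 R. \<bar>Q k m n x t\<bar> \<le> M)"
    using Q_bounded[OF k I_subset] by blast
  then have "AE t in lborel. t \<in> I \<longrightarrow> (\<forall>x\<in>cball 0 R. \<bar>Qv k m n (x, t)\<bar> \<le> M)"
    using Q_eq_Qv[OF test_function_kernel(1)[OF k], of m n]
  proof eventually_elim
    case (elim t)
    show ?case
    proof (intro impI ballI)
      fix x :: "real^3" assume t: "t \<in> I" and x: "x \<in> cball 0 R"
      have "Q k m n x t = Qv k m n (x, t)"
        using elim(2) I_T[OF t] by blast
      moreover have "\<bar>Q k m n x t\<bar> \<le> M"
        using elim(1) t x by blast
      ultimately show "\<bar>Qv k m n (x, t)\<bar> \<le> M" by simp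
    qed
  qed
  then show ?thesis by blast
qed

text \<open>Everything in \<open>fG\<close> that is continuous on the slab. With
  \<open>coupling\<close> and \<open>quadratic_part\<close> it realises the decomposition to which
  \<open>slab_fubini\<close> applies; the quadratic part is the only contribution that is irregular
  in time.\<close>

definition regular_part :: "(real^3) \<times> real \<Rightarrow> real" where
  "regular_part z = et (fst z) (snd z) * q (fst z) (snd z)
     + 2 * \<eta> (fst z) (snd z) * (\<Sum>i\<in>UNIV. Om i (fst z) (snd z) * (\<Sum>j\<in>UNIV. ddOm j i (fst z) (snd z)))"

definition coupling :: "3 \<Rightarrow> (real^3) \<times> real \<Rightarrow> real" where
  "coupling i z = - (2 * \<eta> (fst z) (snd z) * Om i (fst z) (snd z))"

definition quadratic_part :: "3 \<Rightarrow> (real^3) \<times> real \<Rightarrow> real" where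
  "quadratic_part i z = (\<Sum>j\<in>UNIV. Qv (pd j (pd (rot i) K)) (rot (rot i)) j z - Qv (pd j (pd (rot (rot i)) K)) (rot i) j z)"

lemma fG_split: "fG z = regular_part z + (\<Sum>i\<in>UNIV. coupling i z * quadratic_part i z)"
proof -
  have "rate (rot i) (rot (rot i)) (fst z) (snd z) = (\<Sum>j\<in>UNIV. ddOm j i (fst z) (snd z)) - quadratic_part i z" for i
    by (simp add: rate_def ddOm_def quadratic_part_def)
  then show ?thesis
    by (simp add: fG_def regular_part_def coupling_def right_diff_distrib sum_subtractf sum_distrib_left sum_negf mult.assoc)
qed

lemma fG_fubini:
  "set_integrable lborel I (\<lambda>t. LINT x|lborel. fG (x, t))"
  "(LINT x|lborel. (LINT t:I|lborel. fG (x, t))) = (LINT t:I|lborel. LINT x|lborel. fG (x, t))"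
proof -
  have A: "continuous_on (UNIV \<times> I) regular_part"
    unfolding regular_part_def[abs_def] by (intro continuous_intros Om_slab \<eta>_space \<eta>_time)
  have A0: "regular_part (x, t) = 0" if "t \<in> I" "R < norm x" for x t
    using \<eta>_zero_outside[OF that] by (simp add: regular_part_def)
  have G: "continuous_on (UNIV \<times> I) (coupling i)" for i
    unfolding coupling_def[abs_def] by (intro continuous_intros Om_slab \<eta>_space)
  have G0: "coupling i (x, t) = 0" if "t \<in> I" "R < norm x" for i x t
    using \<eta>_zero_outside[OF that] by (simp add: coupling_def)
  have q: "quadratic_part i \<in> borel_measurable borel" for i
    unfolding quadratic_part_def[abs_def]
    by (intro borel_measurable_sum borel_measurable_diff Qv_borel test_function_kernel(1) K_test)
  have qb: "\<exists>M. AE t in lborel. t \<in> I \<longrightarrow> (\<forall>x\<in>cball 0 R. \<bar>quadratic_part i (x, t)\<bar> \<le> M)" for i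
    unfolding quadratic_part_def
    by (intro AE_bounded_sum AE_bounded_diff Qv_AE_bounded K_test)
  note F = slab_fubini[OF A A0 G G0 q qb]
  show "set_integrable lborel I (\<lambda>t. LINT x|lborel. fG (x, t))"
    unfolding fG_split by (rule F(1))
  show "(LINT x|lborel. (LINT t:I|lborel. fG (x, t))) = (LINT t:I|lborel. LINT x|lborel. fG (x, t))"
    unfolding fG_split by (rule F(2))
qed

text \<open>At fixed \<open>x\<close> each vorticity component is a bounded primitive of its rate
  and the weight is continuously differentiable in time, so the product rule for bounded primitives
  gives the increment of the weighted density.\<close>

lemma pointwise_balance: "\<eta> x s1 * q x s1 - \<eta> x s0 * q x s0 = (LINT t:I|lborel. fG (x, t))"
proof -
  let ?r = "\<lambda>i t. rate (rot i) (rot (rot i)) x t"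
  have vp: "bounded_primitive s0 s1 (Om i x) (?r i)" for i
    unfolding Om_def by (rule vort_primitive[OF times])
  have ec: "continuous_on I (et x)"
  proof -
    have "continuous_on I (\<lambda>t. (\<lambda>z. et (fst z) (snd z)) (x, t))"
      by (rule continuous_on_compose2[OF \<eta>_time(2)]) (auto intro!: continuous_intros)
    then show ?thesis by simp
  qed
  have "bounded_primitive s0 s1 (\<lambda>t. \<eta> x t * (\<Sum>i\<in>UNIV. Om i x t * Om i x t))
      (\<lambda>t. et x t * (\<Sum>i\<in>UNIV. Om i x t * Om i x t) + \<eta> x t * (\<Sum>i\<in>UNIV. ?r i t * Om i x t + Om i x t * ?r i t))"
    by (intro bounded_primitive_mult bounded_primitive_sum vp bounded_primitive_C1[OF \<eta>_time(1) ec] finite)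
  from bounded_primitiveD(1)[OF this order_refl less_imp_le[OF times(2)] order_refl]
  have "\<eta> x s1 * q x s1 - \<eta> x s0 * q x s0 = (LINT t:I|lborel. et x t * (\<Sum>i\<in>UNIV. Om i x t * Om i x t)
      + \<eta> x t * (\<Sum>i\<in>UNIV. ?r i t * Om i x t + Om i x t * ?r i t))"
    by (simp add: q_def power2_eq_square)
  also have "\<dots> = (LINT t:I|lborel. fG (x, t))"
  proof -
    have "(\<Sum>i\<in>UNIV. ?r i t * Om i x t + Om i x t * ?r i t) = 2 * (\<Sum>i\<in>UNIV. Om i x t * ?r i t)" for t
      by (simp add: sum_distrib_left mult.commute)
    then show ?thesis
      by (simp add: fG_def q_def power2_eq_square mult_ac)
  qed
  finally show ?thesis .
qed

text \<open>At a fixed good time all terms are continuous in \<open>x\<close> and compactly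
  supported, hence separately integrable, and the divergence of the flux integrates to zero.\<close>

lemma slice_integrals:
  assumes t: "t \<in> I" and Q: "\<And>a j m n x. Q (pd j (pd a K)) m n x t = Qv (pd j (pd a K)) m n (x, t)"
  shows "(LINT x|lborel. fG (x, t)) = (LINT x|lebesgue. fL (x, t)) - 2 * (LINT x|lebesgue. fP (x, t))
    + 2 * ((LINT x|lebesgue. fN (x, t)) + (LINT x|lebesgue. fM (x, t))) + 2 * (LINT x|lebesgue. fR (x, t))"
proof -
  note tT = I_T[OF t]
  note c = slab_functions[THEN slab_continuous_slice[OF _ t]]
  have cR: "continuous_on UNIV (\<lambda>x. fR (x, t))"
    unfolding fR_def fst_conv snd_conv
    by (intro continuous_intros C1D(3)[OF \<eta>_space(1)[OF t]] forcing_continuous[OF tT] C1D(3)[OF Om_pd(1)[OF tT]])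
  have cF: "continuous_on UNIV (pd j (\<lambda>x. flux j x t))" for j
    by (rule C1D(2)[OF flux_C1[OF t]])
  have flux0: "flux j x t = 0" if "R < norm x" for j x
    using \<eta>_zero_outside[OF t that] by (simp add: flux_def)
  note iF = integral_pd_C1[OF flux_C1[OF t] flux0]
  have i: "integrable lebesgue (\<lambda>x. fP (x, t))" "integrable lebesgue (\<lambda>x. fN (x, t))"
    "integrable lebesgue (\<lambda>x. fM (x, t))" "integrable lebesgue (\<lambda>x. fL (x, t))" "integrable lebesgue (\<lambda>x. fR (x, t))"
    using slab_functions_support[OF t] by (auto intro!: continuous_compact_support_integrable c cR)
  have eq: "(\<lambda>x. fG (x, t)) = (\<lambda>x. (\<Sum>j\<in>UNIV. pd j (\<lambda>x. flux j x t) x) + fL (x, t) - 2 * fP (x, t)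
    + 2 * (fN (x, t) + fM (x, t)) + 2 * fR (x, t))"
    by (rule ext) (rule density_identity[OF t Q])
  have "continuous_on UNIV (\<lambda>x. fG (x, t))"
    unfolding eq by (intro continuous_intros c cR cF)
  then have "(\<lambda>x. fG (x, t)) \<in> borel_measurable lborel"
    unfolding measurable_lborel2 by (rule borel_measurable_continuous_onI)
  then have "(LINT x|lborel. fG (x, t)) = (LINT x|lebesgue. fG (x, t))"
    by (rule integral_completion[symmetric])
  also have "\<dots> = (LINT x|lebesgue. fL (x, t)) - 2 * (LINT x|lebesgue. fP (x, t))
    + 2 * ((LINT x|lebesgue. fN (x, t)) + (LINT x|lebesgue. fM (x, t))) + 2 * (LINT x|lebesgue. fR (x, t))"
    unfolding eq using i iF by simp
  finally show ?thesis .
qed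

lemma Q_eq_Qv_all:
  "AE t in lborel. t \<in> T \<longrightarrow> (\<forall>a j m n x. Q (pd j (pd a K)) m n x t = Qv (pd j (pd a K)) m n (x, t))"
proof -
  have "AE t in lborel. \<forall>a j m n. t \<in> T \<longrightarrow> (\<forall>x. Q (pd j (pd a K)) m n x t = Qv (pd j (pd a K)) m n (x, t))"
    unfolding AE_all_countable by (intro allI Q_eq_Qv test_function_kernel(1) K_test)
  then show ?thesis
    by eventually_elim blast
qed

lemma energy_integral:
  assumes "t \<in> I"
  shows "integrable lborel (\<lambda>x. \<eta> x t * q x t)"
    "(LINT x|lebesgue. \<eta> x t * (norm (filtered_vorticity \<phi> l u x t))\<^sup>2) = (LINT x|lborel. \<eta> x t * q x t)"
proof -
  have c: "continuous_on UNIV (\<lambda>x. \<eta> x t * q x t)"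
    by (intro continuous_intros C1D(3)[OF \<eta>_space(1)[OF assms]] C1D(3)[OF pd_square_sum(1)[OF I_T[OF assms]]])
  have m: "(\<lambda>x. \<eta> x t * q x t) \<in> borel_measurable lborel"
    unfolding measurable_lborel2 by (rule borel_measurable_continuous_onI[OF c])
  have "integrable lebesgue (\<lambda>x. \<eta> x t * q x t)"
    by (rule continuous_compact_support_integrable[OF c, where R=R]) (use \<eta>_zero_outside(1)[OF assms] in simp)
  then show "integrable lborel (\<lambda>x. \<eta> x t * q x t)"
    using integrable_completion[OF m] by blast
  show "(LINT x|lebesgue. \<eta> x t * (norm (filtered_vorticity \<phi> l u x t))\<^sup>2) = (LINT x|lborel. \<eta> x t * q x t)"
    unfolding vorticity_norm[OF I_T[OF assms]] q_def[symmetric] by (rule integral_completion[OF m])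
qed

text \<open>The spatial integrals of the two end states differ by the space-time integral of
  \<open>fG\<close>, which is evaluated slice by slice. \<open>iX fR\<close> involves the pointwise
  \<open>Q\<close>, so its measurability in time is not given in advance; equality almost everywhere
  with a combination of integrable functions supplies both measurability and integral.\<close>

lemma enstrophy_balance:
  "(LINT x|lebesgue. \<eta> x s1 * (norm (filtered_vorticity \<phi> l u x s1))\<^sup>2)
     - (LINT x|lebesgue. \<eta> x s0 * (norm (filtered_vorticity \<phi> l u x s0))\<^sup>2)
     + 2 * (LINT t:I|lebesgue. LINT x|lebesgue. fP (x, t))
   = 2 * (LINT t:I|lebesgue. LINT x|lebesgue. fN (x, t)) + 2 * (LINT t:I|lebesgue. LINT x|lebesgue. fM (x, t))
     + 2 * (LINT t:I|lebesgue. LINT x|lebesgue. fR (x, t)) + (LINT t:I|lebesgue. LINT x|lebesgue. fL (x, t))"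
proof -
  have sI: "s0 \<in> I" "s1 \<in> I" using times by auto
  define iX where "iX f t = indicator I t * (LINT x|lebesgue. f (x, t))" for f :: "(real^3) \<times> real \<Rightarrow> real" and t
  define g where "g t = indicator I t * (LINT x|lborel. fG (x, t))" for t
  have i: "integrable lebesgue (iX fP)" "integrable lebesgue (iX fN)" "integrable lebesgue (iX fM)" "integrable lebesgue (iX fL)"
    using slab_integrals[OF slab_functions(1), where R=R] slab_integrals[OF slab_functions(2), where R=R]
      slab_integrals[OF slab_functions(3), where R=R] slab_integrals[OF slab_functions(4), where R=R]
      slab_functions_support
    unfolding set_integrable_def iX_def[abs_def] by simp_all
  have gi: "integrable lborel g"
    using fG_fubini(1) unfolding set_integrable_def g_def[abs_def] by simp
  then have gl: "integrable lebesgue g" "(LINT t|lebesgue. g t) = (LINT t|lborel. g t)"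
    using integrable_completion[OF borel_measurable_integrable] integral_completion[OF borel_measurable_integrable] by blast+
  \<comment> \<open>The identity of \<open>slice_integrals\<close>, solved for the forcing
    term.\<close>
  have ae: "AE t in lebesgue. g t / 2 - iX fL t / 2 + iX fP t - iX fN t - iX fM t = iX fR t"
    unfolding AE_completion_iff using Q_eq_Qv_all
  proof eventually_elim
    case (elim t)
    show ?case
    proof (cases "t \<in> I")
      case True
      have "Q (pd j (pd a K)) m n x t = Qv (pd j (pd a K)) m n (x, t)" for a j m n x
        using elim I_T[OF True] by blast
      from slice_integrals[OF True this] True show ?thesis
        by (simp add: g_def iX_def field_simps)
    qed (simp add: g_def iX_def)
  qed
  have lhs: "integrable lebesgue (\<lambda>t. g t / 2 - iX fL t / 2 + iX fP t - iX fN t - iX fM t)"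
    using i gl(1) by simp
  have Rm: "iX fR \<in> borel_measurable lebesgue"
    by (rule borel_measurable_AE[OF borel_measurable_integrable[OF lhs] ae])
  have "(LINT t|lebesgue. iX fR t) = (LINT t|lebesgue. g t / 2 - iX fL t / 2 + iX fP t - iX fN t - iX fM t)"
    by (rule integral_cong_AE[OF Rm borel_measurable_integrable[OF lhs]]) (use ae in eventually_elim, simp)
  also have "\<dots> = (LINT t|lebesgue. g t) / 2 - (LINT t|lebesgue. iX fL t) / 2 + (LINT t|lebesgue. iX fP t)
      - (LINT t|lebesgue. iX fN t) - (LINT t|lebesgue. iX fM t)"
    using i gl(1) by simp
  finally have R: "(LINT t|lebesgue. iX fR t) = \<dots>" .
  have "(LINT x|lborel. \<eta> x s1 * q x s1) - (LINT x|lborel. \<eta> x s0 * q x s0)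
      = (LINT x|lborel. \<eta> x s1 * q x s1 - \<eta> x s0 * q x s0)"
    using energy_integral(1)[OF sI(1)] energy_integral(1)[OF sI(2)] by simp
  also have "\<dots> = (LINT t|lborel. g t)"
    unfolding pointwise_balance fG_fubini(2) g_def by (simp add: set_lebesgue_integral_def)
  finally have E: "(LINT x|lborel. \<eta> x s1 * q x s1) - (LINT x|lborel. \<eta> x s0 * q x s0) = (LINT t|lebesgue. g t)"
    using gl(2) by simp
  have set: "(LINT t:I|lebesgue. LINT x|lebesgue. f (x, t)) = (LINT t|lebesgue. iX f t)" for f
    by (simp add: set_lebesgue_integral_def iX_def)
  show ?thesis
    unfolding energy_integral(2)[OF sI(1)] energy_integral(2)[OF sI(2)] E set R by (simp add: field_simps)
qed

section \<open>Agreement with the integrands of the statement\<close>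

lemma integrands:
  assumes t: "t \<in> I"
  shows "\<eta> x t * (norm (jacobian (\<lambda>y. filtered_vorticity \<phi> l u y t) (at x)))\<^sup>2 = fP (x, t)"
    "\<eta> x t * ((near_strain \<theta> d \<phi> l u x t *v filtered_vorticity \<phi> l u x t) \<bullet> filtered_vorticity \<phi> l u x t) = fN (x, t)"
    "\<eta> x t * ((rem_strain \<theta> d \<phi> l u x t *v filtered_vorticity \<phi> l u x t) \<bullet> filtered_vorticity \<phi> l u x t) = fM (x, t)"
    "\<eta> x t * (commutator_forcing \<phi> l u x t \<bullet> filtered_vorticity \<phi> l u x t) = fR (x, t)"
    "(norm (filtered_vorticity \<phi> l u x t))\<^sup>2 * (vector_derivative (\<lambda>s. \<eta> x s) (at t within I)
       + laplacian (\<lambda>y. \<eta> y t) x + filtered_velocity \<phi> l u x t \<bullet> grad (\<lambda>y. \<eta> y t) x) = fL (x, t)"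
proof -
  note tT = I_T[OF t]
  show "\<eta> x t * (norm (jacobian (\<lambda>y. filtered_vorticity \<phi> l u y t) (at x)))\<^sup>2 = fP (x, t)"
    by (simp add: norm_jacobian_squared vorticity_pd[OF tT] fP_def)
  show "\<eta> x t * ((near_strain \<theta> d \<phi> l u x t *v filtered_vorticity \<phi> l u x t) \<bullet> filtered_vorticity \<phi> l u x t) = fN (x, t)"
    by (simp add: matrix_vector_inner near_strain_eq[OF t] vorticity_nth[OF tT] fN_def)
  show "\<eta> x t * ((rem_strain \<theta> d \<phi> l u x t *v filtered_vorticity \<phi> l u x t) \<bullet> filtered_vorticity \<phi> l u x t) = fM (x, t)"
    by (simp add: matrix_vector_inner rem_strain_def near_strain_eq[OF t] strain_nth[OF tT] vorticity_nth[OF tT] fM_def)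
  show "\<eta> x t * (commutator_forcing \<phi> l u x t \<bullet> filtered_vorticity \<phi> l u x t) = fR (x, t)"
    by (simp add: inner_vec_def vorticity_nth[OF tT] fR_def)
  show "(norm (filtered_vorticity \<phi> l u x t))\<^sup>2 * (vector_derivative (\<lambda>s. \<eta> x s) (at t within I)
       + laplacian (\<lambda>y. \<eta> y t) x + filtered_velocity \<phi> l u x t \<bullet> grad (\<lambda>y. \<eta> y t) x) = fL (x, t)"
    by (simp add: vorticity_norm[OF tT] q_def[symmetric] et_def[symmetric] laplacian_def grad_def inner_vec_def
        velocity_nth[OF tT] fL_def)
qed

lemma time_integrals:
  "(LINT t:I|lebesgue. LINT x|lebesgue. \<eta> x t * (norm (jacobian (\<lambda>y. filtered_vorticity \<phi> l u y t) (at x)))\<^sup>2)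
    = (LINT t:I|lebesgue. LINT x|lebesgue. fP (x, t))"
  "(LINT t:I|lebesgue. LINT x|lebesgue.
      \<eta> x t * ((near_strain \<theta> d \<phi> l u x t *v filtered_vorticity \<phi> l u x t) \<bullet> filtered_vorticity \<phi> l u x t))
    = (LINT t:I|lebesgue. LINT x|lebesgue. fN (x, t))"
  "(LINT t:I|lebesgue. LINT x|lebesgue.
      \<eta> x t * ((rem_strain \<theta> d \<phi> l u x t *v filtered_vorticity \<phi> l u x t) \<bullet> filtered_vorticity \<phi> l u x t))
    = (LINT t:I|lebesgue. LINT x|lebesgue. fM (x, t))"
  "(LINT t:I|lebesgue. LINT x|lebesgue. \<eta> x t * (commutator_forcing \<phi> l u x t \<bullet> filtered_vorticity \<phi> l u x t))
    = (LINT t:I|lebesgue. LINT x|lebesgue. fR (x, t))"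
  "(LINT t:I|lebesgue. LINT x|lebesgue.
      (norm (filtered_vorticity \<phi> l u x t))\<^sup>2 * (vector_derivative (\<lambda>s. \<eta> x s) (at t within I)
       + laplacian (\<lambda>y. \<eta> y t) x + filtered_velocity \<phi> l u x t \<bullet> grad (\<lambda>y. \<eta> y t) x))
    = (LINT t:I|lebesgue. LINT x|lebesgue. fL (x, t))"
proof -
  have cong: "(LINT t:I|lebesgue. LINT x|lebesgue. f x t) = (LINT t:I|lebesgue. LINT x|lebesgue. g x t)"
    if "\<And>x t. t \<in> I \<Longrightarrow> f x t = g x t" for f g :: "real^3 \<Rightarrow> real \<Rightarrow> real"
    by (rule set_lebesgue_integral_cong) (use that in auto)
  show "(LINT t:I|lebesgue. LINT x|lebesgue. \<eta> x t * (norm (jacobian (\<lambda>y. filtered_vorticity \<phi> l u y t) (at x)))\<^sup>2)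
    = (LINT t:I|lebesgue. LINT x|lebesgue. fP (x, t))"
    by (rule cong, rule integrands, assumption)
  show "(LINT t:I|lebesgue. LINT x|lebesgue.
      \<eta> x t * ((near_strain \<theta> d \<phi> l u x t *v filtered_vorticity \<phi> l u x t) \<bullet> filtered_vorticity \<phi> l u x t))
    = (LINT t:I|lebesgue. LINT x|lebesgue. fN (x, t))"
    by (rule cong, rule integrands, assumption)
  show "(LINT t:I|lebesgue. LINT x|lebesgue.
      \<eta> x t * ((rem_strain \<theta> d \<phi> l u x t *v filtered_vorticity \<phi> l u x t) \<bullet> filtered_vorticity \<phi> l u x t))
    = (LINT t:I|lebesgue. LINT x|lebesgue. fM (x, t))"
    by (rule cong, rule integrands, assumption)
  show "(LINT t:I|lebesgue. LINT x|lebesgue. \<eta> x t * (commutator_forcing \<phi> l u x t \<bullet> filtered_vorticity \<phi> l u x t))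
    = (LINT t:I|lebesgue. LINT x|lebesgue. fR (x, t))"
    by (rule cong, rule integrands, assumption)
  show "(LINT t:I|lebesgue. LINT x|lebesgue.
      (norm (filtered_vorticity \<phi> l u x t))\<^sup>2 * (vector_derivative (\<lambda>s. \<eta> x s) (at t within I)
       + laplacian (\<lambda>y. \<eta> y t) x + filtered_velocity \<phi> l u x t \<bullet> grad (\<lambda>y. \<eta> y t) x))
    = (LINT t:I|lebesgue. LINT x|lebesgue. fL (x, t))"
    by (rule cong, rule integrands, assumption)
qed

end

section \<open>The identity for a suitable weak solution\<close>

theorem proposition6p1:
  fixes x0 :: "real^3" and t0 r \<rho> l s0 s1 :: real and J :: "real set"
    and \<phi> \<theta> :: "real^3 \<Rightarrow> real"
    and u :: "real^3 \<Rightarrow> real \<Rightarrow> real^3" and p \<eta> :: "real^3 \<Rightarrow> real \<Rightarrow> real"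
  defines "U \<equiv> filtered_velocity \<phi> l u"
    and "\<Omega> \<equiv> filtered_vorticity \<phi> l u"
    and "S_near \<equiv> near_strain \<theta> (\<rho> * r) \<phi> l u"
    and "S_rem \<equiv> rem_strain \<theta> (\<rho> * r) \<phi> l u"
    and "F \<equiv> commutator_forcing \<phi> l u"
  defines "E_eta \<equiv> \<lambda>t. r / 2 * (LINT x|lebesgue. \<eta> x t * (norm (\<Omega> x t))\<^sup>2)"
    and "P_eta \<equiv> r * (LINT t:{s0..s1}|lebesgue. LINT x|lebesgue.
           \<eta> x t * (norm (jacobian (\<lambda>y. \<Omega> y t) (at x)))\<^sup>2)"
    and "V_near_eta \<equiv> r * (LINT t:{s0..s1}|lebesgue. LINT x|lebesgue.
           \<eta> x t * ((S_near x t *v \<Omega> x t) \<bullet> \<Omega> x t))"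
    and "V_rem_eta \<equiv> r * (LINT t:{s0..s1}|lebesgue. LINT x|lebesgue.
           \<eta> x t * ((S_rem x t *v \<Omega> x t) \<bullet> \<Omega> x t))"
    and "R_eta \<equiv> r * (LINT t:{s0..s1}|lebesgue. LINT x|lebesgue.
           \<eta> x t * (F x t \<bullet> \<Omega> x t))"
    and "L_eta \<equiv> r / 2 * (LINT t:{s0..s1}|lebesgue. LINT x|lebesgue.
           (norm (\<Omega> x t))\<^sup>2 *
             (vector_derivative (\<lambda>s. \<eta> x s) (at t within {s0..s1})
              + laplacian (\<lambda>y. \<eta> y t) x
              + U x t \<bullet> grad (\<lambda>y. \<eta> y t) x))"
  assumes filter: "test_function (ball 0 1) \<phi>" "\<And>x. 0 \<le> \<phi> x" "(LINT x|lebesgue. \<phi> x) = 1"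
    and cutoff: "test_function (ball 0 1) \<theta>" "\<And>x y. norm x = norm y \<Longrightarrow> \<theta> x = \<theta> y"
      "\<And>x. 0 \<le> \<theta> x" "\<And>x. \<theta> x \<le> 1" "\<And>x. x \<in> ball 0 (1/2) \<Longrightarrow> \<theta> x = 1"
    and scales: "0 < r" "0 < \<rho>" "\<rho> \<le> 1/4" "0 < l" "l \<le> \<rho> * r"
    and interval: "is_interval J" "{t0 - r\<^sup>2<..<t0} \<subseteq> J"
    and solution: "suitable_weak_solution J u p"
    and times: "s0 < s1" "{s0..s1} \<subseteq> {t0 - r\<^sup>2<..<t0}"
    and weight: "smooth_on (UNIV \<times> {s0..s1}) (\<lambda>(x, t). \<eta> x t)"
      "\<And>x t. t \<in> {s0..s1} \<Longrightarrow> 0 \<le> \<eta> x t"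
      "\<exists>K. compact K \<and> (\<forall>t\<in>{s0..s1}. \<forall>x. x \<notin> K \<longrightarrow> \<eta> x t = 0)"
  shows "E_eta s1 - E_eta s0 + P_eta = V_near_eta + V_rem_eta + R_eta + L_eta"
proof -
  define T where "T = interior J"
  obtain G where wc: "weakly_continuous_in_time T u" and ns: "weak_navier_stokes T u p"
    and le: "local_energy_class T u G"
    using solution unfolding suitable_weak_solution_def T_def by blast
  have oT: "open T" by (simp add: T_def)
  have "(\<lambda>(x, t). u x t) \<in> borel_measurable (lebesgue_on (UNIV \<times> T))"
    using le unfolding local_energy_class_def by blast
  moreover have "(UNIV :: (real^3) set) \<times> T \<in> sets lebesgue"
    using oT by (intro sets_completionI_sets) (simp add: open_Times borel_open)
  ultimately obtain v where v: "v \<in> borel_measurable borel"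
      "AE z in lborel. z \<in> UNIV \<times> T \<longrightarrow> (\<lambda>(x, t). u x t) z = v z"
    using lebesgue_on_borel_version by blast
  have vae: "AE z in lborel. snd z \<in> T \<longrightarrow> u (fst z) (snd z) = v z"
    using v(2) by eventually_elim (auto simp: case_prod_unfold mem_Times_iff)
  have en: "\<exists>C. AE t in lborel. t \<in> {a..b} \<longrightarrow> (LINT x:cball 0 R|lebesgue. (norm (u x t))\<^sup>2) \<le> C"
    if "{a..b} \<subseteq> T" for R a b
    using le that unfolding local_energy_class_def AE_completion_iff by blast
  obtain \<beta> B :: "real \<Rightarrow> real" where step: "smooth_on UNIV \<beta>" "smooth_on UNIV B" "\<And>t. 0 \<le> \<beta> t"
    "\<And>t. (B has_real_derivative \<beta> t) (at t)" "\<And>t. 2 < \<bar>t\<bar> \<Longrightarrow> \<beta> t = 0"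
    "\<And>t. t \<le> -2 \<Longrightarrow> B t = 0" "\<And>t. 2 \<le> t \<Longrightarrow> B t = 1"
    using smooth_step_exists[OF filter] by blast
  obtain R where R: "\<And>x t. t \<in> {s0..s1} \<Longrightarrow> R < norm x \<Longrightarrow> \<eta> x t = 0"
  proof -
    obtain C where C: "compact C" "\<forall>t\<in>{s0..s1}. \<forall>x. x \<notin> C \<longrightarrow> \<eta> x t = 0"
      using weight(3) by blast
    obtain R where "\<forall>x\<in>C. norm x \<le> R"
      using compact_imp_bounded[OF C(1)] unfolding bounded_iff by blast
    then have "x \<notin> C" if "R < norm x" for x
      using that by force
    with C(2) show thesis by (intro that[of R]) blast
  qed
  \<comment> \<open>Midpoints between \<open>{s0..s1}\<close> and the ends of the given open time
    interval: the closed interval from \<open>c\<close> to \<open>e\<close> contains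
    \<open>{s0..s1}\<close> in its interior and still lies in the interior of
    \<open>J\<close>.\<close>
  define c where "c = (t0 - r\<^sup>2 + s0) / 2"
  define e where "e = (s1 + t0) / 2"
  have s: "t0 - r\<^sup>2 < s0" "s1 < t0"
    using times(1) subsetD[OF times(2), of s0] subsetD[OF times(2), of s1] by auto
  have ce: "c < s0" "s1 < e" "{c..e} \<subseteq> T"
  proof -
    show "c < s0" "s1 < e" using s by (auto simp: c_def e_def)
    have "{c..e} \<subseteq> {t0 - r\<^sup>2<..<t0}" using s by (auto simp: c_def e_def)
    also have "\<dots> \<subseteq> T"
      unfolding T_def by (rule interior_maximal[OF interval(2)]) simp
    finally show "{c..e} \<subseteq> T" .
  qed
  interpret weighted_enstrophy T u v \<beta> B p \<phi> l \<theta> "\<rho> * r" \<eta> c s0 s1 e R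
  proof unfold_locales
    show "0 < \<rho> * r" using scales by simp
    show "test_function UNIV (rescaled \<phi> l)"
      by (rule test_function_rescaled[OF filter(1) scales(4)])
  qed (fact oT v(1) vae wc en step ns cutoff ce times(1) weight(1) R)+
  have "E_eta s1 - E_eta s0 + P_eta = r / 2 * ((LINT x|lebesgue. \<eta> x s1 * (norm (filtered_vorticity \<phi> l u x s1))\<^sup>2)
     - (LINT x|lebesgue. \<eta> x s0 * (norm (filtered_vorticity \<phi> l u x s0))\<^sup>2)
     + 2 * (LINT t:{s0..s1}|lebesgue. LINT x|lebesgue. fP (x, t)))"
    unfolding E_eta_def P_eta_def \<Omega>_def time_integrals by (simp add: algebra_simps)
  also have "\<dots> = V_near_eta + V_rem_eta + R_eta + L_eta"
    unfolding enstrophy_balance V_near_eta_def V_rem_eta_def R_eta_def L_eta_def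
      \<Omega>_def S_near_def S_rem_def F_def U_def time_integrals by (simp add: algebra_simps)
  finally show ?thesis .
qed

end
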